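(* Let $X=X_1\times X_2\times\cdots\times X_r$ be a product of locally compact Hadamard spaces and let $\Gamma<\mathrm{Is}(X_1)\times\cdots\times\mathrm{Is}(X_r)$ be a group which acts properly discontinuously on $X$ and contains two independent regular axial isometries. Then the regular geometric limit set splits as a product $F_\Gamma\times P_\Gamma^{reg}$; that is, under the homeomorphism $\partial X^{reg}\cong\partial^F X\times E^+$, one has $L_\Gamma\cap\partial X^{reg}= F_\Gamma\times P_\Gamma^{reg}$, where $P_\Gamma^{reg}\subset E^+$ is the set of slopes of regular limit points of $\Gamma$.
   Context: A Hadamard space is a complete CAT(0) metric space. Let $(X_i,d_i)$, $i=1,\ldots,r$, be locally compact Hadamard spaces, and let $X=X_1\times\cdots\times X_r$ carry the product distance $d=\sqrt{d_1^2+\cdots+d_r^2}$. $\partial X_i$ and $\partial X$ denote the geometric boundaries with the cone topology. An isometry $h$ of a Hadamard space $Y$ is axial if there are $l(h)>0$ and a geodesic line $\sigma:\mathbb{R}\to Y$ (an axis) with $h(\sigma(t))=\sigma(t+l(h))$ for all $t$; set $h^+=\sigma(\infty)$, $h^-=\sigma(-\infty)$. It is rank one if it has an axis which does not bound a flat half-plane (a closed convex subset of $Y$ isometric to $[0,\infty)\times\mathbb{R}$ whose boundary line is the axis). Two rank one isometries $g,h$ are independent if $\{g^+,g^-\}\cap\{h^+,h^-\}=\emptyset$. An element $h=(h_1,\ldots,h_r)\in\mathrm{Is}(X_1)\times\cdots\times\mathrm{Is}(X_r)$ is regular axial if each $h_i$ is a rank one isometry of $X_i$; two regular axial isometries $g,h$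 are independent if $g_i,h_i$ are independent for all $i$. $E^+=\{\theta\in\mathbb{R}_{>0}^r:\Vert\theta\Vert=1\}$. Every geodesic ray in $X$ has the form $\sigma(t)=(\sigma_1(\theta_1 t),\ldots,\sigma_r(\theta_r t))$ with $\sigma_i$ geodesic rays in $X_i$, $\theta_i\ge 0$, $\sum\theta_i^2=1$; the vector $\theta$ is its slope and depends only on the class of $\sigma$ in $\partial X$. The regular boundary $\partial X^{reg}$ is the set of boundary points with slope in $E^+$. The Furstenberg boundary is $\partial^F X=\partial X_1\times\cdots\times\partial X_r$; the map $\partial X^{reg}\to\partial^F X\times E^+$ sending the class of $\sigma$ to $(\sigma_1(\infty),\ldots,\sigma_r(\infty),\theta)$ is a homeomorphism, and $\pi^F:\partial X^{reg}\to\partial^F X$ is its first component. $L_\Gamma=\overline{\Gamma\cdot x}\cap\partial X$ ($x\in X$ arbitrary) is the geometric limit set, $F_\Gamma=\pi^F(L_\Gamma\cap\partial X^{reg})$, and $P_\Gamma^{reg}\subset E^+$ is the set of slopes of points of $L_\Gamma\cap\partial X^{reg}$. *)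

theory Defs
  imports "HOL-Analysis.Analysis" "HOL-Algebra.Product_Groups" "HOL-Algebra.Bij"
begin

text \<open>
  Metric spaces are given by a carrier \<open>M\<close> and a distance function \<open>d\<close>, as in the locale
  \<^locale>\<open>Metric_space\<close>. Paths are functions on all of \<^typ>\<open>real\<close>; geodesic segments and rays
  are only constrained on \<open>[0, d x y]\<close> and \<open>[0, \<infinity>)\<close> respectively.
\<close>

section \<open>Geodesics and Hadamard spaces\<close>

definition geodesic_segment :: "'a set \<Rightarrow> ('a \<Rightarrow> 'a \<Rightarrow> real) \<Rightarrow> (real \<Rightarrow> 'a) \<Rightarrow> 'a \<Rightarrow> 'a \<Rightarrow> bool" where
  "geodesic_segment M d c x y \<longleftrightarrow>
     (\<forall>t\<in>{0..d x y}. c t \<in> M) \<and> c 0 = x \<and> c (d x y) = y \<and>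
     (\<forall>s\<in>{0..d x y}. \<forall>t\<in>{0..d x y}. d (c s) (c t) = \<bar>s - t\<bar>)"

definition geodesic_ray :: "'a set \<Rightarrow> ('a \<Rightarrow> 'a \<Rightarrow> real) \<Rightarrow> (real \<Rightarrow> 'a) \<Rightarrow> bool" where
  "geodesic_ray M d c \<longleftrightarrow>
     (\<forall>t\<ge>0. c t \<in> M) \<and> (\<forall>s\<ge>0. \<forall>t\<ge>0. d (c s) (c t) = \<bar>s - t\<bar>)"

definition geodesic_line :: "'a set \<Rightarrow> ('a \<Rightarrow> 'a \<Rightarrow> real) \<Rightarrow> (real \<Rightarrow> 'a) \<Rightarrow> bool" where
  "geodesic_line M d c \<longleftrightarrow> (\<forall>t. c t \<in> M) \<and> (\<forall>s t. d (c s) (c t) = \<bar>s - t\<bar>)"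

definition geodesic_metric_space :: "'a set \<Rightarrow> ('a \<Rightarrow> 'a \<Rightarrow> real) \<Rightarrow> bool" where
  "geodesic_metric_space M d \<longleftrightarrow>
     Metric_space M d \<and> (\<forall>x\<in>M. \<forall>y\<in>M. \<exists>c. geodesic_segment M d c x y)"

text \<open>
  The CAT(0) comparison condition. The complex numbers serve as the Euclidean plane, and
  \<open>x'\<close>, \<open>y'\<close>, \<open>z'\<close> are the vertices of a comparison triangle; \<open>p'\<close> and \<open>q'\<close> are the comparison
  points of \<open>c s\<close> and \<open>e t\<close>. Since the vertex \<open>x\<close> is arbitrary, any two sides of a
  geodesic triangle are covered (two points on the same side are compared trivially).
\<close>
definition CAT0_space :: "'a set \<Rightarrow> ('a \<Rightarrow> 'a \<Rightarrow> real) \<Rightarrow> bool" where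
  "CAT0_space M d \<longleftrightarrow> geodesic_metric_space M d \<and>
     (\<forall>x\<in>M. \<forall>y\<in>M. \<forall>z\<in>M. \<forall>c e. geodesic_segment M d c x y \<longrightarrow> geodesic_segment M d e x z \<longrightarrow>
       (\<forall>x' y' z' :: complex. dist x' y' = d x y \<longrightarrow> dist x' z' = d x z \<longrightarrow> dist y' z' = d y z \<longrightarrow>
         (\<forall>s\<in>{0..d x y}. \<forall>t\<in>{0..d x z}.
           \<forall>p'\<in>closed_segment x' y'. \<forall>q'\<in>closed_segment x' z'.
             dist x' p' = s \<longrightarrow> dist x' q' = t \<longrightarrow> d (c s) (e t) \<le> dist p' q')))"

definition hadamard_space :: "'a set \<Rightarrow> ('a \<Rightarrow> 'a \<Rightarrow> real) \<Rightarrow> bool" where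
  "hadamard_space M d \<longleftrightarrow> CAT0_space M d \<and> Metric_space.mcomplete M d"


section \<open>Geometric boundary and cone topology\<close>

definition asymptotic :: "('a \<Rightarrow> 'a \<Rightarrow> real) \<Rightarrow> (real \<Rightarrow> 'a) \<Rightarrow> (real \<Rightarrow> 'a) \<Rightarrow> bool" where
  "asymptotic d c c' \<longleftrightarrow> (\<exists>B. \<forall>t\<ge>0. d (c t) (c' t) \<le> B)"

text \<open>The point \<open>c(\<infinity>)\<close>. For a line \<open>c\<close> it depends only on the restriction to \<open>[0, \<infinity>)\<close>.\<close>
definition endpoint :: "'a set \<Rightarrow> ('a \<Rightarrow> 'a \<Rightarrow> real) \<Rightarrow> (real \<Rightarrow> 'a) \<Rightarrow> (real \<Rightarrow> 'a) set" where
  "endpoint M d c = {c'. geodesic_ray M d c' \<and> asymptotic d c c'}"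

definition geom_boundary :: "'a set \<Rightarrow> ('a \<Rightarrow> 'a \<Rightarrow> real) \<Rightarrow> (real \<Rightarrow> 'a) set set" where
  "geom_boundary M d = endpoint M d ` {c. geodesic_ray M d c}"

text \<open>
  The basic cone neighbourhood \<open>U(c, R, \<epsilon>)\<close> of \<open>c(\<infinity>)\<close> in the disjoint union of \<open>M\<close> and its
  boundary: all points outside the closed \<open>R\<close>-ball about \<open>c 0\<close> whose projection to that ball,
  i.e. the point at distance \<open>R\<close> on the geodesic from \<open>c 0\<close>, is \<open>\<epsilon>\<close>-close to \<open>c R\<close>.
\<close>
definition cone_nbhd ::
  "'a set \<Rightarrow> ('a \<Rightarrow> 'a \<Rightarrow> real) \<Rightarrow> (real \<Rightarrow> 'a) \<Rightarrow> real \<Rightarrow> real \<Rightarrow> ('a + (real \<Rightarrow> 'a) set) set" where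
  "cone_nbhd M d c R \<epsilon> =
     Inl ` {x\<in>M. d (c 0) x > R \<and> (\<exists>e. geodesic_segment M d e (c 0) x \<and> d (e R) (c R) < \<epsilon>)} \<union>
     Inr ` {\<xi>\<in>geom_boundary M d. \<exists>e\<in>\<xi>. e 0 = c 0 \<and> d (e R) (c R) < \<epsilon>}"

definition cone_topology :: "'a set \<Rightarrow> ('a \<Rightarrow> 'a \<Rightarrow> real) \<Rightarrow> ('a + (real \<Rightarrow> 'a) set) topology" where
  "cone_topology M d = topology_generated_by
     ({Inl ` U | U. openin (Metric_space.mtopology M d) U} \<union>
      {cone_nbhd M d c R \<epsilon> | c R \<epsilon>. geodesic_ray M d c \<and> R > 0 \<and> \<epsilon> > 0})"

definition boundary_limit_points :: "'a set \<Rightarrow> ('a \<Rightarrow> 'a \<Rightarrow> real) \<Rightarrow> 'a set \<Rightarrow> (real \<Rightarrow> 'a) set set" where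
  "boundary_limit_points M d S =
     {\<xi>\<in>geom_boundary M d. Inr \<xi> \<in> cone_topology M d closure_of (Inl ` S)}"


section \<open>Isometries\<close>

definition isometry_group :: "'a set \<Rightarrow> ('a \<Rightarrow> 'a \<Rightarrow> real) \<Rightarrow> ('a \<Rightarrow> 'a) monoid" where
  "isometry_group M d =
     (BijGroup M)\<lparr>carrier := {f \<in> Bij M. \<forall>x\<in>M. \<forall>y\<in>M. d (f x) (f y) = d x y}\<rparr>"

definition is_axis :: "'a set \<Rightarrow> ('a \<Rightarrow> 'a \<Rightarrow> real) \<Rightarrow> ('a \<Rightarrow> 'a) \<Rightarrow> (real \<Rightarrow> 'a) \<Rightarrow> bool" where
  "is_axis M d h \<sigma> \<longleftrightarrow> geodesic_line M d \<sigma> \<and> (\<exists>l>0. \<forall>t. h (\<sigma> t) = \<sigma> (t + l))"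

text \<open>The fixed points \<open>h\<^sup>+\<close> and \<open>h\<^sup>-\<close> of an axial isometry; all its axes have the same endpoints.\<close>
definition attractive_point :: "'a set \<Rightarrow> ('a \<Rightarrow> 'a \<Rightarrow> real) \<Rightarrow> ('a \<Rightarrow> 'a) \<Rightarrow> (real \<Rightarrow> 'a) set" where
  "attractive_point M d h = (THE \<xi>. \<exists>\<sigma>. is_axis M d h \<sigma> \<and> \<xi> = endpoint M d \<sigma>)"

definition repulsive_point :: "'a set \<Rightarrow> ('a \<Rightarrow> 'a \<Rightarrow> real) \<Rightarrow> ('a \<Rightarrow> 'a) \<Rightarrow> (real \<Rightarrow> 'a) set" where
  "repulsive_point M d h = (THE \<xi>. \<exists>\<sigma>. is_axis M d h \<sigma> \<and> \<xi> = endpoint M d (\<lambda>t. \<sigma> (- t)))"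

definition geodesically_convex :: "'a set \<Rightarrow> ('a \<Rightarrow> 'a \<Rightarrow> real) \<Rightarrow> 'a set \<Rightarrow> bool" where
  "geodesically_convex M d F \<longleftrightarrow>
     (\<forall>x\<in>F. \<forall>y\<in>F. \<forall>c. geodesic_segment M d c x y \<longrightarrow> c ` {0..d x y} \<subseteq> F)"

definition bounds_flat_half_plane :: "'a set \<Rightarrow> ('a \<Rightarrow> 'a \<Rightarrow> real) \<Rightarrow> (real \<Rightarrow> 'a) \<Rightarrow> bool" where
  "bounds_flat_half_plane M d \<sigma> \<longleftrightarrow>
     (\<exists>F (f :: real \<times> real \<Rightarrow> 'a).
        F \<subseteq> M \<and> closedin (Metric_space.mtopology M d) F \<and> geodesically_convex M d F \<and>
        f ` ({0..} \<times> UNIV) = F \<and>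
        (\<forall>p\<in>{0..} \<times> UNIV. \<forall>q\<in>{0..} \<times> UNIV. d (f p) (f q) = dist p q) \<and>
        f ` ({0} \<times> UNIV) = range \<sigma>)"

definition rank_one :: "'a set \<Rightarrow> ('a \<Rightarrow> 'a \<Rightarrow> real) \<Rightarrow> ('a \<Rightarrow> 'a) \<Rightarrow> bool" where
  "rank_one M d h \<longleftrightarrow> h \<in> carrier (isometry_group M d) \<and>
     (\<exists>\<sigma>. is_axis M d h \<sigma> \<and> \<not> bounds_flat_half_plane M d \<sigma>)"

definition independent_rank_one :: "'a set \<Rightarrow> ('a \<Rightarrow> 'a \<Rightarrow> real) \<Rightarrow> ('a \<Rightarrow> 'a) \<Rightarrow> ('a \<Rightarrow> 'a) \<Rightarrow> bool" where
  "independent_rank_one M d g h \<longleftrightarrow> rank_one M d g \<and> rank_one M d h \<and>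
     {attractive_point M d g, repulsive_point M d g} \<inter>
     {attractive_point M d h, repulsive_point M d h} = {}"


section \<open>Products\<close>

text \<open>
  The product of the spaces \<open>(X i, d i)\<close>, \<open>i \<in> I\<close>, has the carrier \<open>Pi\<^sub>E I X\<close>. All factors
  live in one type, which is no restriction since they may be realized as subsets of a common type.
\<close>
definition l2_dist :: "'i set \<Rightarrow> ('i \<Rightarrow> 'a \<Rightarrow> 'a \<Rightarrow> real) \<Rightarrow> ('i \<Rightarrow> 'a) \<Rightarrow> ('i \<Rightarrow> 'a) \<Rightarrow> real" where
  "l2_dist I d x y = L2_set (\<lambda>i. d i (x i) (y i)) I"

definition prod_action :: "'i set \<Rightarrow> ('i \<Rightarrow> 'a \<Rightarrow> 'a) \<Rightarrow> ('i \<Rightarrow> 'a) \<Rightarrow> ('i \<Rightarrow> 'a)" where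
  "prod_action I \<gamma> x = (\<lambda>i\<in>I. \<gamma> i (x i))"

definition acts_properly_discontinuously ::
  "'i set \<Rightarrow> ('i \<Rightarrow> 'a set) \<Rightarrow> ('i \<Rightarrow> 'a \<Rightarrow> 'a \<Rightarrow> real) \<Rightarrow> ('i \<Rightarrow> 'a \<Rightarrow> 'a) set \<Rightarrow> bool" where
  "acts_properly_discontinuously I X d \<Gamma> \<longleftrightarrow>
     (\<forall>K. compactin (Metric_space.mtopology (Pi\<^sub>E I X) (l2_dist I d)) K \<longrightarrow>
        finite {\<gamma>\<in>\<Gamma>. prod_action I \<gamma> ` K \<inter> K \<noteq> {}})"

definition regular_axial ::
  "'i set \<Rightarrow> ('i \<Rightarrow> 'a set) \<Rightarrow> ('i \<Rightarrow> 'a \<Rightarrow> 'a \<Rightarrow> real) \<Rightarrow> ('i \<Rightarrow> 'a \<Rightarrow> 'a) \<Rightarrow> bool" where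
  "regular_axial I X d h \<longleftrightarrow> (\<forall>i\<in>I. rank_one (X i) (d i) (h i))"

definition independent_regular_axial ::
  "'i set \<Rightarrow> ('i \<Rightarrow> 'a set) \<Rightarrow> ('i \<Rightarrow> 'a \<Rightarrow> 'a \<Rightarrow> real) \<Rightarrow> ('i \<Rightarrow> 'a \<Rightarrow> 'a) \<Rightarrow> ('i \<Rightarrow> 'a \<Rightarrow> 'a) \<Rightarrow> bool" where
  "independent_regular_axial I X d g h \<longleftrightarrow> regular_axial I X d g \<and> regular_axial I X d h \<and>
     (\<forall>i\<in>I. independent_rank_one (X i) (d i) (g i) (h i))"

definition E_plus :: "'i set \<Rightarrow> ('i \<Rightarrow> real) set" where
  "E_plus I = {\<theta> \<in> I \<rightarrow>\<^sub>E {0<..}. L2_set \<theta> I = 1}"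

text \<open>The ray \<open>\<sigma>\<close> of the product has the form \<open>\<sigma>(t) = (\<sigma>\<^sub>i(\<theta>\<^sub>i t))\<^sub>i\<close> with slope vector \<open>\<theta>\<close>.\<close>
definition ray_decomposition ::
  "'i set \<Rightarrow> ('i \<Rightarrow> 'a set) \<Rightarrow> ('i \<Rightarrow> 'a \<Rightarrow> 'a \<Rightarrow> real) \<Rightarrow>
   (real \<Rightarrow> 'i \<Rightarrow> 'a) \<Rightarrow> ('i \<Rightarrow> real \<Rightarrow> 'a) \<Rightarrow> ('i \<Rightarrow> real) \<Rightarrow> bool" where
  "ray_decomposition I X d \<sigma> \<sigma>s \<theta> \<longleftrightarrow>
     (\<forall>i\<in>I. geodesic_ray (X i) (d i) (\<sigma>s i)) \<and>
     \<theta> \<in> I \<rightarrow>\<^sub>E {0..} \<and> L2_set \<theta> I = 1 \<and>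
     (\<forall>t\<ge>0. \<sigma> t = (\<lambda>i\<in>I. \<sigma>s i (\<theta> i * t)))"

definition ray_slope ::
  "'i set \<Rightarrow> ('i \<Rightarrow> 'a set) \<Rightarrow> ('i \<Rightarrow> 'a \<Rightarrow> 'a \<Rightarrow> real) \<Rightarrow> (real \<Rightarrow> 'i \<Rightarrow> 'a) set \<Rightarrow> ('i \<Rightarrow> real)" where
  "ray_slope I X d \<xi> = (THE \<theta>. \<exists>\<sigma>\<in>\<xi>. \<exists>\<sigma>s. ray_decomposition I X d \<sigma> \<sigma>s \<theta>)"

definition regular_boundary ::
  "'i set \<Rightarrow> ('i \<Rightarrow> 'a set) \<Rightarrow> ('i \<Rightarrow> 'a \<Rightarrow> 'a \<Rightarrow> real) \<Rightarrow> (real \<Rightarrow> 'i \<Rightarrow> 'a) set set" where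
  "regular_boundary I X d =
     {\<xi> \<in> geom_boundary (Pi\<^sub>E I X) (l2_dist I d). ray_slope I X d \<xi> \<in> E_plus I}"

text \<open>
  The Furstenberg boundary is \<open>\<Pi>\<^sub>E i\<in>I. geom_boundary (X i) (d i)\<close>; the following projection
  is meaningful on the regular boundary only.
\<close>
definition furstenberg_proj ::
  "'i set \<Rightarrow> ('i \<Rightarrow> 'a set) \<Rightarrow> ('i \<Rightarrow> 'a \<Rightarrow> 'a \<Rightarrow> real) \<Rightarrow>
   (real \<Rightarrow> 'i \<Rightarrow> 'a) set \<Rightarrow> ('i \<Rightarrow> (real \<Rightarrow> 'a) set)" where
  "furstenberg_proj I X d \<xi> =
     (THE \<eta>. \<exists>\<sigma>\<in>\<xi>. \<exists>\<sigma>s \<theta>. ray_decomposition I X d \<sigma> \<sigma>s \<theta> \<and>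
        \<eta> = (\<lambda>i\<in>I. endpoint (X i) (d i) (\<sigma>s i)))"

text \<open>The map identifying the regular boundary with (Furstenberg boundary) \<open>\<times> E\<^sup>+\<close>.\<close>
definition regular_boundary_map ::
  "'i set \<Rightarrow> ('i \<Rightarrow> 'a set) \<Rightarrow> ('i \<Rightarrow> 'a \<Rightarrow> 'a \<Rightarrow> real) \<Rightarrow>
   (real \<Rightarrow> 'i \<Rightarrow> 'a) set \<Rightarrow> ('i \<Rightarrow> (real \<Rightarrow> 'a) set) \<times> ('i \<Rightarrow> real)" where
  "regular_boundary_map I X d \<xi> = (furstenberg_proj I X d \<xi>, ray_slope I X d \<xi>)"


section \<open>Limit sets\<close>

definition limit_set ::
  "'i set \<Rightarrow> ('i \<Rightarrow> 'a set) \<Rightarrow> ('i \<Rightarrow> 'a \<Rightarrow> 'a \<Rightarrow> real) \<Rightarrow> ('i \<Rightarrow> 'a \<Rightarrow> 'a) set \<Rightarrow> ('i \<Rightarrow> 'a) \<Rightarrow>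
   (real \<Rightarrow> 'i \<Rightarrow> 'a) set set" where
  "limit_set I X d \<Gamma> x =
     boundary_limit_points (Pi\<^sub>E I X) (l2_dist I d) ((\<lambda>\<gamma>. prod_action I \<gamma> x) ` \<Gamma>)"

definition furstenberg_limit_set ::
  "'i set \<Rightarrow> ('i \<Rightarrow> 'a set) \<Rightarrow> ('i \<Rightarrow> 'a \<Rightarrow> 'a \<Rightarrow> real) \<Rightarrow> ('i \<Rightarrow> 'a \<Rightarrow> 'a) set \<Rightarrow> ('i \<Rightarrow> 'a) \<Rightarrow>
   ('i \<Rightarrow> (real \<Rightarrow> 'a) set) set" where
  "furstenberg_limit_set I X d \<Gamma> x =
     furstenberg_proj I X d ` (limit_set I X d \<Gamma> x \<inter> regular_boundary I X d)"

definition regular_slopes ::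
  "'i set \<Rightarrow> ('i \<Rightarrow> 'a set) \<Rightarrow> ('i \<Rightarrow> 'a \<Rightarrow> 'a \<Rightarrow> real) \<Rightarrow> ('i \<Rightarrow> 'a \<Rightarrow> 'a) set \<Rightarrow> ('i \<Rightarrow> 'a) \<Rightarrow>
   ('i \<Rightarrow> real) set" where
  "regular_slopes I X d \<Gamma> x =
     ray_slope I X d ` (limit_set I X d \<Gamma> x \<inter> regular_boundary I X d)"

end

theory Submission
  imports Defs
begin

text \<open>
  A geodesic line with translations that bounds no flat half-plane is \<open>crossed\<close>: a segment
  whose end points have feet far to the left and far to the right on the line comes uniformly
  close to the line in between. Otherwise translates of counterexamples would subconverge to a ray
  spanning a flat half-plane with the line.

  Let \<open>g\<close>, \<open>h\<close> be independent. In each factor the end points of the translates of the axis of \<open>h\<close>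
  by powers of \<open>g\<close> have pairwise disjoint neighbourhoods. Using \<open>r + 1\<close> translates for \<open>r\<close> factors,
  the pigeonhole principle yields for all points \<open>y\<close>, \<open>z\<close> an element
  \<open>a = g\<^sup>k h\<^sup>N g\<^sup>-\<^sup>j\<close> of a fixed finite set such that the segment from \<open>y i\<close> to \<open>a i (z i)\<close>
  passes near \<open>x i\<close> for all \<open>i\<close> at once. Apply this to \<open>y = \<alpha>\<^sup>-\<^sup>1 x\<close> and \<open>z = \<beta> x\<close>: the segments
  from \<open>x\<close> to \<open>\<alpha> a \<beta> x\<close> pass near \<open>\<alpha> x\<close> in every factor. Choosing first \<open>\<alpha> x\<close> close to \<open>\<xi>\<close> and then
  \<open>\<beta> x\<close> much further away and close to \<open>\<xi>'\<close>, the points \<open>\<alpha> a \<beta> x\<close> converge to the limit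
  point with the Furstenberg projection of \<open>\<xi>\<close> and the slope of \<open>\<xi>'\<close>.
\<close>

section \<open>The CN inequality\<close>

text \<open>Comparison triangles are replaced throughout by the inequality \<open>CN\<close>. It is
  linear in squared distances, so it passes to the product by summation over the factors, and the
  same lemmas serve the factors and the product.

  The obstacle in the product is simultaneity. In a single factor all but at most one k and one j
  will do, but the group need not contain elements assembled factor by factor: one element has to
  work everywhere at once.

  The slope survives because the inserted element comes from a finite set that does not depend on
  \<beta>. In each factor the lengths for \<alpha> a \<beta> x and \<beta> x differ by a bound
  depending on \<alpha> only, which is negligible once \<beta> x is far away. The direction survives
  because segments from x contract towards x: passing within a bounded distance of a far point means
  being very close near x.

  The flat half-plane argument is used twice. First a ray at an arbitrary angle shows that segments
  towards points with feet far to the left follow the line; only then can segments that miss the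
  line be shown to produce a ray orthogonal to it.\<close>

locale CN_space = Metric_space M d for M :: "'a set" and d +
  assumes CN: "\<lbrakk>x \<in> M; y \<in> M; 0 \<le> s; s \<le> 1\<rbrakk> \<Longrightarrow>
    \<exists>p\<in>M. \<forall>z\<in>M. (d p z)\<^sup>2 \<le> (1 - s) * (d x z)\<^sup>2 + s * (d y z)\<^sup>2 - s * (1 - s) * (d x y)\<^sup>2"
begin

text \<open>\<open>pt x y s\<close> and \<open>gp x y t\<close> are meaningful only for \<open>0 \<le> s \<le> 1\<close> and \<open>0 \<le> t \<le> d x y\<close>.\<close>
definition pt :: "'a \<Rightarrow> 'a \<Rightarrow> real \<Rightarrow> 'a" where
  "pt x y s = (SOME p. p \<in> M \<and> (\<forall>z\<in>M. (d p z)\<^sup>2 \<le>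
     (1 - s) * (d x z)\<^sup>2 + s * (d y z)\<^sup>2 - s * (1 - s) * (d x y)\<^sup>2))"

definition gp :: "'a \<Rightarrow> 'a \<Rightarrow> real \<Rightarrow> 'a" where
  "gp x y t = pt x y (t / d x y)"

lemma pt_CN_in:
  assumes "x \<in> M" "y \<in> M" "0 \<le> s" "s \<le> 1"
  shows "pt x y s \<in> M \<and> (\<forall>z\<in>M. (d (pt x y s) z)\<^sup>2 \<le>
     (1 - s) * (d x z)\<^sup>2 + s * (d y z)\<^sup>2 - s * (1 - s) * (d x y)\<^sup>2)"
  unfolding pt_def by (rule someI_ex) (use CN[OF assms] in blast)

lemma pt_in [simp]: "\<lbrakk>x \<in> M; y \<in> M; 0 \<le> s; s \<le> 1\<rbrakk> \<Longrightarrow> pt x y s \<in> M"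
  using pt_CN_in by blast

lemma pt_CN: "\<lbrakk>x \<in> M; y \<in> M; z \<in> M; 0 \<le> s; s \<le> 1\<rbrakk> \<Longrightarrow> (d (pt x y s) z)\<^sup>2 \<le>
     (1 - s) * (d x z)\<^sup>2 + s * (d y z)\<^sup>2 - s * (1 - s) * (d x y)\<^sup>2"
  using pt_CN_in by blast

text \<open>Taking z = x and z = y in \<open>CN\<close> bounds both parts of the segment from above;
  the triangle inequality leaves no slack.\<close>

lemma dist_pt_left:
  assumes "x \<in> M" "y \<in> M" "0 \<le> s" "s \<le> 1"
  shows "d x (pt x y s) = s * d x y" and "d (pt x y s) y = (1 - s) * d x y"
proof -
  let ?p = "pt x y s"
  have p: "?p \<in> M" using assms by simp
  have "(d ?p x)\<^sup>2 \<le> s * (d y x)\<^sup>2 - s * (1 - s) * (d x y)\<^sup>2"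
    using pt_CN[of x y x s] assms by simp
  also have "\<dots> = (s * d x y)\<^sup>2"
    by (simp add: commute[of y x] power2_eq_square algebra_simps)
  finally have 1: "d x ?p \<le> s * d x y"
    using assms by (metis commute nonneg power2_le_imp_le zero_le_mult_iff)
  have "(d ?p y)\<^sup>2 \<le> (1 - s) * (d x y)\<^sup>2 - s * (1 - s) * (d x y)\<^sup>2"
    using pt_CN[of x y y s] assms by simp
  also have "\<dots> = ((1 - s) * d x y)\<^sup>2"
    by (simp add: power2_eq_square algebra_simps)
  finally have 2: "d ?p y \<le> (1 - s) * d x y"
    using assms by (metis diff_ge_0_iff_ge nonneg power2_le_imp_le zero_le_mult_iff)
  have "d x y \<le> d x ?p + d ?p y" using triangle[OF assms(1) p assms(2)] .
  with 1 2 show "d x ?p = s * d x y" "d ?p y = (1 - s) * d x y"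
    by (auto simp: algebra_simps)
qed

text \<open>For z = p the right-hand side of \<open>pt_CN\<close> vanishes. Upper bounds on the two
  distances suffice, which makes this the standard way of identifying points later.\<close>

lemma pt_unique:
  assumes "x \<in> M" "y \<in> M" "0 \<le> s" "s \<le> 1" "p \<in> M"
    and "d x p \<le> s * d x y" "d p y \<le> (1 - s) * d x y"
  shows "p = pt x y s"
proof -
  have "d x y \<le> d x p + d p y" using triangle assms by blast
  then have e: "d x p = s * d x y" "d y p = (1 - s) * d x y"
    using assms(6,7) commute[of p y] by (auto simp: algebra_simps)
  have "(d (pt x y s) p)\<^sup>2 \<le> 0"
    using pt_CN[of x y p s] assms(1-5) unfolding e
    by (simp add: power2_eq_square algebra_simps)
  then show ?thesis using assms by simp
qed

lemma pt_0 [simp]: "\<lbrakk>x \<in> M; y \<in> M\<rbrakk> \<Longrightarrow> pt x y 0 = x"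
  and pt_1 [simp]: "\<lbrakk>x \<in> M; y \<in> M\<rbrakk> \<Longrightarrow> pt x y 1 = y"
  using pt_unique[of x y 0 x] pt_unique[of x y 1 y] by simp_all

lemma pt_refl [simp]: "\<lbrakk>x \<in> M; 0 \<le> s; s \<le> 1\<rbrakk> \<Longrightarrow> pt x x s = x"
  using pt_unique[of x x s x] by simp

lemma pt_commute: "\<lbrakk>x \<in> M; y \<in> M; 0 \<le> s; s \<le> 1\<rbrakk> \<Longrightarrow> pt x y s = pt y x (1 - s)"
  using dist_pt_left[of x y s] by (intro pt_unique) (auto simp: commute)

lemma dist_pt_pt:
  assumes "x \<in> M" "y \<in> M" "0 \<le> s" "s \<le> 1" "0 \<le> t" "t \<le> 1"
  shows "d (pt x y s) (pt x y t) = \<bar>s - t\<bar> * d x y"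
proof (rule antisym)
  have yt: "d y (pt x y t) = (1 - t) * d x y"
    using dist_pt_left[of x y t] assms by (simp add: commute)
  have "(d (pt x y s) (pt x y t))\<^sup>2 \<le> ((s - t) * d x y)\<^sup>2"
    using pt_CN[of x y "pt x y t" s] assms
    by (simp add: dist_pt_left yt power2_eq_square algebra_simps)
  then show "d (pt x y s) (pt x y t) \<le> \<bar>s - t\<bar> * d x y"
    by (metis abs_le_square_iff abs_mult abs_of_nonneg nonneg)
  have "s * d x y \<le> t * d x y + d (pt x y s) (pt x y t)"
       "t * d x y \<le> s * d x y + d (pt x y s) (pt x y t)"
    using triangle[of x "pt x y t" "pt x y s"] triangle[of x "pt x y s" "pt x y t"] assms
    by (simp_all add: dist_pt_left commute)
  then show "\<bar>s - t\<bar> * d x y \<le> d (pt x y s) (pt x y t)"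
    by (auto simp: abs_if algebra_simps)
qed

text \<open>By the law of cosines the right-hand side is the squared distance of the comparison
  points in the plane. It comes from \<open>CN\<close> used once along each side.\<close>

lemma dist_pt_pt_le:
  assumes "o1 \<in> M" "x \<in> M" "y \<in> M" "0 \<le> s" "s \<le> 1" "0 \<le> t" "t \<le> 1"
  shows "(d (pt o1 x s) (pt o1 y t))\<^sup>2 \<le> (s * d o1 x)\<^sup>2 + (t * d o1 y)\<^sup>2
    - s * t * ((d o1 x)\<^sup>2 + (d o1 y)\<^sup>2 - (d x y)\<^sup>2)"
proof -
  have 1: "(d x (pt o1 y t))\<^sup>2 \<le> (1 - t) * (d o1 x)\<^sup>2 + t * (d x y)\<^sup>2 - t * (1 - t) * (d o1 y)\<^sup>2"
    using pt_CN[of o1 y x t] assms by (simp add: commute)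
  have "(d (pt o1 x s) (pt o1 y t))\<^sup>2 \<le> (1 - s) * (t * d o1 y)\<^sup>2
     + s * (d x (pt o1 y t))\<^sup>2 - s * (1 - s) * (d o1 x)\<^sup>2"
    using pt_CN[of o1 x "pt o1 y t" s] assms by (simp add: dist_pt_left)
  also have "\<dots> \<le> (1 - s) * (t * d o1 y)\<^sup>2
     + s * ((1 - t) * (d o1 x)\<^sup>2 + t * (d x y)\<^sup>2 - t * (1 - t) * (d o1 y)\<^sup>2) - s * (1 - s) * (d o1 x)\<^sup>2"
    using mult_left_mono[OF 1 assms(4)] by simp
  also have "\<dots> = (s * d o1 x)\<^sup>2 + (t * d o1 y)\<^sup>2
    - s * t * ((d o1 x)\<^sup>2 + (d o1 y)\<^sup>2 - (d x y)\<^sup>2)"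
    by (simp add: power2_eq_square algebra_simps)
  finally show ?thesis .
qed

lemma pt_contract:
  assumes "o1 \<in> M" "x \<in> M" "y \<in> M" "0 \<le> s" "s \<le> 1"
  shows "d (pt o1 x s) (pt o1 y s) \<le> s * d x y"
proof -
  have "(d (pt o1 x s) (pt o1 y s))\<^sup>2 \<le> (s * d x y)\<^sup>2"
    using dist_pt_pt_le[of o1 x y s s] assms by (simp add: power2_eq_square algebra_simps)
  then show ?thesis using assms by (metis nonneg power2_le_imp_le zero_le_mult_iff)
qed

text \<open>Pass through the diagonal from x to y' and contract towards each of its ends.\<close>

lemma pt_convex:
  assumes "x \<in> M" "y \<in> M" "x' \<in> M" "y' \<in> M" "0 \<le> s" "s \<le> 1"
  shows "d (pt x y s) (pt x' y' s) \<le> (1 - s) * d x x' + s * d y y'"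
proof -
  have "d (pt x y s) (pt x y' s) \<le> s * d y y'"
    using pt_contract assms by blast
  moreover have "d (pt x y' s) (pt x' y' s) \<le> (1 - s) * d x x'"
    using pt_contract[of y' x x' "1 - s"] assms by (simp add: pt_commute[of _ y' s])
  moreover have "d (pt x y s) (pt x' y' s) \<le> d (pt x y s) (pt x y' s) + d (pt x y' s) (pt x' y' s)"
    using triangle assms by simp
  ultimately show ?thesis by simp
qed

lemma ratio_bounds:
  assumes "0 \<le> t" "t \<le> d x y"
  shows "0 \<le> t / d x y" "t / d x y \<le> 1" "t / d x y * d x y = t"
  using assms by (auto simp: divide_le_eq_1 intro: antisym)

lemma gp_in [simp]: "\<lbrakk>x \<in> M; y \<in> M; 0 \<le> t; t \<le> d x y\<rbrakk> \<Longrightarrow> gp x y t \<in> M"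
  by (simp add: gp_def ratio_bounds)

lemma dist_gp:
  assumes "x \<in> M" "y \<in> M" "0 \<le> t" "t \<le> d x y"
  shows "d x (gp x y t) = t" "d (gp x y t) y = d x y - t"
  using dist_pt_left[OF assms(1,2) ratio_bounds(1,2)[OF assms(3,4)]]
    ratio_bounds(3)[OF assms(3,4)]
  by (simp_all add: gp_def algebra_simps)

lemma gp_0 [simp]: "\<lbrakk>x \<in> M; y \<in> M\<rbrakk> \<Longrightarrow> gp x y 0 = x"
  by (simp add: gp_def)

lemma gp_unique:
  assumes "x \<in> M" "y \<in> M" "0 \<le> t" "t \<le> d x y" "p \<in> M" "d x p \<le> t" "d p y \<le> d x y - t"
  shows "p = gp x y t"
  unfolding gp_def using ratio_bounds[OF assms(3,4)] assms
  by (intro pt_unique) (auto simp: algebra_simps)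

lemma dist_gp_gp:
  assumes "x \<in> M" "y \<in> M" "0 \<le> s" "s \<le> d x y" "0 \<le> t" "t \<le> d x y"
  shows "d (gp x y s) (gp x y t) = \<bar>s - t\<bar>"
proof -
  have "d (gp x y s) (gp x y t) = \<bar>s / d x y - t / d x y\<bar> * \<bar>d x y\<bar>"
    unfolding gp_def using assms by (simp add: dist_pt_pt ratio_bounds)
  also have "\<dots> = \<bar>s / d x y * d x y - t / d x y * d x y\<bar>"
    by (metis abs_mult left_diff_distrib)
  finally show ?thesis using ratio_bounds(3)[OF assms(3,4)] ratio_bounds(3)[OF assms(5,6)] by simp
qed

lemma geodesic_segment_gp: "\<lbrakk>x \<in> M; y \<in> M\<rbrakk> \<Longrightarrow> geodesic_segment M d (gp x y) x y"
  unfolding geodesic_segment_def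
  using dist_gp(2)[of x y "d x y"] by (auto simp: dist_gp_gp zero)

lemma geodesic_segment_eq_gp:
  assumes "geodesic_segment M d c x y" "t \<in> {0..d x y}"
  shows "c t = gp x y t"
proof -
  have *: "c 0 = x" "c (d x y) = y" "\<And>t. t \<in> {0..d x y} \<Longrightarrow> c t \<in> M"
    "\<And>s t. s \<in> {0..d x y} \<Longrightarrow> t \<in> {0..d x y} \<Longrightarrow> d (c s) (c t) = \<bar>s - t\<bar>"
    using assms(1) unfolding geodesic_segment_def by auto
  have xy: "x \<in> M" "y \<in> M" using *(3)[of 0] *(3)[of "d x y"] *(1,2) by auto
  show ?thesis
    using *(4)[of 0 t] *(4)[of t "d x y"] *(1,2,3) assms(2) xy
    by (intro gp_unique) auto
qed

lemma gp_gp: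
  assumes "x \<in> M" "y \<in> M" "0 \<le> s" "s \<le> t" "t \<le> d x y"
  shows "gp x (gp x y t) s = gp x y s"
  using assms by (intro gp_unique[symmetric]) (auto simp: dist_gp dist_gp_gp)

lemma ray_gp:
  assumes "geodesic_ray M d c" "0 \<le> t" "t \<le> s"
  shows "gp (c 0) (c s) t = c t"
  using assms unfolding geodesic_ray_def
  by (intro gp_unique[symmetric]) auto

lemma gp_dist_le:
  assumes "o1 \<in> M" "x \<in> M" "y \<in> M" "0 \<le> t" "t \<le> A" "0 < A" "A \<le> d o1 x" "A \<le> d o1 y"
  shows "d (gp o1 x t) (gp o1 y t) \<le> t / A * d x y"
proof -
  let ?a = "d o1 x" and ?b = "d o1 y"
  have ab: "?a > 0" "?b > 0" "t \<le> ?a" "t \<le> ?b" using assms by linarith+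
  have "(d (gp o1 x t) (gp o1 y t))\<^sup>2 \<le> (t / ?a * ?a)\<^sup>2 + (t / ?b * ?b)\<^sup>2
     - t / ?a * (t / ?b) * (?a\<^sup>2 + ?b\<^sup>2 - (d x y)\<^sup>2)"
    unfolding gp_def using assms ab by (intro dist_pt_pt_le) (auto simp: ratio_bounds)
  also have "\<dots> = t\<^sup>2 / (?a * ?b) * ((d x y)\<^sup>2 - (?a - ?b)\<^sup>2)"
    using ab by (simp add: field_simps power2_eq_square)
  also have "\<dots> \<le> t\<^sup>2 / (?a * ?b) * (d x y)\<^sup>2"
    using ab by (intro mult_left_mono) auto
  also have "\<dots> \<le> t\<^sup>2 / (A * A) * (d x y)\<^sup>2"
    using ab assms by (intro mult_right_mono divide_left_mono mult_mono) auto
  also have "\<dots> = (t / A * d x y)\<^sup>2" by (simp add: power2_eq_square)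
  finally show ?thesis using assms by (metis nonneg power2_le_imp_le zero_le_mult_iff zero_le_divide_iff order_less_imp_le)
qed

text \<open>The intermediate point is the point of [x', y] with the same ratio as
  \<open>gp x y t\<close>. Each of the two steps costs at most d x x'.\<close>

lemma gp_change_base:
  assumes "x \<in> M" "x' \<in> M" "y \<in> M" "0 \<le> t" "t \<le> d x y" "t \<le> d x' y"
  shows "d (gp x y t) (gp x' y t) \<le> 2 * d x x'"
proof (cases "d x y = 0")
  case True
  then have "t = 0" "x = y" using assms by auto
  then show ?thesis using assms by simp
next
  case False
  define s where "s = t / d x y"
  have s: "0 \<le> s" "s \<le> 1" "s * d x y = t" unfolding s_def using ratio_bounds assms by auto
  have 1: "d (gp x y t) (pt x' y s) \<le> d x x'"
  proof -
    have "d (gp x y t) (pt x' y s) \<le> (1 - s) * d x x' + s * d y y"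
      unfolding gp_def s_def[symmetric] using assms s by (intro pt_convex) auto
    also have "\<dots> \<le> d x x'" using assms s by (simp add: algebra_simps)
    finally show ?thesis .
  qed
  have "d (pt x' y s) (gp x' y t) = \<bar>s - t / d x' y\<bar> * \<bar>d x' y\<bar>"
    unfolding gp_def using assms s ratio_bounds[of t x' y] by (simp add: dist_pt_pt)
  also have "\<dots> = \<bar>s * d x' y - t / d x' y * d x' y\<bar>"
    by (metis abs_mult left_diff_distrib)
  also have "\<dots> = \<bar>s * (d x' y - d x y)\<bar>"
    using ratio_bounds(3)[of t x' y] assms s by (simp add: algebra_simps)
  also have "\<dots> \<le> \<bar>d x' y - d x y\<bar>"
    using s by (simp add: abs_mult mult_left_le_one_le)
  also have "\<dots> \<le> d x x'"
    using triangle[of x x' y] triangle[of x' x y] assms by (simp add: commute)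
  finally show ?thesis
    using 1 triangle[of "gp x y t" "pt x' y s" "gp x' y t"] assms s by simp
qed

lemma dist_sq_convex_line:
  assumes "geodesic_line M d c" "z \<in> M" "0 \<le> s" "s \<le> 1"
  shows "(d (c ((1 - s) * a + s * b)) z)\<^sup>2 \<le> (1 - s) * (d (c a) z)\<^sup>2 + s * (d (c b) z)\<^sup>2 - s * (1 - s) * (a - b)\<^sup>2"
proof -
  have c: "\<And>t. c t \<in> M" "\<And>s t. d (c s) (c t) = \<bar>s - t\<bar>"
    using assms(1) unfolding geodesic_line_def by auto
  have e: "a - ((1 - s) * a + s * b) = s * (a - b)" "(1 - s) * a + s * b - b = (1 - s) * (a - b)"
    by (simp_all add: algebra_simps)
  have "c ((1 - s) * a + s * b) = pt (c a) (c b) s"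
    using assms c by (intro pt_unique) (auto simp: e abs_mult)
  then show ?thesis using pt_CN[of "c a" "c b" z s] assms c by simp
qed

lemma dist_convex_line:
  assumes "geodesic_line M d c" "z \<in> M" "0 \<le> s" "s \<le> 1"
  shows "d (c ((1 - s) * a + s * b)) z \<le> (1 - s) * d (c a) z + s * d (c b) z"
proof -
  have c: "\<And>t. c t \<in> M" "\<And>s t. d (c s) (c t) = \<bar>s - t\<bar>"
    using assms(1) unfolding geodesic_line_def by auto
  have e: "a - ((1 - s) * a + s * b) = s * (a - b)" "(1 - s) * a + s * b - b = (1 - s) * (a - b)"
    by (simp_all add: algebra_simps)
  have "c ((1 - s) * a + s * b) = pt (c a) (c b) s"
    using assms c by (intro pt_unique) (auto simp: e abs_mult)
  then show ?thesis using pt_convex[of "c a" "c b" z z s] assms c by simp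
qed

subsection \<open>Properness and limit rays\<close>

lemma compactin_mcball_downward:
  assumes "compactin mtopology (mcball x R)" "R' \<le> R"
  shows "compactin mtopology (mcball x R')"
  by (rule closed_compactin[OF assms(1)]) (use assms(2) in auto)

lemma truncate_ball:
  assumes "x \<in> M" "y \<in> mcball x (R + e)" "0 \<le> R" "0 \<le> e"
  obtains y' where "y' \<in> mcball x R" "d y' y \<le> e"
proof -
  define t where "t = min R (d x y)"
  have "0 \<le> t" "t \<le> d x y" using assms by (auto simp: t_def)
  then have "gp x y t \<in> mcball x R" "d (gp x y t) y \<le> e"
    using assms dist_gp[of x y t] by (auto simp: t_def)
  then show ?thesis by (rule that)
qed

text \<open>The Hopf--Rinow theorem for length spaces.\<close>
lemma compactin_mcball:
  assumes "mcomplete" "locally_compact_space mtopology" "x \<in> M"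
  shows "compactin mtopology (mcball x R)"
proof (rule ccontr)
  assume nR: "\<not> compactin mtopology (mcball x R)"
  define C where "C = {R. 0 \<le> R \<and> compactin mtopology (mcball x R)}"
  \<comment> \<open>The ball of the critical radius S turns out to be compact and then to admit a
    compact enlargement.\<close>
  define S where "S = Sup C"
  have "mcball x 0 = {x}" using assms(3) by auto (metis nonneg order_antisym zero)
  then have C0: "0 \<in> C" using assms(3) by (simp add: C_def)
  have bd: "r \<le> R" if "r \<in> C" for r
    using that nR compactin_mcball_downward[of x r R] unfolding C_def by force
  then have bdd: "bdd_above C" by (rule bdd_aboveI)
  have S0: "0 \<le> S" unfolding S_def by (rule cSup_upper[OF C0 bdd])
  \<comment> \<open>Every point of the ball is within e / 3 of a slightly smaller ball, which is
    compact and so has a finite e / 2 net.\<close>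
  have tot: "mtotally_bounded (mcball x S)"
    unfolding mtotally_bounded_def
  proof (intro allI impI)
    fix e :: real assume e: "e > 0"
    define R' where "R' = max 0 (S - e / 3)"
    have "R' \<in> C"
    proof (cases "S - e / 3 \<le> 0")
      case True then show ?thesis using C0 by (simp add: R'_def)
    next
      case False
      have "S - e / 3 < Sup C" using e by (simp add: S_def)
      then obtain r where "r \<in> C" "S - e / 3 < r"
        using C0 by (metis empty_iff less_cSup_iff bdd)
      then show ?thesis
        using compactin_mcball_downward[of x r "S - e / 3"] False by (auto simp: C_def R'_def)
    qed
    then have "mtotally_bounded (mcball x R')"
      by (simp add: C_def compactin_imp_mtotally_bounded)
    then obtain K where K: "finite K" "K \<subseteq> mcball x R'" "mcball x R' \<subseteq> (\<Union>k\<in>K. mball k (e / 2))"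
      unfolding mtotally_bounded_def using e by (meson half_gt_zero)
    have "mcball x S \<subseteq> (\<Union>k\<in>K. mball k e)"
    proof
      fix y assume y: "y \<in> mcball x S"
      then have "y \<in> mcball x (R' + e / 3)" by (auto simp: R'_def)
      then obtain y' where y': "y' \<in> mcball x R'" "d y' y \<le> e / 3"
        using truncate_ball[of x y R' "e / 3"] assms(3) e by (auto simp: R'_def)
      then obtain k where k: "k \<in> K" "k \<in> M" "d k y' < e / 2"
        using K(3) by auto
      then have "d k y < e" using triangle[of k y' y] y y' e by auto
      then show "y \<in> (\<Union>k\<in>K. mball k e)" using k y by auto
    qed
    moreover have "R' \<le> S" using S0 e by (auto simp: R'_def)
    then have "K \<subseteq> mcball x S" using K(2) mcball_subset_concentric[of R' S x] by blast
    ultimately show "\<exists>K. finite K \<and> K \<subseteq> mcball x S \<and> mcball x S \<subseteq> (\<Union>k\<in>K. mball k e)"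
      using K(1) by blast
  qed
  have cS: "compactin mtopology (mcball x S)"
    using mtotally_bounded_eq_compact_closure_of[OF assms(1), of "mcball x S"] tot
    by (simp add: closure_of_closedin)
  \<comment> \<open>L is a compact neighbourhood of the ball; the Lebesgue number of the one-set
    cover {U} is the width of a collar inside it.\<close>
  then obtain U L where UL: "openin mtopology U" "compactin mtopology L" "mcball x S \<subseteq> U" "U \<subseteq> L"
    using assms(2) locally_compact_space_compact_closed_compact[of mtopology]
      Hausdorff_space_mtopology by blast
  obtain e where e: "e > 0" "\<And>y. y \<in> mcball x S \<Longrightarrow> mball y e \<subseteq> U"
    using lebesgue_number[OF cS, of "{U}"] UL by auto
  have "mcball x (S + e / 2) \<subseteq> L"
  proof
    fix y assume y: "y \<in> mcball x (S + e / 2)"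
    then obtain y' where y': "y' \<in> mcball x S" "d y' y \<le> e / 2"
      using truncate_ball[of x y S "e / 2"] assms(3) e S0 by auto
    then have "y \<in> mball y' e" using y e by auto
    then show "y \<in> L" using e y' UL by blast
  qed
  then have "compactin mtopology (mcball x (S + e / 2))"
    using closed_compactin[OF UL(2)] by blast
  then have "S + e / 2 \<in> C" using S0 e by (simp add: C_def)
  then have "S + e / 2 \<le> S" unfolding S_def using cSup_upper bdd by blast
  then show False using e by simp
qed

end

locale proper_CN_space = CN_space +
  assumes complete: "mcomplete"
    and compact_ball: "x \<in> M \<Longrightarrow> compactin mtopology (mcball x R)"
begin

text \<open>
  A limit ray is a cluster point of the segments \<open>[p, y n]\<close> in a product of compact balls;
  two times \<open>s\<close>, \<open>t\<close> suffice for all later uses.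
\<close>
lemma limit_ray_cluster:
  fixes y :: "nat \<Rightarrow> 'a"
  assumes "p \<in> M" "\<And>n. y n \<in> M" "\<And>R. \<exists>N. \<forall>n\<ge>N. R \<le> d p (y n)"
  obtains c where "geodesic_ray M d c" "c 0 = p"
    "\<And>s t e N. \<lbrakk>0 \<le> s; 0 \<le> t; 0 < e\<rbrakk> \<Longrightarrow> \<exists>n\<ge>N. s \<le> d p (y n) \<and> t \<le> d p (y n) \<and>
        d (c s) (gp p (y n) s) < e \<and> d (c t) (gp p (y n) t) < e"
proof -
  \<comment> \<open>Beyond its length the segment rests at \<open>y n\<close>, so that
    \<open>u n\<close> is defined at all times and lies in one fixed product of compact
    balls.\<close>
  define u where "u n = (\<lambda>t\<in>{0..}. gp p (y n) (min t (d p (y n))))" for n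
  define P where "P = product_topology (\<lambda>_. mtopology) {0::real..}"
  define K where "K = PiE {0..} (\<lambda>t. mcball p t)"
  have uK: "u n \<in> K" for n
    using assms(1,2) dist_gp(1)[of p "y n"] by (auto simp: u_def K_def)
  have "compactin P K"
    unfolding P_def K_def compactin_PiE using compact_ball assms(1) by auto
  then have cK: "compact_space (subtopology P K)" by (simp add: compactin_subspace)
  have KP: "K \<subseteq> topspace P" unfolding P_def K_def by auto
  define C where "C n = (subtopology P K) closure_of (u ` {n..})" for n :: nat
  have "(\<Inter>n. C n) \<noteq> {}"
  proof (rule compact_space_imp_nest[OF cK])
    show "closedin (subtopology P K) (C n)" for n by (simp add: C_def)
    show "C n \<noteq> {}" for n
      unfolding C_def using closure_of_subset[of "u ` {n..}" "subtopology P K"] uK KP by auto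
    show "decseq C"
      unfolding C_def decseq_def by (intro allI impI closure_of_mono) auto
  qed
  then obtain c where c: "\<And>n. c \<in> C n" by blast
  have cK: "c \<in> K"
    using c[of 0] unfolding C_def closure_of_def by auto
  have cM: "c t \<in> M" if "0 \<le> t" for t using cK that by (auto simp: K_def)
  have "c 0 \<in> mcball p 0" using cK by (auto simp: K_def)
  then have c0: "c 0 = p" using assms(1) order_antisym[OF _ nonneg[of p "c 0"]] by auto
  have cl: "\<exists>n\<ge>N. s \<le> d p (y n) \<and> t \<le> d p (y n) \<and>
        d (c s) (gp p (y n) s) < e \<and> d (c t) (gp p (y n) t) < e"
    if st: "0 \<le> s" "0 \<le> t" "0 < e" for s t e N
  proof -
    obtain N' where N': "\<And>n. n \<ge> N' \<Longrightarrow> max s t \<le> d p (y n)"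
      using assms(3) by blast
    define W where "W = {f \<in> topspace P. f s \<in> mball (c s) e} \<inter> {f \<in> topspace P. f t \<in> mball (c t) e}"
    have "openin P {f \<in> topspace P. f q \<in> mball (c q) e}" if "0 \<le> q" for q
      unfolding P_def using that
      by (intro openin_continuous_map_preimage[where Y = mtopology]
          continuous_map_product_projection) auto
    then have "openin P W" unfolding W_def using st by (intro openin_Int) auto
    moreover have "c \<in> W" unfolding W_def using st cM cK KP by auto
    ultimately obtain n where n: "n \<ge> max N N'" "u n \<in> W"
      using c[of "max N N'"] cK unfolding C_def in_closure_of
      by (auto simp: openin_subtopology)
    then have "s \<le> d p (y n)" "t \<le> d p (y n)" using N'[of n] by auto
    then show ?thesis using n st unfolding W_def u_def by auto
  qed
  have "d (c s) (c t) = \<bar>s - t\<bar>" if st: "0 \<le> s" "0 \<le> t" for s t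
  proof -
    have "\<bar>d (c s) (c t) - \<bar>s - t\<bar>\<bar> < e" if e: "e > 0" for e
    proof -
      obtain n where n: "s \<le> d p (y n)" "t \<le> d p (y n)"
        "d (c s) (gp p (y n) s) < e / 2" "d (c t) (gp p (y n) t) < e / 2"
        using cl[OF st, of "e / 2" 0] e by auto
      define q1 q2 where "q1 = gp p (y n) s" and "q2 = gp p (y n) t"
      have q: "q1 \<in> M" "q2 \<in> M" "d q1 q2 = \<bar>s - t\<bar>"
        using st n assms unfolding q1_def q2_def by (auto simp: dist_gp_gp)
      have "d (c s) (c t) \<le> d (c s) q1 + \<bar>s - t\<bar> + d (c t) q2"
        using triangle[of "c s" q1 "c t"] triangle[of q1 q2 "c t"] q cM st by (simp add: commute)
      moreover have "\<bar>s - t\<bar> \<le> d (c s) q1 + d (c s) (c t) + d (c t) q2"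
        using triangle[of q1 "c s" q2] triangle[of "c s" "c t" q2] q cM st by (simp add: commute)
      ultimately show ?thesis using n unfolding q1_def[symmetric] q2_def[symmetric] by auto
    qed
    then have "\<not> 0 < \<bar>d (c s) (c t) - \<bar>s - t\<bar>\<bar>" by blast
    then show ?thesis by simp
  qed
  then have "geodesic_ray M d c" unfolding geodesic_ray_def using cM by auto
  then show ?thesis using that c0 cl by blast
qed

text \<open>Upper bounds on the distance to a fixed point that hold along the segments eventually,
  up to an arbitrarily small error, pass to a cluster point. They are stated for squares because the
  comparison estimates are.\<close>

lemma limit_ray:
  fixes y :: "nat \<Rightarrow> 'a"
  assumes "p \<in> M" "\<And>n. y n \<in> M" "\<And>R. \<exists>N. \<forall>n\<ge>N. R \<le> d p (y n)"
  obtains c where "geodesic_ray M d c" "c 0 = p"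
    "\<And>s z A. \<lbrakk>0 \<le> s; z \<in> M;
       \<And>e. 0 < e \<Longrightarrow> \<exists>N. \<forall>n\<ge>N. s \<le> d p (y n) \<longrightarrow> (d (gp p (y n) s) z)\<^sup>2 \<le> A + e\<rbrakk>
      \<Longrightarrow> (d (c s) z)\<^sup>2 \<le> A"
proof -
  obtain c where c: "geodesic_ray M d c" "c 0 = p"
    "\<And>s t e N. \<lbrakk>0 \<le> s; 0 \<le> t; 0 < e\<rbrakk> \<Longrightarrow> \<exists>n\<ge>N. s \<le> d p (y n) \<and> t \<le> d p (y n) \<and>
        d (c s) (gp p (y n) s) < e \<and> d (c t) (gp p (y n) t) < e"
    using limit_ray_cluster[OF assms] by metis
  have "(d (c s) z)\<^sup>2 \<le> A"
    if s: "0 \<le> s" "z \<in> M"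
      and H: "\<And>e. 0 < e \<Longrightarrow> \<exists>N. \<forall>n\<ge>N. s \<le> d p (y n) \<longrightarrow> (d (gp p (y n) s) z)\<^sup>2 \<le> A + e"
    for s z A
  proof (rule ccontr)
    assume n: "\<not> (d (c s) z)\<^sup>2 \<le> A"
    define D h where "D = d (c s) z" and "h = (D\<^sup>2 - A) / 2"
    have h: "h > 0" "A + h = D\<^sup>2 - h"
      using n by (auto simp: h_def D_def field_simps)
    obtain N where N: "\<And>n. n \<ge> N \<Longrightarrow> s \<le> d p (y n) \<Longrightarrow> (d (gp p (y n) s) z)\<^sup>2 \<le> A + h"
      using H[OF h(1)] by blast
    have "D\<^sup>2 > 0"
    proof -
      obtain n where "n \<ge> N" "s \<le> d p (y n)" using c(3)[OF s(1) s(1), of 1] by auto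
      then have "0 \<le> A + h" using N by (meson order_trans zero_le_power2)
      then show ?thesis using h by linarith
    qed
    moreover have "D \<ge> 0" by (simp add: D_def)
    ultimately have D: "D > 0" by (cases "D = 0") auto
    \<comment> \<open>Being off by e lowers the square by at most 2 * D * e, which is less than the
      gap h.\<close>
    define e where "e = h / (4 * D)"
    have e: "e > 0" "2 * D * e < h" using h D by (auto simp: e_def)
    obtain n where n: "n \<ge> N" "s \<le> d p (y n)" "d (c s) (gp p (y n) s) < e"
      using c(3)[OF s(1) s(1) e(1)] by auto
    define g where "g = d (gp p (y n) s) z"
    have "D \<le> e + g"
      using triangle[of "c s" "gp p (y n) s" z] n s assms c(1)
      unfolding D_def g_def geodesic_ray_def by force
    moreover have "g\<^sup>2 \<le> D\<^sup>2 - h" using N[OF n(1,2)] h by (simp add: g_def)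
    moreover have "e \<le> D"
    proof -
      have "h \<le> D * D"
        using \<open>g\<^sup>2 \<le> D\<^sup>2 - h\<close> zero_le_power2[of g] unfolding power2_eq_square by linarith
      then have "h / (4 * D) \<le> D * D / (4 * D)" using D by (intro divide_right_mono) auto
      then show ?thesis using D by (simp add: e_def)
    qed
    ultimately have "(D - e)\<^sup>2 \<le> g\<^sup>2" by (intro power_mono) auto
    also have "\<dots> \<le> D\<^sup>2 - h" by fact
    finally have "(D - e)\<^sup>2 \<le> D\<^sup>2 - h" .
    then show False using e zero_le_power2[of e] by (simp add: power2_diff)
  qed
  then show ?thesis using that c by blast
qed

text \<open>The new ray is a limit of the segments from p to c n. The change of base point accounts
  for \<open>2 * d (c 0) p\<close>, and the 1 is the tolerance at the cluster point.\<close>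

lemma asymptotic_ray_from:
  assumes "geodesic_ray M d c" "p \<in> M"
  obtains e where "geodesic_ray M d e" "e 0 = p" "\<And>t. 0 \<le> t \<Longrightarrow> d (c t) (e t) \<le> 2 * d (c 0) p + 1"
proof -
  have cM: "\<And>t. 0 \<le> t \<Longrightarrow> c t \<in> M" and cd: "\<And>s t. 0 \<le> s \<Longrightarrow> 0 \<le> t \<Longrightarrow> d (c s) (c t) = \<bar>s - t\<bar>"
    using assms(1) unfolding geodesic_ray_def by auto
  have far: "real n - d (c 0) p \<le> d p (c (real n))" for n
    using triangle[of "c 0" p "c (real n)"] cM assms(2) cd[of 0 "real n"] by simp
  have inf: "\<exists>N. \<forall>n\<ge>N. R \<le> d p (c (real n))" for R
  proof -
    obtain N :: nat where "R + d (c 0) p \<le> real N" using real_arch_simple by blast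
    then show ?thesis using far by (intro exI[of _ N]) (smt (verit) of_nat_mono)
  qed
  obtain e where e: "geodesic_ray M d e" "e 0 = p"
    "\<And>s t q N. \<lbrakk>0 \<le> s; 0 \<le> t; 0 < q\<rbrakk> \<Longrightarrow> \<exists>n\<ge>N. s \<le> d p (c (real n)) \<and> t \<le> d p (c (real n)) \<and>
        d (e s) (gp p (c (real n)) s) < q \<and> d (e t) (gp p (c (real n)) t) < q"
    using limit_ray_cluster[of p "\<lambda>n. c (real n)"] assms(2) cM inf by (metis of_nat_0_le_iff)
  have "d (c t) (e t) \<le> 2 * d (c 0) p + 1" if t: "0 \<le> t" for t
  proof -
    obtain N :: nat where N: "t \<le> real N" using real_arch_simple by blast
    obtain n where n: "n \<ge> N" "t \<le> d p (c (real n))" "d (e t) (gp p (c (real n)) t) < 1"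
      using e(3)[OF t t, of 1 N] by auto
    have tn: "t \<le> real n" using N n(1) by linarith
    have "d (gp (c 0) (c (real n)) t) (gp p (c (real n)) t) \<le> 2 * d (c 0) p"
      using cM cd[of 0 "real n"] assms(2) t n tn by (intro gp_change_base) auto
    then have "d (c t) (gp p (c (real n)) t) \<le> 2 * d (c 0) p"
      using ray_gp[OF assms(1) t tn] by simp
    then show ?thesis
      using triangle[of "c t" "gp p (c (real n)) t" "e t"] n t cM e(1) assms(2)
      unfolding geodesic_ray_def by (simp add: commute)
  qed
  then show ?thesis using that e by blast
qed

end

section \<open>Flat half-planes\<close>

text \<open>Reflect a at z: a value below 0 at a would force one above 0 at the mirror point. Below,
  this rigidity turns comparison inequalities for distances to a line into equalities.\<close>

lemma midconvex_nonpos_eq_0: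
  fixes \<phi> :: "real \<Rightarrow> real"
  assumes "\<And>a b. \<phi> ((a + b) / 2) \<le> \<phi> a / 2 + \<phi> b / 2" "\<And>a. \<phi> a \<le> 0" "\<phi> z = 0"
  shows "\<phi> a = 0"
proof -
  have "\<phi> z \<le> \<phi> a / 2 + \<phi> (2 * z - a) / 2" using assms(1)[of a "2 * z - a"] by simp
  then show ?thesis using assms(2)[of a] assms(2)[of "2 * z - a"] assms(3) by linarith
qed

context CN_space
begin

lemma dist_sq_midpoint_line:
  assumes "geodesic_line M d c" "z \<in> M"
  shows "(d (c ((a + b) / 2)) z)\<^sup>2 \<le> (d (c a) z)\<^sup>2 / 2 + (d (c b) z)\<^sup>2 / 2 - (a - b)\<^sup>2 / 4"
  using dist_sq_convex_line[OF assms, of "1/2" a b] by (simp add: add_divide_distrib)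

text \<open>
  Distances between interior points are bounded below by prolonging the segment between
  them until it meets the boundary line.
\<close>
lemma half_plane_isometric:
  fixes F :: "real \<times> real \<Rightarrow> 'a"
  assumes in_M: "\<And>u v. 0 \<le> u \<Longrightarrow> F (u, v) \<in> M"
    and le: "\<And>u v u' v'. 0 \<le> u \<Longrightarrow> 0 \<le> u' \<Longrightarrow> d (F (u, v)) (F (u', v')) \<le> dist (u, v) (u', v')"
    and bd: "\<And>u v w. 0 \<le> u \<Longrightarrow> d (F (0, w)) (F (u, v)) = dist (0, w) (u, v)"
    and "0 \<le> u" "0 \<le> u'"
  shows "d (F (u, v)) (F (u', v')) = dist (u, v) (u', v')"
proof -
  have lt: "dist (u, v) (u', v') \<le> d (F (u, v)) (F (u', v'))" if u: "0 \<le> u" "u < u'" for u u' v v'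
  proof -
    \<comment> \<open>The Euclidean line through the two points meets the boundary at (0, w); the
      distances from there to the two points are \<open>lam\<close> and 1 + \<open>lam\<close> times
      their mutual distance.\<close>
    define lam where "lam = u / (u' - u)"
    define w where "w = v - lam * (v' - v)"
    have lam: "0 \<le> lam" "lam * (u' - u) = u" using u by (auto simp: lam_def)
    have e: "u - 0 = lam * (u' - u)" "v - w = lam * (v' - v)"
      "u' - 0 = (1 + lam) * (u' - u)" "v' - w = (1 + lam) * (v' - v)"
      using lam by (auto simp: w_def algebra_simps)
    have sq: "sqrt ((k * a)\<^sup>2 + (k * b)\<^sup>2) = k * sqrt (a\<^sup>2 + b\<^sup>2)" if "k \<ge> 0" for k a b :: real
      using that by (simp add: power_mult_distrib real_sqrt_mult flip: distrib_left)
    have D: "dist (a, b) (a', b') = sqrt ((a' - a)\<^sup>2 + (b' - b)\<^sup>2)" for a b a' b' :: real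
      by (simp only: dist_Pair_Pair dist_real_def power2_abs power2_commute[of a] power2_commute[of b])
    have "dist (0, w) (u, v) = lam * dist (u, v) (u', v')"
      unfolding D e using lam(1) by (rule sq)
    moreover have "dist (0, w) (u', v') = (1 + lam) * dist (u, v) (u', v')"
      unfolding D e by (rule sq) (use lam(1) in simp)
    moreover have "d (F (0, w)) (F (u', v')) \<le> d (F (0, w)) (F (u, v)) + d (F (u, v)) (F (u', v'))"
      using in_M u by (intro triangle) auto
    ultimately show ?thesis using bd u by (simp add: algebra_simps)
  qed
  have "dist (u, v) (u', v') \<le> d (F (u, v)) (F (u', v'))"
  proof (cases u u' rule: linorder_cases)
    case less then show ?thesis using lt assms by auto
  next
    case greater then show ?thesis using lt[of u' u v' v] assms by (auto simp: commute dist_commute)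
  next
    case equal
    \<comment> \<open>A segment parallel to the boundary never meets it, so one end is first pushed
      away from the boundary by e'.\<close>
    show ?thesis
    proof (rule field_le_epsilon)
      fix e :: real assume e: "0 < e"
      define e' where "e' = e / 2"
      have e': "e' > 0" "e' + e' = e" using e by (auto simp: e'_def)
      have q: "dist (u', v') (u' + e', v') = e'" "dist (u' + e', v') (u', v') = e'"
        using e' by (auto simp: dist_Pair_Pair dist_real_def)
      have "dist (u, v) (u', v') \<le> dist (u, v) (u' + e', v') + e'"
        using dist_triangle[of "(u, v)" "(u', v')" "(u' + e', v')"] q by simp
      also have "dist (u, v) (u' + e', v') \<le> d (F (u, v)) (F (u' + e', v'))"
        using lt[of u "u' + e'" v v'] equal assms e' by simp
      also have "d (F (u, v)) (F (u' + e', v')) \<le> d (F (u, v)) (F (u', v')) + d (F (u', v')) (F (u' + e', v'))"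
        using in_M assms e' by (intro triangle) auto
      also have "d (F (u', v')) (F (u' + e', v')) \<le> e'"
        using le[of u' "u' + e'" v' v'] q assms e' by simp
      finally show "dist (u, v) (u', v') \<le> d (F (u, v)) (F (u', v')) + e" using e' by simp
    qed
  qed
  then show ?thesis using le assms by (simp add: antisym)
qed

end

context proper_CN_space
begin

lemma closedin_isometric_image:
  fixes F :: "'b :: complete_space \<Rightarrow> 'a"
  assumes "closed S" "\<And>p. p \<in> S \<Longrightarrow> F p \<in> M" "\<And>p q. p \<in> S \<Longrightarrow> q \<in> S \<Longrightarrow> d (F p) (F q) = dist p q"
  shows "closedin mtopology (F ` S)"
  unfolding metric_closedin_iff_sequentially_closed
proof (intro conjI allI impI)
  show "F ` S \<subseteq> M" using assms(2) by blast
  fix \<sigma> l assume H: "range \<sigma> \<subseteq> F ` S \<and> limitin mtopology \<sigma> l sequentially"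
  then have ex: "\<forall>n. \<exists>p. p \<in> S \<and> \<sigma> n = F p" by auto
  obtain p where "\<forall>n. p n \<in> S \<and> \<sigma> n = F (p n)"
    using choice[OF ex] by blast
  then have p: "p n \<in> S" "\<sigma> n = F (p n)" for n by auto
  have "range \<sigma> \<subseteq> M" unfolding image_subset_iff p(2) using assms(2) p(1) by simp
  then have mc: "MCauchy \<sigma>" using H convergent_imp_MCauchy by blast
  have "Cauchy p"
  proof (rule metric_CauchyI)
    fix e :: real assume "e > 0"
    then obtain N where "\<And>n n'. N \<le> n \<Longrightarrow> N \<le> n' \<Longrightarrow> d (\<sigma> n) (\<sigma> n') < e"
      using mc unfolding MCauchy_def by blast
    moreover have "d (\<sigma> n) (\<sigma> n') = dist (p n) (p n')" for n n'
      unfolding p(2) by (rule assms(3)[OF p(1) p(1)])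
    ultimately show "\<exists>N. \<forall>m\<ge>N. \<forall>n\<ge>N. dist (p m) (p n) < e" by auto
  qed
  then obtain q where q: "p \<longlonglongrightarrow> q" using Cauchy_convergent convergent_def by blast
  then have qS: "q \<in> S" using closed_sequentially assms(1) p(1) by blast
  have "limitin mtopology \<sigma> (F q) sequentially"
    unfolding limit_metric_sequentially
  proof (intro conjI allI impI)
    show "F q \<in> M" using assms(2) qS by blast
    fix e :: real assume "0 < e"
    then obtain N where "\<And>n. N \<le> n \<Longrightarrow> dist (p n) q < e"
      using q unfolding lim_sequentially by blast
    moreover have "d (\<sigma> n) (F q) = dist (p n) q" "\<sigma> n \<in> M" for n
      unfolding p(2) using assms(2,3) p(1) qS by auto
    ultimately show "\<exists>N. \<forall>n\<ge>N. \<sigma> n \<in> M \<and> d (\<sigma> n) (F q) < e" by auto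
  qed
  then have "l = F q" using H limitin_metric_unique trivial_limit_sequentially by blast
  then show "l \<in> F ` S" using qS by blast
qed

text \<open>Closedness and convexity come for free: the isometric image of a complete set is closed,
  and the image of a Euclidean segment is the unique geodesic between its ends.\<close>

lemma bounds_flat_half_planeI:
  fixes F :: "real \<times> real \<Rightarrow> 'a"
  assumes in_M: "\<And>p. p \<in> {0..} \<times> UNIV \<Longrightarrow> F p \<in> M"
    and iso: "\<And>p q. p \<in> {0..} \<times> UNIV \<Longrightarrow> q \<in> {0..} \<times> UNIV \<Longrightarrow> d (F p) (F q) = dist p q"
    and bd: "\<And>v. F (0, v) = \<sigma> v"
  shows "bounds_flat_half_plane M d \<sigma>"
  unfolding bounds_flat_half_plane_def
proof (intro exI conjI)
  let ?H = "{0..} \<times> UNIV :: (real \<times> real) set"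
  show "F ` ?H \<subseteq> M" using in_M by blast
  show "closedin mtopology (F ` ?H)"
  proof (rule closedin_isometric_image)
    show "closed ?H" by (intro closed_Times closed_atLeast closed_UNIV)
  qed (fact in_M, fact iso)
  show "geodesically_convex M d (F ` ?H)"
    unfolding geodesically_convex_def
  proof (intro ballI allI impI)
    fix x y c assume "x \<in> F ` ?H" "y \<in> F ` ?H" and c: "geodesic_segment M d c x y"
    then obtain p q where pq: "p \<in> ?H" "q \<in> ?H" "x = F p" "y = F q" by blast
    have xy: "x \<in> M" "y \<in> M" "d x y = dist p q" using pq in_M iso by auto
    show "c ` {0..d x y} \<subseteq> F ` ?H"
    proof
      fix z assume "z \<in> c ` {0..d x y}"
      then obtain t where t: "t \<in> {0..d x y}" "z = c t" by blast
      define s where "s = t / d x y"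
      have s: "0 \<le> s" "s \<le> 1" "s * d x y = t" unfolding s_def using ratio_bounds t by auto
      define m where "m = (1 - s) *\<^sub>R p + s *\<^sub>R q"
      have m: "m \<in> ?H"
        using pq(1,2) s(1,2) unfolding m_def mem_Times_iff by simp
      have "p - m = s *\<^sub>R (p - q)" "m - q = (1 - s) *\<^sub>R (p - q)"
        unfolding m_def by (simp_all add: algebra_simps)
      then have "dist p m = s * dist p q" "dist m q = (1 - s) * dist p q"
        unfolding dist_norm using s by simp_all
      then have "dist p m = t" "dist m q = d x y - t"
        using s(3) xy(3) by (simp_all add: algebra_simps)
      then have "F m = gp x y t"
        using xy t pq m iso in_M by (intro gp_unique) auto
      then have "z = F m" using geodesic_segment_eq_gp[OF c t(1)] t by simp
      then show "z \<in> F ` ?H" using m by (rule image_eqI)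
    qed
  qed
  show "F ` ?H = F ` ?H" ..
  show "\<forall>p\<in>?H. \<forall>q\<in>?H. d (F p) (F q) = dist p q" using iso by blast
  show "F ` ({0} \<times> UNIV) = range \<sigma>" 
  proof (intro equalityI subsetI)
    show "x \<in> range \<sigma>" if "x \<in> F ` ({0} \<times> UNIV)" for x using that bd by auto
    show "x \<in> F ` ({0} \<times> UNIV)" if "x \<in> range \<sigma>" for x
    proof -
      obtain v where "x = F (0, v)" using \<open>x \<in> range \<sigma>\<close> bd by auto
      then show ?thesis by blast
    qed
  qed
qed

text \<open>
  If the angles of a ray with the two halves of a line add up to at most \<open>\<pi>\<close> (the two angles
  have cosines \<open>-m\<close> and \<open>m\<close>), then the ray and the line span a flat half-plane, which
  is swept out by the midpoints of the points of the line and the points of the ray.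
\<close>
lemma flat_half_plane_criterion:
  fixes l m :: real
  assumes line: "geodesic_line M d \<sigma>" and ray: "geodesic_ray M d c" and c0: "c 0 = \<sigma> 0"
    and m: "\<bar>m\<bar> < 1" and l: "0 < l"
    and le: "\<And>s (j::int). 0 \<le> s \<Longrightarrow>
      (d (c s) (\<sigma> (of_int j * l)))\<^sup>2 \<le> s\<^sup>2 + (of_int j * l)\<^sup>2 + 2 * m * s * (of_int j * l)"
  shows "bounds_flat_half_plane M d \<sigma>"
proof -
  have \<sigma>M: "\<And>t. \<sigma> t \<in> M" and \<sigma>d: "\<And>s t. d (\<sigma> s) (\<sigma> t) = \<bar>s - t\<bar>"
    using line unfolding geodesic_line_def by auto
  have cM: "\<And>t. 0 \<le> t \<Longrightarrow> c t \<in> M" and cd: "\<And>s t. 0 \<le> s \<Longrightarrow> 0 \<le> t \<Longrightarrow> d (c s) (c t) = \<bar>s - t\<bar>"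
    using ray unfolding geodesic_ray_def by auto
  \<comment> \<open>The squared distance in the plane between the point at s on the ray and the
    point at a on the line, if ray and line form an angle with cosine -m.\<close>
  define Q where "Q s a = s\<^sup>2 + a\<^sup>2 + 2 * m * s * a" for s a :: real
  have Qle: "(d (\<sigma> a) (c s))\<^sup>2 \<le> Q s a" if s: "0 \<le> s" for s a
  proof -
    \<comment> \<open>The hypothesis concerns multiples of l only. Between two of them
      \<open>dist_sq_convex_line\<close> interpolates, and for Q this interpolation is
      exact.\<close>
    define j where "j = \<lfloor>a / l\<rfloor>"
    define u where "u = a / l - of_int j"
    have u: "0 \<le> u" "u \<le> 1" unfolding u_def j_def by linarith+
    define a1 a2 where "a1 = of_int j * l" and "a2 = of_int (j + 1) * l"
    have "u * l = a - of_int j * l" using l by (simp add: u_def left_diff_distrib)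
    then have a: "a = (1 - u) * a1 + u * a2" "a1 - a2 = - l"
      unfolding a1_def a2_def by (simp_all add: algebra_simps)
    have 1: "(d (\<sigma> a1) (c s))\<^sup>2 \<le> Q s a1" "(d (\<sigma> a2) (c s))\<^sup>2 \<le> Q s a2"
      using le[OF s, of j] le[OF s, of "j + 1"] unfolding Q_def a1_def a2_def
      by (simp_all add: commute[of "c s"])
    have "(d (\<sigma> a) (c s))\<^sup>2 \<le> (1 - u) * (d (\<sigma> a1) (c s))\<^sup>2 + u * (d (\<sigma> a2) (c s))\<^sup>2 - u * (1 - u) * (a1 - a2)\<^sup>2"
      using dist_sq_convex_line[OF line cM[OF s] u, of a1 a2] a(1) by simp
    also have "\<dots> \<le> (1 - u) * Q s a1 + u * Q s a2 - u * (1 - u) * (a1 - a2)\<^sup>2"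
      using mult_left_mono[OF 1(1), of "1 - u"] mult_left_mono[OF 1(2), of u] u by linarith
    also have "\<dots> = Q s ((1 - u) * a1 + u * a2)"
      unfolding Q_def by (simp add: power2_eq_square algebra_simps)
    also have "\<dots> = Q s a" using a(1) by simp
    finally show ?thesis .
  qed
  \<comment> \<open>At a = 0 the inequality is an equality, and the quadratic part of
    \<open>Q s a\<close> in a matches the correction term of \<open>CN\<close>, so rigidity gives
    equality for all a.\<close>
  have Q: "(d (\<sigma> a) (c s))\<^sup>2 = Q s a" if s: "0 \<le> s" for s a
  proof -
    have "(d (\<sigma> a) (c s))\<^sup>2 - Q s a = 0"
    proof (rule midconvex_nonpos_eq_0[where z = 0 and \<phi> = "\<lambda>a. (d (\<sigma> a) (c s))\<^sup>2 - Q s a"])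
      fix a b
      show "(d (\<sigma> ((a + b) / 2)) (c s))\<^sup>2 - Q s ((a + b) / 2)
        \<le> ((d (\<sigma> a) (c s))\<^sup>2 - Q s a) / 2 + ((d (\<sigma> b) (c s))\<^sup>2 - Q s b) / 2"
        using dist_sq_midpoint_line[OF line cM[OF s], of a b]
        by (simp add: Q_def power2_eq_square field_simps)
    next
      show "(d (\<sigma> a) (c s))\<^sup>2 - Q s a \<le> 0" for a using Qle[OF s] by simp
      show "(d (\<sigma> 0) (c s))\<^sup>2 - Q s 0 = 0"
        using c0 cd[of 0 s] s by (simp add: Q_def)
    qed
    then show ?thesis by simp
  qed
  \<comment> \<open>Oblique coordinates on the half-plane to be built: \<open>f a b\<close> stands
    for a times the direction of the line plus b times that of the ray, realised as a midpoint,
    whence the factors 2. N is the squared norm in these coordinates.\<close>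
  define f where "f a b = pt (\<sigma> (2 * a)) (c (2 * b)) (1 / 2)" for a b
  define N where "N a b = a\<^sup>2 + b\<^sup>2 - 2 * m * a * b" for a b
  have fM: "f a b \<in> M" if "0 \<le> b" for a b using that \<sigma>M cM by (simp add: f_def)
  have f0: "f a 0 = \<sigma> a" for a
    unfolding f_def using \<sigma>M c0 \<sigma>d by (intro pt_unique[symmetric]) auto
  have fle: "(d (f a b) (f a' b'))\<^sup>2 \<le> N (a - a') (b - b')" if b: "0 \<le> b" "0 \<le> b'" for a b a' b'
  proof -
    let ?x = "\<sigma> (2 * a)" and ?y = "c (2 * b)" and ?z = "f a' b'"
    have z: "(d w ?z)\<^sup>2 \<le> (d w (\<sigma> (2 * a')))\<^sup>2 / 2 + (d w (c (2 * b')))\<^sup>2 / 2 - Q (2 * b') (2 * a') / 4"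
      if "w \<in> M" for w
      using pt_CN[of "\<sigma> (2 * a')" "c (2 * b')" w "1/2"] \<sigma>M cM b that Q[of "2 * b'" "2 * a'"]
      unfolding f_def by (simp add: commute[of w])
    have "(d (f a b) ?z)\<^sup>2 \<le> (d ?x ?z)\<^sup>2 / 2 + (d ?y ?z)\<^sup>2 / 2 - Q (2 * b) (2 * a) / 4"
      using pt_CN[of "\<sigma> (2 * a)" "c (2 * b)" ?z "1/2"] \<sigma>M cM b fM Q[of "2 * b" "2 * a"]
      unfolding f_def[of a b] by simp
    moreover have "(d ?x ?z)\<^sup>2 \<le> (2 * a - 2 * a')\<^sup>2 / 2 + Q (2 * b') (2 * a) / 2 - Q (2 * b') (2 * a') / 4"
      using z[of ?x] \<sigma>M \<sigma>d b Q[of "2 * b'" "2 * a"] by simp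
    moreover have "(d ?y ?z)\<^sup>2 \<le> Q (2 * b) (2 * a') / 2 + (2 * b - 2 * b')\<^sup>2 / 2 - Q (2 * b') (2 * a') / 4"
      using z[of ?y] cM cd b Q[of "2 * b" "2 * a'"] by (simp add: commute[of ?y "\<sigma> _"])
    moreover have "X \<le> A' / 2 + B' / 2 - C" if "X \<le> A / 2 + B / 2 - C" "A \<le> A'" "B \<le> B'"
      for X A B C A' B' :: real using that by linarith
    ultimately have "(d (f a b) ?z)\<^sup>2 \<le> ((2 * a - 2 * a')\<^sup>2 / 2 + Q (2 * b') (2 * a) / 2 - Q (2 * b') (2 * a') / 4) / 2
      + (Q (2 * b) (2 * a') / 2 + (2 * b - 2 * b')\<^sup>2 / 2 - Q (2 * b') (2 * a') / 4) / 2 - Q (2 * b) (2 * a) / 4"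
      by blast
    also have "\<dots> = N (a - a') (b - b')" unfolding Q_def N_def by (simp add: power2_eq_square field_simps)
    finally show ?thesis .
  qed
  \<comment> \<open>Rigidity again. Contact is now at e = 2 * a, an end of the segment whose
    midpoint is \<open>f a b\<close>.\<close>
  have fbd: "(d (\<sigma> e) (f a b))\<^sup>2 = N (a - e) b" if b: "0 \<le> b" for e a b
  proof -
    have "(d (\<sigma> e) (f a b))\<^sup>2 - N (a - e) b = 0"
    proof (rule midconvex_nonpos_eq_0[where z = "2 * a" and \<phi> = "\<lambda>e. (d (\<sigma> e) (f a b))\<^sup>2 - N (a - e) b"])
      fix e1 e2
      show "(d (\<sigma> ((e1 + e2) / 2)) (f a b))\<^sup>2 - N (a - (e1 + e2) / 2) b
        \<le> ((d (\<sigma> e1) (f a b))\<^sup>2 - N (a - e1) b) / 2 + ((d (\<sigma> e2) (f a b))\<^sup>2 - N (a - e2) b) / 2"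
        using dist_sq_midpoint_line[OF line fM[OF b], of e1 e2 a]
        by (simp add: N_def power2_eq_square field_simps)
    next
      show "(d (\<sigma> e) (f a b))\<^sup>2 - N (a - e) b \<le> 0" for e
        using fle[OF b, of 0 a e] by (simp add: f0 commute)
      have "d (\<sigma> (2 * a)) (f a b) = d (\<sigma> (2 * a)) (c (2 * b)) / 2"
        unfolding f_def using dist_pt_left[of "\<sigma> (2 * a)" "c (2 * b)" "1/2"] \<sigma>M cM b by simp
      then have "(d (\<sigma> (2 * a)) (f a b))\<^sup>2 = (d (\<sigma> (2 * a)) (c (2 * b)))\<^sup>2 / 4"
        by (simp only: power_divide) simp
      also have "\<dots> = Q (2 * b) (2 * a) / 4" using Q[of "2 * b" "2 * a"] b by simp
      also have "\<dots> = N (a - 2 * a) b"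
        by (simp add: Q_def N_def power2_eq_square)
      finally have "(d (\<sigma> (2 * a)) (f a b))\<^sup>2 = N (a - 2 * a) b" .
      then show "(d (\<sigma> (2 * a)) (f a b))\<^sup>2 - N (a - 2 * a) b = 0"
        by simp
    qed
    then show ?thesis by simp
  qed
  \<comment> \<open>The sine of the angle. F passes from oblique to orthonormal coordinates, the
    first of which is the distance from the line.\<close>
  define k where "k = sqrt (1 - m\<^sup>2)"
  have "m\<^sup>2 < 1" using m by (simp add: abs_square_less_1)
  then have k: "k > 0" "k * k = 1 - m * m" by (auto simp: k_def power2_eq_square)
  define F where "F p = f (snd p + m * (fst p / k)) (fst p / k)" for p
  have N: "N (v + m * (u / k)) (u / k) = u\<^sup>2 + v\<^sup>2" for u v
  proof -
    have "N (v + m * b) b = v\<^sup>2 + (1 - m * m) * b\<^sup>2" for b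
      unfolding N_def by (simp add: power2_eq_square algebra_simps)
    then have "N (v + m * (u / k)) (u / k) = v\<^sup>2 + (1 - m * m) * (u / k)\<^sup>2" .
    also have "(1 - m * m) * (u / k)\<^sup>2 = u\<^sup>2"
      using k(1) unfolding k(2)[symmetric] by (simp add: power2_eq_square)
    finally show ?thesis by simp
  qed
  have F_in: "F (u, v) \<in> M" if "0 \<le> u" for u v using that k fM by (simp add: F_def)
  have F_le: "d (F (u, v)) (F (u', v')) \<le> dist (u, v) (u', v')" if "0 \<le> u" "0 \<le> u'" for u v u' v'
  proof -
    have "(d (F (u, v)) (F (u', v')))\<^sup>2 \<le> N ((v + m * (u / k)) - (v' + m * (u' / k))) (u / k - u' / k)"
      unfolding F_def using that k by (auto intro: fle)
    also have "\<dots> = N ((v - v') + m * ((u - u') / k)) ((u - u') / k)"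
      by (simp add: algebra_simps diff_divide_distrib)
    also have "\<dots> = (u - u')\<^sup>2 + (v - v')\<^sup>2" by (rule N)
    finally show ?thesis by (simp add: dist_Pair_Pair dist_real_def real_le_rsqrt)
  qed
  have F_bd: "d (F (0, w)) (F (u, v)) = dist (0, w) (u, v)" if "0 \<le> u" for u v w
  proof -
    have "(d (F (0, w)) (F (u, v)))\<^sup>2 = N ((v + m * (u / k)) - w) (u / k)"
      unfolding F_def using that k by (simp add: f0 fbd)
    also have "\<dots> = N ((v - w) + m * (u / k)) (u / k)" by (simp add: algebra_simps)
    also have "\<dots> = u\<^sup>2 + (v - w)\<^sup>2" by (rule N)
    finally have "d (F (0, w)) (F (u, v)) = sqrt (u\<^sup>2 + (v - w)\<^sup>2)"
      by (metis nonneg real_sqrt_unique)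
    then show ?thesis by (simp add: dist_Pair_Pair dist_real_def power2_commute)
  qed
  have iso: "d (F (u, v)) (F (u', v')) = dist (u, v) (u', v')" if "0 \<le> u" "0 \<le> u'" for u v u' v'
    by (rule half_plane_isometric[OF F_in F_le F_bd that]) auto
  show ?thesis
  proof (rule bounds_flat_half_planeI[where F = F])
    show "F (0, v) = \<sigma> v" for v by (simp add: F_def f0)
  qed (use F_in iso in auto)
qed

end

section \<open>Rank one lines\<close>

context CN_space
begin

text \<open>At the point nearest to p, neither direction along the segment forms an acute angle with
  the segment back to p; hence a Pythagorean inequality towards either end.\<close>

lemma nearest_on_segment:
  assumes "x \<in> M" "y \<in> M" "p \<in> M"
  obtains u where "0 \<le> u" "u \<le> 1" "(d (pt x y u) x)\<^sup>2 \<le> (d p x)\<^sup>2 - (d p (pt x y u))\<^sup>2"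
    "(d (pt x y u) y)\<^sup>2 \<le> (d p y)\<^sup>2 - (d p (pt x y u))\<^sup>2"
proof -
  have lip: "\<bar>d p (pt x y u) - d p (pt x y v)\<bar> \<le> d x y * dist u v"
    if "u \<in> {0..1}" "v \<in> {0..1}" for u v
  proof -
    have "d (pt x y u) (pt x y v) = d x y * dist u v"
      using that assms by (simp add: dist_pt_pt dist_real_def)
    then show ?thesis
      using triangle[of p "pt x y u" "pt x y v"] triangle[of p "pt x y v" "pt x y u"] that assms
      by (simp add: commute[of "pt x y v" "pt x y u"])
  qed
  have "continuous_on {0..1} (\<lambda>u. d p (pt x y u))"
    unfolding continuous_on_iff
  proof (intro ballI allI impI)
    fix u e :: real assume u: "u \<in> {0..1}" and e: "0 < e"
    show "\<exists>r>0. \<forall>v\<in>{0..1}. dist v u < r \<longrightarrow> dist (d p (pt x y v)) (d p (pt x y u)) < e"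
    proof (intro exI conjI ballI impI)
      show "0 < e / (d x y + 1)" using e by (simp add: add_nonneg_pos)
      fix v :: real assume v: "v \<in> {0..1}" "dist v u < e / (d x y + 1)"
      have "dist (d p (pt x y v)) (d p (pt x y u)) \<le> d x y * dist v u"
        using lip[OF v(1) u] by (simp add: dist_real_def)
      also have "\<dots> \<le> (d x y + 1) * dist v u" by (intro mult_right_mono) auto
      also have "\<dots> < e" using v(2) by (simp add: pos_less_divide_eq add_nonneg_pos mult.commute)
      finally show "dist (d p (pt x y v)) (d p (pt x y u)) < e" .
    qed
  qed
  then obtain u where u: "u \<in> {0..1}" "\<And>v. v \<in> {0..1} \<Longrightarrow> d p (pt x y u) \<le> d p (pt x y v)"
    using continuous_attains_inf[of "{0..1::real}" "\<lambda>u. d p (pt x y u)"] by auto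
  let ?q = "pt x y u"
  have q: "?q \<in> M" using assms u by simp
  \<comment> \<open>First variation: move from q towards w by a small fraction e, apply
    \<open>pt_CN\<close> and divide by e. The premise \<open>on\<close> says that this motion stays
    on the segment.\<close>
  have ineq: "(d ?q w)\<^sup>2 \<le> (d p w)\<^sup>2 - (d p ?q)\<^sup>2"
    if w: "w \<in> M" and on: "\<And>e. 0 \<le> e \<Longrightarrow> e \<le> 1 \<Longrightarrow> \<exists>v\<in>{0..1}. pt ?q w e = pt x y v" for w
  proof (rule field_le_epsilon)
    fix h :: real assume h: "0 < h"
    define e where "e = min 1 (h / ((d ?q w)\<^sup>2 + 1))"
    have b: "0 < (d ?q w)\<^sup>2 + 1" by (simp add: add_nonneg_pos)
    have e: "0 < e" "e \<le> 1" using h b by (auto simp: e_def)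
    have "e * ((d ?q w)\<^sup>2 + 1) \<le> h"
      unfolding pos_le_divide_eq[OF b, symmetric] by (simp add: e_def)
    then have eh: "e * (d ?q w)\<^sup>2 \<le> h" using e(1) by (simp add: algebra_simps)
    have "d p ?q \<le> d p (pt ?q w e)" using on[of e] e u(2) by force
    then have "(d p ?q)\<^sup>2 \<le> (d (pt ?q w e) p)\<^sup>2" by (simp add: commute[of p] power_mono)
    also have "\<dots> \<le> (1 - e) * (d p ?q)\<^sup>2 + e * (d p w)\<^sup>2 - e * (1 - e) * (d ?q w)\<^sup>2"
      using pt_CN[of ?q w p e] q w assms e by (simp add: commute[of p])
    finally have "0 \<le> e * ((d p w)\<^sup>2 - (d p ?q)\<^sup>2 - (1 - e) * (d ?q w)\<^sup>2)"
      by (simp add: algebra_simps)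
    then have "0 \<le> (d p w)\<^sup>2 - (d p ?q)\<^sup>2 - (1 - e) * (d ?q w)\<^sup>2"
      using e(1) by (simp add: zero_le_mult_iff)
    then show "(d ?q w)\<^sup>2 \<le> (d p w)\<^sup>2 - (d p ?q)\<^sup>2 + h" using eh by (simp add: algebra_simps)
  qed
  have "\<exists>v\<in>{0..1}. pt ?q y e = pt x y v" if e: "0 \<le> e" "e \<le> 1" for e
  proof (rule bexI)
    show v: "u + e * (1 - u) \<in> {0..1}" using e u(1)
      by (auto intro: add_nonneg_nonneg) (metis add_le_cancel_left diff_add_cancel diff_ge_0_iff_ge
          le_add_diff_inverse2 mult_left_le_one_le add.commute)
    have "u - (u + e * (1 - u)) = - (e * (1 - u))" "1 - (u + e * (1 - u)) = (1 - e) * (1 - u)"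
      by (simp_all add: algebra_simps)
    then show "pt ?q y e = pt x y (u + e * (1 - u))"
      using e u(1) v assms q dist_pt_left(2)[of x y] dist_pt_pt[of x y u "u + e * (1 - u)"]
      by (intro pt_unique[symmetric]) auto
  qed
  moreover have "\<exists>v\<in>{0..1}. pt ?q x e = pt x y v" if e: "0 \<le> e" "e \<le> 1" for e
  proof (rule bexI)
    show v: "u * (1 - e) \<in> {0..1}" using e u(1) by (auto simp: mult_le_one)
    have "u - u * (1 - e) = e * u" by (simp add: algebra_simps)
    then show "pt ?q x e = pt x y (u * (1 - e))"
      using e u(1) v assms q dist_pt_left(1)[of x y] dist_pt_pt[of x y u "u * (1 - e)"]
      by (intro pt_unique[symmetric]) (auto simp: commute[of _ x])
  qed
  ultimately show ?thesis using that[of u] u ineq assms by auto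
qed

text \<open>Extensionality is left out on purpose: the iterates \<open>g ^^ n\<close> of an element
  of \<open>isometry_group\<close> need not have it.\<close>

definition isom :: "('a \<Rightarrow> 'a) \<Rightarrow> bool" where
  "isom g \<longleftrightarrow> g ` M = M \<and> (\<forall>x\<in>M. \<forall>y\<in>M. d (g x) (g y) = d x y)"

text \<open>
  \<open>left_of c s y\<close> says that the foot of \<open>y\<close> on the line \<open>c\<close> is \<open>c a\<close> with \<open>a \<le> s\<close>, without
  mentioning the foot.
\<close>
definition left_of :: "(real \<Rightarrow> 'a) \<Rightarrow> real \<Rightarrow> 'a \<Rightarrow> bool" where
  "left_of c s y \<longleftrightarrow> (\<forall>t\<ge>s. d y (c s) \<le> d y (c t))"

definition right_of :: "(real \<Rightarrow> 'a) \<Rightarrow> real \<Rightarrow> 'a \<Rightarrow> bool" where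
  "right_of c s y \<longleftrightarrow> (\<forall>t\<le>s. d y (c s) \<le> d y (c t))"

lemma right_of_reverse: "right_of c s y \<longleftrightarrow> left_of (\<lambda>t. c (- t)) (- s) y"
  unfolding right_of_def left_of_def by (metis minus_le_iff minus_minus)

lemma geodesic_line_reverse: "geodesic_line M d c \<Longrightarrow> geodesic_line M d (\<lambda>t. c (- t))"
  unfolding geodesic_line_def by auto

lemma convex_between:
  assumes "geodesic_line M d c" "y \<in> M" "a \<le> b" "b \<le> e" "a < e"
  shows "(e - a) * d y (c b) \<le> (e - b) * d y (c a) + (b - a) * d y (c e)"
proof -
  define u where "u = (b - a) / (e - a)"
  have u: "0 \<le> u" "u \<le> 1" "(e - a) * u = b - a" using assms by (auto simp: u_def)
  have "(1 - u) * a + u * e = a + (e - a) * u" by (simp add: algebra_simps)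
  then have b: "(1 - u) * a + u * e = b" using u by simp
  have "d (c b) y \<le> (1 - u) * d (c a) y + u * d (c e) y"
    using dist_convex_line[OF assms(1,2) u(1,2), of a e] b by simp
  then have "(e - a) * d (c b) y \<le> (e - a) * ((1 - u) * d (c a) y + u * d (c e) y)"
    using assms by (intro mult_left_mono) auto
  also have "\<dots> = ((e - a) - (e - a) * u) * d (c a) y + (e - a) * u * d (c e) y"
    by (simp add: algebra_simps)
  finally show ?thesis using u by (simp add: commute[of y])
qed

lemma left_of_mono:
  assumes "geodesic_line M d c" "y \<in> M" "left_of c s y" "s \<le> s'"
  shows "left_of c s' y"
  unfolding left_of_def
proof (intro allI impI)
  fix t assume t: "s' \<le> t"
  show "d y (c s') \<le> d y (c t)"
  proof (cases "s < t")
    case True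
    have "(t - s) * d y (c s') \<le> (t - s') * d y (c s) + (s' - s) * d y (c t)"
      by (rule convex_between) (use assms t True in auto)
    also have "(t - s') * d y (c s) \<le> (t - s') * d y (c t)"
      using assms t unfolding left_of_def by (intro mult_left_mono) auto
    finally have "(t - s) * d y (c s') \<le> (t - s) * d y (c t)" by (simp add: algebra_simps)
    then show ?thesis using True by simp
  next
    case False
    then have "s' = t" using t assms by simp
    then show ?thesis by simp
  qed
qed

lemma right_of_mono:
  assumes "geodesic_line M d c" "y \<in> M" "right_of c s y" "s' \<le> s"
  shows "right_of c s' y"
  using left_of_mono[OF geodesic_line_reverse[OF assms(1)] assms(2), of "- s" "- s'"] assms(3,4)
  by (simp add: right_of_reverse)

lemma left_or_right:
  assumes "geodesic_line M d c" "y \<in> M"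
  shows "left_of c s y \<or> right_of c s y"
proof (rule ccontr)
  assume "\<not> ?thesis"
  then obtain a b where ab: "a \<le> s" "s \<le> b" "d y (c a) < d y (c s)" "d y (c b) < d y (c s)"
    unfolding left_of_def right_of_def by (auto simp: not_le)
  then have lt: "a < s" "s < b" by (auto simp: less_le)
  have "(b - a) * d y (c s) \<le> (b - s) * d y (c a) + (s - a) * d y (c b)"
    by (rule convex_between) (use assms lt in auto)
  also have "\<dots> < (b - s) * d y (c s) + (s - a) * d y (c s)"
    using ab lt by (intro add_strict_mono mult_strict_left_mono) auto
  finally show False by (simp add: algebra_simps)
qed

text \<open>The distance to y is convex along c, so its increments over windows of fixed length grow
  to the right. A bound on one window thus controls all windows on one side of it.\<close>

lemma increments_mono:
  assumes "geodesic_line M d c" "y \<in> M" "a \<le> b" "0 < l"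
  shows "d y (c (a + l)) - d y (c a) \<le> d y (c (b + l)) - d y (c b)"
proof -
  let ?w = "b + l - a"
  have 1: "?w * d y (c (a + l)) \<le> (b + l - (a + l)) * d y (c a) + (a + l - a) * d y (c (b + l))"
    by (rule convex_between) (use assms in auto)
  have 2: "?w * d y (c b) \<le> (b + l - b) * d y (c a) + (b - a) * d y (c (b + l))"
    by (rule convex_between) (use assms in auto)
  have "?w * (d y (c (a + l)) + d y (c b)) \<le> ?w * (d y (c a) + d y (c (b + l)))"
    using 1 2 by (simp add: algebra_simps)
  then show ?thesis using assms by simp
qed

text \<open>Being left of -n makes y at least as close to c (-n) as to c 0, and these two points are
  n apart.\<close>

lemma left_of_far:
  assumes "geodesic_line M d c" "left_of c (- n) y" "0 \<le> n" "y \<in> M"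
  shows "n \<le> 2 * d (c 0) y"
proof -
  have "d y (c (- n)) \<le> d y (c 0)" using assms unfolding left_of_def by auto
  moreover have "d (c 0) (c (- n)) = n" "c 0 \<in> M" "c (- n) \<in> M"
    using assms unfolding geodesic_line_def by auto
  ultimately show ?thesis
    using triangle[of "c 0" y "c (- n)"] assms(4) by (simp add: commute[of y])
qed

lemma isom_left_of:
  assumes "isom g" "y \<in> M" "\<And>t. c t \<in> M" "\<And>t. g (c t) = c' (t + k)"
  shows "left_of c' (s + k) (g y) \<longleftrightarrow> left_of c s y" "right_of c' (s + k) (g y) \<longleftrightarrow> right_of c s y"
proof -
  have e: "d (g y) (c' (t + k)) = d y (c t)" for t
    using assms unfolding isom_def by (metis)
  show "left_of c' (s + k) (g y) \<longleftrightarrow> left_of c s y"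
    unfolding left_of_def using e by (metis add_le_cancel_right diff_add_cancel)
  show "right_of c' (s + k) (g y) \<longleftrightarrow> right_of c s y"
    unfolding right_of_def using e by (metis add_le_cancel_right diff_add_cancel)
qed

lemma isom_pt:
  assumes "isom g" "x \<in> M" "y \<in> M" "0 \<le> s" "s \<le> 1"
  shows "g (pt x y s) = pt (g x) (g y) s"
  using assms unfolding isom_def by (intro pt_unique) (auto simp: dist_pt_left)

text \<open>
  As \<open>y\<close> tends to infinity, \<open>K\<close> is the limit of \<open>d y z - d p y\<close>, and the last two terms vanish.
\<close>
lemma gp_horofunction_bound:
  assumes "p \<in> M" "y \<in> M" "z \<in> M" "0 \<le> s" "s \<le> d p y" "0 < d p y"
    "d y z \<le> d p y + K + e" "0 \<le> e" "e \<le> 1"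
  shows "(d (gp p y s) z)\<^sup>2 \<le> s\<^sup>2 + (d p z)\<^sup>2 + 2 * s * K + 2 * s * e + s * (\<bar>K\<bar> + 1)\<^sup>2 / d p y"
proof -
  let ?D = "d p y"
  define u where "u = s / ?D"
  have u: "0 \<le> u" "u \<le> 1" "u * ?D = s" unfolding u_def using ratio_bounds assms by auto
  have "(d y z)\<^sup>2 \<le> (?D + K + e)\<^sup>2" using assms(7) by (intro power_mono) auto
  also have "\<dots> = ?D\<^sup>2 + 2 * ?D * (K + e) + (K + e)\<^sup>2" by (simp add: power2_eq_square algebra_simps)
  also have "(K + e)\<^sup>2 \<le> (\<bar>K\<bar> + 1)\<^sup>2" using assms(8,9) by (intro power2_le_iff_abs_le[THEN iffD2]) auto
  finally have b: "(d y z)\<^sup>2 \<le> ?D\<^sup>2 + 2 * ?D * (K + e) + (\<bar>K\<bar> + 1)\<^sup>2" by simp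
  have "(d (gp p y s) z)\<^sup>2 \<le> (1 - u) * (d p z)\<^sup>2 + u * (d y z)\<^sup>2 - u * (1 - u) * ?D\<^sup>2"
    unfolding gp_def u_def[symmetric] using assms u by (intro pt_CN) auto
  also have "\<dots> \<le> (1 - u) * (d p z)\<^sup>2 + u * (?D\<^sup>2 + 2 * ?D * (K + e) + (\<bar>K\<bar> + 1)\<^sup>2) - u * (1 - u) * ?D\<^sup>2"
    using mult_left_mono[OF b u(1)] by simp
  also have "\<dots> = (1 - u) * (d p z)\<^sup>2 + (u * ?D)\<^sup>2 + 2 * (u * ?D) * (K + e) + u * (\<bar>K\<bar> + 1)\<^sup>2"
    by (simp add: power2_eq_square algebra_simps)
  also have "\<dots> \<le> (d p z)\<^sup>2 + s\<^sup>2 + 2 * s * (K + e) + u * (\<bar>K\<bar> + 1)\<^sup>2"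
    unfolding u(3) using u by (simp add: mult_left_le_one_le)
  finally show ?thesis by (simp add: u_def algebra_simps)
qed

end

text \<open>Asking for an isometry for every integer k avoids inverses and makes the assumption
  symmetric under reversal of the line.\<close>

locale rank_one_line = proper_CN_space +
  fixes \<sigma> :: "real \<Rightarrow> 'a" and l :: real
  assumes line: "geodesic_line M d \<sigma>" and l_pos: "0 < l"
    and transl: "\<exists>g. isom g \<and> (\<forall>t. g (\<sigma> t) = \<sigma> (t + of_int k * l))"
    and no_flat: "\<not> bounds_flat_half_plane M d \<sigma>"
begin

lemma \<sigma>_in [simp]: "\<sigma> t \<in> M" and \<sigma>_dist: "d (\<sigma> s) (\<sigma> t) = \<bar>s - t\<bar>"
  using line unfolding geodesic_line_def by auto

lemma shift:
  assumes "y \<in> M"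
  obtains y' where "y' \<in> M" "\<And>t. d y' (\<sigma> (t + of_int k * l)) = d y (\<sigma> t)"
    "\<And>s. left_of \<sigma> (s + of_int k * l) y' \<longleftrightarrow> left_of \<sigma> s y"
proof -
  obtain g where g: "isom g" "\<And>t. g (\<sigma> t) = \<sigma> (t + of_int k * l)" using transl by metis
  show ?thesis
  proof (rule that[of "g y"])
    show "g y \<in> M" using g(1) assms unfolding isom_def by blast
    show "d (g y) (\<sigma> (t + of_int k * l)) = d y (\<sigma> t)" for t
      using g(1) assms unfolding isom_def g(2)[symmetric] by simp
    show "left_of \<sigma> (s + of_int k * l) (g y) \<longleftrightarrow> left_of \<sigma> s y" for s
      by (rule isom_left_of(1)[where c = \<sigma> and c' = \<sigma>, OF g(1) assms \<sigma>_in g(2)])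
  qed
qed

text \<open>
  If \<open>d y (\<sigma> l) - d y (\<sigma> 0)\<close> had the limit \<open>m < l\<close> as the foot of \<open>y\<close> moves to \<open>\<sigma>(-\<infinity>)\<close>,
  translating along \<open>\<sigma>\<close> would give points \<open>y n\<close> for which all increments are close to \<open>m\<close>,
  and the limit ray of the segments \<open>[\<sigma> 0, y n]\<close> would span a flat half-plane with \<open>\<sigma>\<close>.
\<close>
lemma increment_left:
  assumes \<delta>: "0 < \<delta>"
  obtains N where "0 \<le> N"
    "\<And>y. y \<in> M \<Longrightarrow> left_of \<sigma> (- N) y \<Longrightarrow> l - \<delta> \<le> d y (\<sigma> l) - d y (\<sigma> 0)"
proof (rule ccontr)
  assume not_thesis: "\<not> thesis"
  note thesisI = that
  define b where "b y = d y (\<sigma> l) - d y (\<sigma> 0)" for y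
  define Y where "Y N = {y \<in> M. left_of \<sigma> (- N) y}" for N
  have H: "\<exists>y\<in>Y N. b y < l - \<delta>" if "0 \<le> N" for N
  proof (rule ccontr)
    assume "\<not> ?thesis"
    then have "l - \<delta> \<le> d y (\<sigma> l) - d y (\<sigma> 0)" if "y \<in> M" "left_of \<sigma> (- N) y" for y
      using that unfolding b_def Y_def by (simp add: not_less)
    then show False using thesisI[OF \<open>0 \<le> N\<close>] not_thesis by blast
  qed
  have Y_mono: "Y N' \<subseteq> Y N" if "N \<le> N'" for N N'
    using that left_of_mono[OF line, of _ "- N'" "- N"] unfolding Y_def by auto
  have b_nonneg: "0 \<le> b y" if "0 \<le> N" "y \<in> Y N" for y N
  proof -
    have "left_of \<sigma> 0 y" using Y_mono[OF that(1)] that(2) unfolding Y_def by auto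
    then show ?thesis using l_pos unfolding left_of_def b_def by simp
  qed
  \<comment> \<open>The infimum grows with N, as fewer points compete, and stays below l - \<delta>.
    Its supremum \<open>ml\<close> is the increment that cannot be improved by going further
    left.\<close>
  define I where "I N = Inf (b ` Y N)" for N
  have bdd: "bdd_below (b ` Y N)" if "0 \<le> N" for N
    by (rule bdd_belowI2[of _ 0]) (rule b_nonneg[OF that])
  have I_le: "I N \<le> b y" if "0 \<le> N" "y \<in> Y N" for N y
    unfolding I_def using that bdd by (intro cInf_lower) auto
  have I_nonneg: "0 \<le> I N" if "0 \<le> N" for N
    unfolding I_def by (rule cInf_greatest) (use H[OF that] b_nonneg[OF that] in auto)
  have I_less: "I N \<le> l - \<delta>" if "0 \<le> N" for N
    using H[OF that] I_le[OF that] by force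
  have I_mono: "I N \<le> I N'" if "0 \<le> N" "N \<le> N'" for N N'
    unfolding I_def
  proof (rule cInf_superset_mono)
    show "b ` Y N' \<noteq> {}" using H[of N'] that by auto
    show "bdd_below (b ` Y N)" by (rule bdd[OF that(1)])
    show "b ` Y N' \<subseteq> b ` Y N" by (rule image_mono[OF Y_mono[OF that(2)]])
  qed
  define ml where "ml = Sup (I ` {0..})"
  have bddI: "bdd_above (I ` {0..})" by (rule bdd_aboveI2[of _ _ "l - \<delta>"]) (use I_less in auto)
  have I_ml: "I N \<le> ml" if "0 \<le> N" for N
    unfolding ml_def using that bddI by (intro cSup_upper) auto
  have ml_le: "ml \<le> l - \<delta>" unfolding ml_def by (rule cSup_least) (use I_less in auto)
  have ml_nonneg: "0 \<le> ml" using I_ml[of 0] I_nonneg[of 0] by simp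
  have approx: "\<exists>N\<ge>0. ml - e < I N" if "0 < e" for e
  proof -
    have "ml - e < Sup (I ` {0..})" using that by (simp add: ml_def)
    then show ?thesis using less_cSup_iff[of "I ` {0..}" "ml - e"] bddI by auto
  qed
  have small: "\<exists>y\<in>Y N. b y < ml + e" if "0 \<le> N" "0 < e" for N e
  proof -
    have "Inf (b ` Y N) < ml + e" using I_ml[OF that(1)] that(2) by (simp add: I_def)
    then show ?thesis
      using cInf_less_iff[of "b ` Y N" "ml + e"] bdd[OF that(1)] H[OF that(1)] by auto
  qed
  \<comment> \<open>Along the multiples of l, up to n of them on either side, the distance to a
    balanced point is at most an affine function of slope \<open>ml\<close> per step, with an error
    tending to 0.\<close>
  define balanced where "balanced n y \<longleftrightarrow> y \<in> M \<and> left_of \<sigma> (- real n) y \<and> (\<forall>j::int. \<bar>j\<bar> \<le> int n \<longrightarrow>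
      d y (\<sigma> (of_int j * l)) \<le> d y (\<sigma> 0) + of_int j * ml + 1 / (real n + 1))" for n y
  have "\<exists>y. balanced n y" for n
  proof -
    \<comment> \<open>n steps with an error of e each add up to at most 1 / (n + 1).\<close>
    define e where "e = 1 / (real n + 1)\<^sup>2"
    have e: "0 < e" by (simp add: e_def)
    have ne: "real n * e \<le> 1 / (real n + 1)"
      by (simp add: e_def power2_eq_square divide_simps)
    obtain N1 where N1: "0 \<le> N1" "ml - e < I N1" using approx[OF e] by blast
    define N0 where "N0 = max N1 (real n)"
    have N0: "0 \<le> N0" "real n \<le> N0" "ml - e < I N0"
      using N1 I_mono[of N1 N0] by (auto simp: N0_def)
    \<comment> \<open>One n * l is consumed by moving y0 to the right, the other by the translations
      in \<open>down\<close>; the point still stays left of -N0.\<close>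
    define N where "N = N0 + 2 * (real n * l)"
    have "0 \<le> N" using N0 l_pos by (simp add: N_def)
    then obtain y0 where y0: "y0 \<in> M" "left_of \<sigma> (- N) y0" "b y0 < ml + e"
      using small[OF _ e] unfolding Y_def by blast
    obtain y where y: "y \<in> M" "\<And>t. d y (\<sigma> (t + of_int (int n) * l)) = d y0 (\<sigma> t)"
      "\<And>s. left_of \<sigma> (s + of_int (int n) * l) y \<longleftrightarrow> left_of \<sigma> s y0"
      using shift[OF y0(1), of "int n"] by metis
    have left: "left_of \<sigma> (- N0 - real n * l) y"
      using y(3)[of "- N"] y0(2) by (simp add: N_def algebra_simps)
    \<comment> \<open>The largest of these increments is the one starting at n * l, and this is the
      window of y0 at 0, moved by the translation.\<close>
    have up: "d y (\<sigma> (of_int j * l + l)) - d y (\<sigma> (of_int j * l)) \<le> ml + e" if "j \<le> int n" for j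
    proof -
      have "of_int j * l \<le> real n * l" using that l_pos by (simp add: of_int_le_iff[symmetric] del: of_int_le_iff)
      then have "d y (\<sigma> (of_int j * l + l)) - d y (\<sigma> (of_int j * l))
          \<le> d y (\<sigma> (real n * l + l)) - d y (\<sigma> (real n * l))"
        by (rule increments_mono[OF line y(1) _ l_pos])
      also have "\<dots> = b y0" using y(2)[of l] y(2)[of 0] by (simp add: b_def add.commute)
      finally show ?thesis using y0(3) by simp
    qed
    \<comment> \<open>Translating window j back to 0 keeps the point left of -N0, where I N0 bounds
      the increment from below.\<close>
    have down: "ml - e \<le> d y (\<sigma> (of_int j * l + l)) - d y (\<sigma> (of_int j * l))" if "- int n \<le> j" for j
    proof -
      obtain y' where y': "y' \<in> M" "\<And>t. d y' (\<sigma> (t + of_int (- j) * l)) = d y (\<sigma> t)"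
        "\<And>s. left_of \<sigma> (s + of_int (- j) * l) y' \<longleftrightarrow> left_of \<sigma> s y"
        using shift[OF y(1), of "- j"] by metis
      have "- of_int j \<le> real n" using that by linarith
      then have "- of_int j * l \<le> real n * l" using l_pos by (intro mult_right_mono) auto
      then have "left_of \<sigma> (- N0) y'"
        using left_of_mono[OF line y'(1), of "- N0 - real n * l + of_int (- j) * l" "- N0"] y'(3) left by auto
      then have "I N0 \<le> b y'" using I_le[of N0 y'] N0 y'(1) by (simp add: Y_def)
      moreover have "b y' = d y (\<sigma> (of_int j * l + l)) - d y (\<sigma> (of_int j * l))"
        using y'(2)[of "of_int j * l + l"] y'(2)[of "of_int j * l"] by (simp add: b_def)
      ultimately show ?thesis using N0 by simp
    qed
    have pos: "d y (\<sigma> (real k * l)) \<le> d y (\<sigma> 0) + real k * (ml + e)" if "k \<le> n" for k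
      using that
    proof (induction k)
      case (Suc k)
      then show ?case using up[of "int k"] by (simp add: algebra_simps)
    qed simp
    have neg: "d y (\<sigma> (- (real k * l))) \<le> d y (\<sigma> 0) - real k * (ml - e)" if "k \<le> n" for k
      using that
    proof (induction k)
      case (Suc k)
      have e1: "- (real (Suc k) * l) + l = - (real k * l)" by (simp add: algebra_simps)
      have e2: "of_int (- int (Suc k)) * l = - (real (Suc k) * l)" by (simp add: algebra_simps)
      have "- int n \<le> - int (Suc k)" using Suc.prems by simp
      then have "ml - e \<le> d y (\<sigma> (- (real k * l))) - d y (\<sigma> (- (real (Suc k) * l)))"
        using down[of "- int (Suc k)"] unfolding e2 e1 by blast
      moreover have "d y (\<sigma> (- (real k * l))) \<le> d y (\<sigma> 0) - real k * (ml - e)" using Suc by simp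
      ultimately show ?case by (simp add: algebra_simps)
    qed simp
    have "d y (\<sigma> (of_int j * l)) \<le> d y (\<sigma> 0) + of_int j * ml + 1 / (real n + 1)" if j: "\<bar>j\<bar> \<le> int n" for j
    proof -
      define k where "k = nat \<bar>j\<bar>"
      have k: "k \<le> n" using j by (simp add: k_def)
      then have "real k * e \<le> real n * e" using e by (intro mult_right_mono) auto
      then have ke: "real k * e \<le> 1 / (real n + 1)" using ne by linarith
      show ?thesis
      proof (cases "0 \<le> j")
        case True
        then have "of_int j = real k" by (simp add: k_def)
        then show ?thesis using pos[OF k] ke by (simp add: algebra_simps)
      next
        case False
        then have "of_int j = - real k" by (simp add: k_def)
        then show ?thesis using neg[OF k] ke by (simp add: algebra_simps)
      qed
    qed
    moreover have "left_of \<sigma> (- real n) y"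
    proof (rule left_of_mono[OF line y(1) left])
      have "0 \<le> real n * l" using l_pos by simp
      then show "- N0 - real n * l \<le> - real n" using N0 by linarith
    qed
    ultimately show ?thesis using y(1) unfolding balanced_def by blast
  qed
  then obtain y where "\<And>n. balanced n (y n)" by metis
  then have y: "\<And>n. y n \<in> M" "\<And>n. left_of \<sigma> (- real n) (y n)"
    "\<And>n j. \<bar>j\<bar> \<le> int n \<Longrightarrow> d (y n) (\<sigma> (of_int j * l)) \<le> d (y n) (\<sigma> 0) + of_int j * ml + 1 / (real n + 1)"
    unfolding balanced_def by blast+
  have far: "real n \<le> 2 * d (\<sigma> 0) (y n)" for n
    using left_of_far[OF line y(2) _ y(1)] by simp
  have inf: "\<exists>N. \<forall>n\<ge>N. R \<le> d (\<sigma> 0) (y n)" for R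
  proof -
    obtain N :: nat where "2 * R \<le> real N" using real_arch_simple by blast
    then have "R \<le> d (\<sigma> 0) (y n)" if "n \<ge> N" for n using far[of n] that by simp
    then show ?thesis by blast
  qed
  obtain c where c: "geodesic_ray M d c" "c 0 = \<sigma> 0"
    "\<And>s z A. \<lbrakk>0 \<le> s; z \<in> M;
       \<And>e. 0 < e \<Longrightarrow> \<exists>N. \<forall>n\<ge>N. s \<le> d (\<sigma> 0) (y n) \<longrightarrow> (d (gp (\<sigma> 0) (y n) s) z)\<^sup>2 \<le> A + e\<rbrakk>
      \<Longrightarrow> (d (c s) z)\<^sup>2 \<le> A"
    using limit_ray[OF \<sigma>_in y(1) inf] by metis
  have "bounds_flat_half_plane M d \<sigma>"
  proof (rule flat_half_plane_criterion[OF line c(1,2), where m = "ml / l" and l = l])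
    show "\<bar>ml / l\<bar> < 1" using ml_nonneg ml_le \<delta> l_pos by simp
    show "0 < l" by (rule l_pos)
    fix s :: real and j :: int assume s: "0 \<le> s"
    define K where "K = of_int j * ml"
    have A: "s\<^sup>2 + (of_int j * l)\<^sup>2 + 2 * (ml / l) * s * (of_int j * l)
       = s\<^sup>2 + (d (\<sigma> 0) (\<sigma> (of_int j * l)))\<^sup>2 + 2 * s * K"
      using l_pos by (simp add: K_def \<sigma>_dist)
    show "(d (c s) (\<sigma> (of_int j * l)))\<^sup>2 \<le> s\<^sup>2 + (of_int j * l)\<^sup>2 + 2 * (ml / l) * s * (of_int j * l)"
      unfolding A
    proof (rule c(3)[OF s \<sigma>_in])
      fix e :: real assume e: "0 < e"
      \<comment> \<open>The two error terms of \<open>gp_horofunction_bound\<close> sum to at most C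
        / n, since \<open>y n\<close> is at distance at least n / 2.\<close>
      define C where "C = 2 * s + 2 * s * (\<bar>K\<bar> + 1)\<^sup>2"
      obtain N :: nat where N: "C / e \<le> real N" using real_arch_simple by blast
      show "\<exists>N. \<forall>n\<ge>N. s \<le> d (\<sigma> 0) (y n) \<longrightarrow> (d (gp (\<sigma> 0) (y n) s) (\<sigma> (of_int j * l)))\<^sup>2
          \<le> s\<^sup>2 + (d (\<sigma> 0) (\<sigma> (of_int j * l)))\<^sup>2 + 2 * s * K + e"
      proof (intro exI allI impI)
        fix n assume n: "n \<ge> max N (max 1 (nat \<bar>j\<bar>))" and sn: "s \<le> d (\<sigma> 0) (y n)"
        let ?D = "d (\<sigma> 0) (y n)"
        have n1: "real n \<ge> 1" "n \<ge> N" "\<bar>j\<bar> \<le> int n" using n by auto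
        have D: "real n / 2 \<le> ?D" "0 < ?D" using far[of n] n1 by auto
        have "C / e \<le> real n" using N n1(2) by simp
        then have Cn: "C / real n \<le> e" using e n1 by (simp add: field_simps)
        have "(d (gp (\<sigma> 0) (y n) s) (\<sigma> (of_int j * l)))\<^sup>2
          \<le> s\<^sup>2 + (d (\<sigma> 0) (\<sigma> (of_int j * l)))\<^sup>2 + 2 * s * K + 2 * s * (1 / (real n + 1)) + s * (\<bar>K\<bar> + 1)\<^sup>2 / ?D"
          using y(1) y(3)[OF n1(3)] s sn D
          by (intro gp_horofunction_bound) (auto simp: K_def commute)
        moreover have "2 * s * (1 / (real n + 1)) \<le> 2 * s * (1 / real n)"
          using s n1 by (intro mult_left_mono divide_left_mono) auto
        moreover have "s * (\<bar>K\<bar> + 1)\<^sup>2 / ?D \<le> s * (\<bar>K\<bar> + 1)\<^sup>2 / (real n / 2)"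
          using s n1 D by (intro divide_left_mono mult_nonneg_nonneg) auto
        moreover have "2 * s * (1 / real n) + s * (\<bar>K\<bar> + 1)\<^sup>2 / (real n / 2) = C / real n"
          by (simp add: C_def add_divide_distrib)
        ultimately show "(d (gp (\<sigma> 0) (y n) s) (\<sigma> (of_int j * l)))\<^sup>2
          \<le> s\<^sup>2 + (d (\<sigma> 0) (\<sigma> (of_int j * l)))\<^sup>2 + 2 * s * K + e"
          using Cn by linarith
      qed
    qed
  qed
  then show False using no_flat by blast
qed

text \<open>Increments cannot exceed l. If k consecutive ones are almost l, then y is almost T
  closer to \<sigma> (-T) than to \<sigma> 0, so \<sigma> (-T) nearly lies on the segment from
  \<sigma> 0 to y.\<close>

lemma gp_near_left:
  fixes k :: nat
  assumes \<eta>: "0 < \<eta>"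
  obtains N where "0 \<le> N" "\<And>y. \<lbrakk>y \<in> M; left_of \<sigma> (- N) y\<rbrakk> \<Longrightarrow> real k * l \<le> d (\<sigma> 0) y"
    "\<And>y. \<lbrakk>y \<in> M; left_of \<sigma> (- N) y\<rbrakk> \<Longrightarrow> d (gp (\<sigma> 0) y (real k * l)) (\<sigma> (- (real k * l))) \<le> \<eta>"
proof (cases "k = 0")
  case True
  then show ?thesis using \<eta> by (intro that[of 0]) auto
next
  case False
  define T where "T = real k * l"
  have T: "0 < T" using False l_pos by (simp add: T_def)
  \<comment> \<open>The bound \<delta> \<le> l keeps \<open>T - real k * \<delta> / 2\<close>
    nonnegative for squaring; the other one yields
    \<open>4 * T * real k * \<delta> \<le> \<eta>\<^sup>2\<close> at the end.\<close>
  define \<delta> where "\<delta> = min l (\<eta>\<^sup>2 / (4 * T * real k))"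
  have \<delta>: "0 < \<delta>" "\<delta> \<le> l" "\<delta> \<le> \<eta>\<^sup>2 / (4 * T * real k)" using l_pos \<eta> T False by (auto simp: \<delta>_def)
  obtain N where N: "0 \<le> N"
    "\<And>y. y \<in> M \<Longrightarrow> left_of \<sigma> (- N) y \<Longrightarrow> l - \<delta> \<le> d y (\<sigma> l) - d y (\<sigma> 0)"
    using increment_left[OF \<delta>(1)] by metis
  \<comment> \<open>The addend serves twice: after translations by up to T the point is still left
    of -N, and by \<open>left_of_far\<close> its distance from \<sigma> 0 is at least T.\<close>
  define N' where "N' = N + 2 * T"
  have far: "T \<le> d (\<sigma> 0) y" if "y \<in> M" "left_of \<sigma> (- N') y" for y
    using left_of_far[OF line that(2) _ that(1)] N(1) T by (simp add: N'_def)
  have "d (gp (\<sigma> 0) y T) (\<sigma> (- T)) \<le> \<eta>" if y: "y \<in> M" "left_of \<sigma> (- N') y" for y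
  proof -
    have inc: "l - \<delta> \<le> d y (\<sigma> (- (real i * l))) - d y (\<sigma> (- (real (Suc i) * l)))" if i: "i < k" for i
    proof -
      obtain y' where y': "y' \<in> M" "\<And>t. d y' (\<sigma> (t + of_int (int (Suc i)) * l)) = d y (\<sigma> t)"
        "\<And>s. left_of \<sigma> (s + of_int (int (Suc i)) * l) y' \<longleftrightarrow> left_of \<sigma> s y"
        using shift[OF y(1), of "int (Suc i)"] by metis
      have "real (Suc i) * l \<le> T" unfolding T_def using i l_pos by (intro mult_right_mono) auto
      then have "left_of \<sigma> (- N) y'"
        using left_of_mono[OF line y'(1), of "- N' + of_int (int (Suc i)) * l" "- N"] y'(3)[of "- N'"] y(2) T
        by (simp add: N'_def)
      then have "l - \<delta> \<le> d y' (\<sigma> l) - d y' (\<sigma> 0)" using N(2) y'(1) by blast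
      moreover have "d y' (\<sigma> l) = d y (\<sigma> (- (real i * l)))"
        using y'(2)[of "- (real i * l)"] by (simp add: algebra_simps)
      moreover have "d y' (\<sigma> 0) = d y (\<sigma> (- (real (Suc i) * l)))"
        using y'(2)[of "- (real (Suc i) * l)"] by (simp add: algebra_simps)
      ultimately show ?thesis by simp
    qed
    have "d y (\<sigma> (- (real i * l))) \<le> d y (\<sigma> 0) - real i * (l - \<delta>)" if "i \<le> k" for i
      using that
    proof (induction i)
      case (Suc i)
      then show ?case using inc[of i] by (simp add: algebra_simps)
    qed simp
    from this[of k] have dy: "d y (\<sigma> (- T)) \<le> d y (\<sigma> 0) - T + real k * \<delta>"
      by (simp add: T_def algebra_simps)
    let ?o = "\<sigma> 0"
    define L where "L = d ?o y"
    define p r where "p = gp ?o y T" and "r = \<sigma> (- T)"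
    \<comment> \<open>If p and r are far apart, \<open>CN\<close> puts their midpoint q well inside
      the ball of radius T about \<sigma> 0. But q is almost as close to y as p is, so it cannot be
      much closer than T to \<sigma> 0.\<close>
    define q where "q = pt p r (1 / 2)"
    have TL: "T \<le> L" using far[OF y] by (simp add: L_def)
    have p: "p \<in> M" "d ?o p = T" "d p y = L - T"
      using TL T y(1) dist_gp[of ?o y T] unfolding p_def L_def by auto
    have r: "r \<in> M" "d ?o r = T" "d r y \<le> L - T + real k * \<delta>"
      using dy T by (auto simp: r_def \<sigma>_dist L_def commute)
    have q: "q \<in> M" using p r by (simp add: q_def)
    have q1: "(d ?o q)\<^sup>2 \<le> T\<^sup>2 - (d p r)\<^sup>2 / 4"
      using pt_CN[of p r ?o "1/2"] p r unfolding q_def by (simp add: commute[of _ ?o])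
    have "d q y \<le> L - T + real k * \<delta> / 2"
      using pt_convex[of p r y y "1/2"] p r y(1) unfolding q_def by (simp add: field_simps)
    then have "T - real k * \<delta> / 2 \<le> d ?o q"
      using triangle[of ?o q y] q y(1) by (simp add: L_def)
    moreover have "real k * \<delta> \<le> T" using \<delta> by (simp add: T_def mult_left_mono)
    ultimately have "(T - real k * \<delta> / 2)\<^sup>2 \<le> (d ?o q)\<^sup>2" using T by (intro power_mono) auto
    then have "T\<^sup>2 - T * (real k * \<delta>) + (real k * \<delta> / 2)\<^sup>2 \<le> T\<^sup>2 - (d p r)\<^sup>2 / 4"
      using q1 by (simp add: power2_eq_square algebra_simps)
    then have "(d p r)\<^sup>2 \<le> 4 * T * real k * \<delta>"
      using zero_le_power2[of "real k * \<delta> / 2"] by linarith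
    also have "\<dots> \<le> \<eta>\<^sup>2" using \<delta>(3) T False by (simp add: field_simps)
    finally have "d p r \<le> \<eta>" by (rule power2_le_imp_le) (use \<eta> in simp)
    then show ?thesis unfolding p_def r_def .
  qed
  then show ?thesis
    by (intro that[of N'] far[unfolded T_def]) (use N(1) T in \<open>auto simp: T_def N'_def\<close>)
qed

end

section \<open>Lines crossed by segments\<close>

context CN_space
begin

text \<open>From here on the absence of flat half-planes is used only through this property, which
  isometries and reversal preserve. One constant serves as margin on both sides and as distance
  bound, uniformly in s.\<close>

definition crossing :: "(real \<Rightarrow> 'a) \<Rightarrow> real \<Rightarrow> bool" where
  "crossing c B \<longleftrightarrow> (\<forall>y\<in>M. \<forall>z\<in>M. \<forall>s. left_of c (s - B) y \<longrightarrow> right_of c (s + B) z \<longrightarrow>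
     (\<exists>u\<in>{0..1}. d (pt y z u) (c s) \<le> B))"

lemma crossingD:
  assumes "crossing c B" "y \<in> M" "z \<in> M" "left_of c (s - B) y" "right_of c (s + B) z"
  obtains u where "u \<in> {0..1}" "d (pt y z u) (c s) \<le> B"
  using assms unfolding crossing_def by blast

text \<open>The inequality for q makes the comparison angle at p between q and x at most a right
  angle. Then the point on the segment to x is exchanged for the reference point r.\<close>

lemma gp_right_angle:
  assumes "p \<in> M" "q \<in> M" "x \<in> M" "r \<in> M" "(d q x)\<^sup>2 \<le> (d p x)\<^sup>2 - (d p q)\<^sup>2"
    "0 \<le> s" "s \<le> d p q" "0 \<le> T" "T \<le> d p x" "d (gp p x T) r \<le> \<eta>"
  shows "d (gp p q s) r \<le> sqrt (s\<^sup>2 + T\<^sup>2) + \<eta>"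
proof -
  define u v where "u = s / d p q" and "v = T / d p x"
  have u: "0 \<le> u" "u \<le> 1" "u * d p q = s" unfolding u_def using ratio_bounds assms by auto
  have v: "0 \<le> v" "v \<le> 1" "v * d p x = T" unfolding v_def using ratio_bounds assms by auto
  have "(d (gp p q s) (gp p x T))\<^sup>2 \<le> (u * d p q)\<^sup>2 + (v * d p x)\<^sup>2
      - u * v * ((d p q)\<^sup>2 + (d p x)\<^sup>2 - (d q x)\<^sup>2)"
    unfolding gp_def u_def[symmetric] v_def[symmetric] using assms u v by (intro dist_pt_pt_le) auto
  moreover have "0 \<le> (d p q)\<^sup>2 + (d p x)\<^sup>2 - (d q x)\<^sup>2"
    using assms(5) zero_le_power2[of "d p q"] by linarith
  then have "0 \<le> u * v * ((d p q)\<^sup>2 + (d p x)\<^sup>2 - (d q x)\<^sup>2)"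
    using u(1) v(1) by simp
  ultimately have "(d (gp p q s) (gp p x T))\<^sup>2 \<le> s\<^sup>2 + T\<^sup>2" unfolding u(3) v(3) by linarith
  then have "d (gp p q s) (gp p x T) \<le> sqrt (s\<^sup>2 + T\<^sup>2)" by (rule real_le_rsqrt)
  moreover have "d (gp p q s) r \<le> d (gp p q s) (gp p x T) + d (gp p x T) r"
    using assms by (intro triangle) auto
  ultimately show ?thesis using assms(10) by linarith
qed

end

lemma small_perturbation_of_square:
  fixes a e :: real
  assumes "0 \<le> a" "0 < e"
  obtains \<eta> where "0 < \<eta>" "(a + \<eta>)\<^sup>2 \<le> a\<^sup>2 + e"
proof -
  define \<eta> where "\<eta> = min 1 (e / (2 * a + 1))"
  have \<eta>: "0 < \<eta>" "\<eta> \<le> 1" "\<eta> \<le> e / (2 * a + 1)" using assms by (auto simp: \<eta>_def)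
  then have "\<eta> * (2 * a + 1) \<le> e" using assms by (simp add: pos_le_divide_eq)
  moreover have "\<eta> * \<eta> \<le> \<eta>" using \<eta> by (simp add: mult_left_le)
  ultimately have "(a + \<eta>)\<^sup>2 \<le> a\<^sup>2 + e" by (simp add: power2_eq_square algebra_simps)
  then show ?thesis using that \<eta>(1) by blast
qed

context rank_one_line
begin

lemma reverse: "rank_one_line M d (\<lambda>t. \<sigma> (- t)) l"
proof
  show "geodesic_line M d (\<lambda>t. \<sigma> (- t))" by (rule geodesic_line_reverse[OF line])
  show "0 < l" by (rule l_pos)
  show "\<exists>g. isom g \<and> (\<forall>t. g (\<sigma> (- t)) = \<sigma> (- (t + of_int k * l)))" for k
  proof -
    obtain g where "isom g" "\<forall>t. g (\<sigma> t) = \<sigma> (t + of_int (- k) * l)" using transl by blast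
    then show ?thesis by (intro exI[of _ g]) simp
  qed
  have "range (\<lambda>t. \<sigma> (- t)) = range \<sigma>"
  proof (intro equalityI subsetI)
    show "x \<in> range \<sigma>" if "x \<in> range (\<lambda>t. \<sigma> (- t))" for x using that by auto
    show "x \<in> range (\<lambda>t. \<sigma> (- t))" if x: "x \<in> range \<sigma>" for x
    proof -
      obtain t where "x = \<sigma> t" using x by blast
      then have "x = \<sigma> (- (- t))" by simp
      then show ?thesis by blast
    qed
  qed
  then show "\<not> bounds_flat_half_plane M d (\<lambda>t. \<sigma> (- t))"
    using no_flat unfolding bounds_flat_half_plane_def by simp
qed

lemma gp_near_right:
  fixes k :: nat
  assumes "0 < \<eta>"
  obtains N where "0 \<le> N" "\<And>y. \<lbrakk>y \<in> M; right_of \<sigma> N y\<rbrakk> \<Longrightarrow> real k * l \<le> d (\<sigma> 0) y"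
    "\<And>y. \<lbrakk>y \<in> M; right_of \<sigma> N y\<rbrakk> \<Longrightarrow> d (gp (\<sigma> 0) y (real k * l)) (\<sigma> (real k * l)) \<le> \<eta>"
proof -
  interpret rev: rank_one_line M d "\<lambda>t. \<sigma> (- t)" l by (rule reverse)
  show ?thesis
    using rev.gp_near_left[OF assms, of k thesis] that unfolding right_of_reverse by simp
qed

text \<open>
  If segments from far left to far right stayed far away from \<open>\<sigma> 0\<close>, the limit ray of the
  segments from \<open>\<sigma> 0\<close> to their nearest points would be orthogonal to \<open>\<sigma>\<close> on both sides.
\<close>
lemma crossing_at_0:
  obtains B where "0 < B" "\<And>y z. \<lbrakk>y \<in> M; z \<in> M; left_of \<sigma> (- B) y; right_of \<sigma> B z\<rbrakk> \<Longrightarrow>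
    \<exists>u\<in>{0..1}. d (pt y z u) (\<sigma> 0) \<le> B"
proof (rule ccontr)
  assume not_thesis: "\<not> thesis"
  note thesisI = that
  let ?o = "\<sigma> 0"
  \<comment> \<open>Here q is the point of [y, z] nearest to \<sigma> 0; only its distance and the
    two Pythagorean inequalities are retained.\<close>
  define avoiding where "avoiding n y z q \<longleftrightarrow> y \<in> M \<and> z \<in> M \<and> q \<in> M \<and>
      left_of \<sigma> (- real n) y \<and> right_of \<sigma> (real n) z \<and> real n < d ?o q \<and>
      (d q y)\<^sup>2 \<le> (d ?o y)\<^sup>2 - (d ?o q)\<^sup>2 \<and> (d q z)\<^sup>2 \<le> (d ?o z)\<^sup>2 - (d ?o q)\<^sup>2" for n y z q
  have "\<exists>y z q. avoiding n y z q" for n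
  proof -
    define B where "B = real n + 1"
    have "\<exists>y z. y \<in> M \<and> z \<in> M \<and> left_of \<sigma> (- B) y \<and> right_of \<sigma> B z \<and> (\<forall>u\<in>{0..1}. B < d (pt y z u) ?o)"
    proof (rule ccontr)
      assume "\<not> ?thesis"
      then have "\<exists>u\<in>{0..1}. d (pt y z u) ?o \<le> B"
        if "y \<in> M" "z \<in> M" "left_of \<sigma> (- B) y" "right_of \<sigma> B z" for y z
        using that by (meson not_le)
      moreover have "0 < B" by (simp add: B_def)
      ultimately show False using thesisI not_thesis by blast
    qed
    then obtain y z where yz: "y \<in> M" "z \<in> M" "left_of \<sigma> (- B) y" "right_of \<sigma> B z"
      "\<And>u. u \<in> {0..1} \<Longrightarrow> B < d (pt y z u) ?o" by blast
    obtain u where u: "0 \<le> u" "u \<le> 1" "(d (pt y z u) y)\<^sup>2 \<le> (d ?o y)\<^sup>2 - (d ?o (pt y z u))\<^sup>2"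
      "(d (pt y z u) z)\<^sup>2 \<le> (d ?o z)\<^sup>2 - (d ?o (pt y z u))\<^sup>2"
      using nearest_on_segment[OF yz(1,2) \<sigma>_in] by blast
    have "left_of \<sigma> (- real n) y" "right_of \<sigma> (real n) z"
      using left_of_mono[OF line yz(1,3)] right_of_mono[OF line yz(2,4)] by (simp_all add: B_def)
    moreover have "real n < d ?o (pt y z u)" using yz(5)[of u] u(1,2) by (simp add: B_def commute[of ?o])
    moreover have "pt y z u \<in> M" using yz u by simp
    ultimately show ?thesis using yz(1,2) u unfolding avoiding_def by blast
  qed
  then obtain y z q where "\<And>n. avoiding n (y n) (z n) (q n)" by metis
  then have y: "y n \<in> M" "left_of \<sigma> (- real n) (y n)" "(d (q n) (y n))\<^sup>2 \<le> (d ?o (y n))\<^sup>2 - (d ?o (q n))\<^sup>2"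
    and z: "z n \<in> M" "right_of \<sigma> (real n) (z n)" "(d (q n) (z n))\<^sup>2 \<le> (d ?o (z n))\<^sup>2 - (d ?o (q n))\<^sup>2"
    and q: "q n \<in> M" "real n < d ?o (q n)" for n
    unfolding avoiding_def by blast+
  have inf: "\<exists>N. \<forall>n\<ge>N. R \<le> d ?o (q n)" for R
  proof -
    obtain N :: nat where "R \<le> real N" using real_arch_simple by blast
    then have "R \<le> d ?o (q n)" if "n \<ge> N" for n using q(2)[of n] that by simp
    then show ?thesis by blast
  qed
  obtain c where c: "geodesic_ray M d c" "c 0 = ?o"
    "\<And>s z A. \<lbrakk>0 \<le> s; z \<in> M;
       \<And>e. 0 < e \<Longrightarrow> \<exists>N. \<forall>n\<ge>N. s \<le> d ?o (q n) \<longrightarrow> (d (gp ?o (q n) s) z)\<^sup>2 \<le> A + e\<rbrakk>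
      \<Longrightarrow> (d (c s) z)\<^sup>2 \<le> A"
    using limit_ray[OF \<sigma>_in q(1) inf] by metis
  \<comment> \<open>The sequence w will be y or z, and r the point of the line at distance T from
    \<sigma> 0 on the corresponding side, which the segments towards \<open>w n\<close> nearly reach
    at time T by \<open>gp_near_left\<close> or \<open>gp_near_right\<close>.\<close>
  have orth: "(d (c s) r)\<^sup>2 \<le> s\<^sup>2 + T\<^sup>2" if s: "0 \<le> s" and T: "0 \<le> T" and r: "r \<in> M"
      and w: "\<And>n. w n \<in> M" "\<And>n. (d (q n) (w n))\<^sup>2 \<le> (d ?o (w n))\<^sup>2 - (d ?o (q n))\<^sup>2"
      and near: "\<And>\<eta>. 0 < \<eta> \<Longrightarrow> \<exists>N. \<forall>n\<ge>N. T \<le> d ?o (w n) \<and> d (gp ?o (w n) T) r \<le> \<eta>"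
    for s T r w
  proof (rule c(3)[OF s r])
    fix e :: real assume "0 < e"
    then obtain \<eta> where \<eta>: "0 < \<eta>" "(sqrt (s\<^sup>2 + T\<^sup>2) + \<eta>)\<^sup>2 \<le> (sqrt (s\<^sup>2 + T\<^sup>2))\<^sup>2 + e"
      using small_perturbation_of_square[of "sqrt (s\<^sup>2 + T\<^sup>2)" e] by auto
    obtain N where N: "\<And>n. n \<ge> N \<Longrightarrow> T \<le> d ?o (w n)" "\<And>n. n \<ge> N \<Longrightarrow> d (gp ?o (w n) T) r \<le> \<eta>"
      using near[OF \<eta>(1)] by blast
    have "(d (gp ?o (q n) s) r)\<^sup>2 \<le> s\<^sup>2 + T\<^sup>2 + e" if n: "n \<ge> N" "s \<le> d ?o (q n)" for n
    proof -
      have "d (gp ?o (q n) s) r \<le> sqrt (s\<^sup>2 + T\<^sup>2) + \<eta>"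
        by (rule gp_right_angle[OF \<sigma>_in q(1) w(1) r w(2) s n(2) T N(1)[OF n(1)] N(2)[OF n(1)]])
      then have "(d (gp ?o (q n) s) r)\<^sup>2 \<le> (sqrt (s\<^sup>2 + T\<^sup>2) + \<eta>)\<^sup>2" by (intro power_mono) auto
      then show ?thesis using \<eta>(2) by simp
    qed
    then show "\<exists>N. \<forall>n\<ge>N. s \<le> d ?o (q n) \<longrightarrow> (d (gp ?o (q n) s) r)\<^sup>2 \<le> s\<^sup>2 + T\<^sup>2 + e" by blast
  qed
  have "bounds_flat_half_plane M d \<sigma>"
  proof (rule flat_half_plane_criterion[OF line c(1,2), where m = 0 and l = l])
    show "\<bar>0::real\<bar> < 1" "0 < l" using l_pos by auto
    fix s :: real and j :: int assume s: "0 \<le> s"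
    define k where "k = nat \<bar>j\<bar>"
    have T: "0 \<le> real k * l" using l_pos by simp
    have "(d (c s) (\<sigma> (of_int j * l)))\<^sup>2 \<le> s\<^sup>2 + (real k * l)\<^sup>2"
    proof (cases "0 \<le> j")
      case True
      then have j: "of_int j = real k" by (simp add: k_def)
      show ?thesis
      proof (rule orth[OF s T \<sigma>_in z(1,3)])
        fix \<eta> :: real assume "0 < \<eta>"
        then obtain N where N: "0 \<le> N" "\<And>y. \<lbrakk>y \<in> M; right_of \<sigma> N y\<rbrakk> \<Longrightarrow> real k * l \<le> d ?o y"
          "\<And>y. \<lbrakk>y \<in> M; right_of \<sigma> N y\<rbrakk> \<Longrightarrow> d (gp ?o y (real k * l)) (\<sigma> (real k * l)) \<le> \<eta>"
          using gp_near_right by metis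
        obtain N' :: nat where N': "N \<le> real N'" using real_arch_simple by blast
        have "right_of \<sigma> N (z n)" if "n \<ge> N'" for n
          using right_of_mono[OF line z(1,2)] N' that by simp
        then show "\<exists>N. \<forall>n\<ge>N. real k * l \<le> d ?o (z n) \<and> d (gp ?o (z n) (real k * l)) (\<sigma> (of_int j * l)) \<le> \<eta>"
          unfolding j using N(2,3) z(1) by blast
      qed
    next
      case False
      then have "of_int j = - real k" by (simp add: k_def)
      then have j: "of_int j * l = - (real k * l)" by simp
      show ?thesis
      proof (rule orth[OF s T \<sigma>_in y(1,3)])
        fix \<eta> :: real assume "0 < \<eta>"
        then obtain N where N: "0 \<le> N" "\<And>y. \<lbrakk>y \<in> M; left_of \<sigma> (- N) y\<rbrakk> \<Longrightarrow> real k * l \<le> d ?o y"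
          "\<And>y. \<lbrakk>y \<in> M; left_of \<sigma> (- N) y\<rbrakk> \<Longrightarrow> d (gp ?o y (real k * l)) (\<sigma> (- (real k * l))) \<le> \<eta>"
          using gp_near_left by metis
        obtain N' :: nat where N': "N \<le> real N'" using real_arch_simple by blast
        have "left_of \<sigma> (- N) (y n)" if "n \<ge> N'" for n
          using left_of_mono[OF line y(1,2)] N' that by simp
        then show "\<exists>N. \<forall>n\<ge>N. real k * l \<le> d ?o (y n) \<and> d (gp ?o (y n) (real k * l)) (\<sigma> (of_int j * l)) \<le> \<eta>"
          unfolding j using N(2,3) y(1) by blast
      qed
    qed
    moreover have "(real k * l)\<^sup>2 = (of_int j * l)\<^sup>2" by (simp add: k_def power_mult_distrib)
    ultimately show "(d (c s) (\<sigma> (of_int j * l)))\<^sup>2 \<le> s\<^sup>2 + (of_int j * l)\<^sup>2 + 2 * 0 * s * (of_int j * l)"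
      by simp
  qed
  then show False using no_flat by blast
qed

lemma ex_crossing:
  obtains B where "0 < B" "crossing \<sigma> B"
proof -
  obtain B0 where B0: "0 < B0" "\<And>y z. \<lbrakk>y \<in> M; z \<in> M; left_of \<sigma> (- B0) y; right_of \<sigma> B0 z\<rbrakk> \<Longrightarrow>
    \<exists>u\<in>{0..1}. d (pt y z u) (\<sigma> 0) \<le> B0"
    using crossing_at_0 by metis
  \<comment> \<open>A translation moves \<sigma> s to \<sigma> r with 0 \<le> r \<le> l. Replacing
    \<sigma> r by \<sigma> 0 costs at most l, in the margins as well as in the distance.\<close>
  define B where "B = B0 + l"
  have "\<exists>u\<in>{0..1}. d (pt y z u) (\<sigma> s) \<le> B"
    if y: "y \<in> M" "left_of \<sigma> (s - B) y" and z: "z \<in> M" "right_of \<sigma> (s + B) z" for y z s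
  proof -
    define k where "k = - \<lfloor>s / l\<rfloor>"
    define r where "r = s + of_int k * l"
    have "r = l * (s / l - of_int \<lfloor>s / l\<rfloor>)" using l_pos by (simp add: r_def k_def algebra_simps)
    moreover have "0 \<le> s / l - of_int \<lfloor>s / l\<rfloor>" "s / l - of_int \<lfloor>s / l\<rfloor> \<le> 1" by linarith+
    ultimately have r: "0 \<le> r" "r \<le> l" using l_pos by (simp_all add: mult_left_le)
    obtain g where g: "isom g" "\<And>t. g (\<sigma> t) = \<sigma> (t + of_int k * l)" using transl by metis
    have gM: "g y \<in> M" "g z \<in> M" using g(1) y z unfolding isom_def by auto
    have "left_of \<sigma> (s - B + of_int k * l) (g y)"
      using isom_left_of(1)[where c = \<sigma> and c' = \<sigma>, OF g(1) y(1) \<sigma>_in g(2)] y(2) by simp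
    then have l: "left_of \<sigma> (- B0) (g y)"
      using left_of_mono[OF line gM(1), of "s - B + of_int k * l" "- B0"] r by (simp add: B_def r_def)
    have "right_of \<sigma> (s + B + of_int k * l) (g z)"
      using isom_left_of(2)[where c = \<sigma> and c' = \<sigma>, OF g(1) z(1) \<sigma>_in g(2)] z(2) by simp
    then have rr: "right_of \<sigma> B0 (g z)"
      using right_of_mono[OF line gM(2), of "s + B + of_int k * l" B0] r l_pos by (simp add: B_def r_def)
    obtain u where u: "u \<in> {0..1}" "d (pt (g y) (g z) u) (\<sigma> 0) \<le> B0"
      using B0(2)[OF gM l rr] by blast
    have p: "pt y z u \<in> M" using y z u by simp
    have "d (pt y z u) (\<sigma> s) = d (g (pt y z u)) (\<sigma> r)"
      using g(1) p unfolding isom_def r_def g(2)[symmetric] by simp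
    also have "g (pt y z u) = pt (g y) (g z) u" using isom_pt[OF g(1) y(1) z(1)] u by simp
    also have "d (pt (g y) (g z) u) (\<sigma> r) \<le> d (pt (g y) (g z) u) (\<sigma> 0) + d (\<sigma> 0) (\<sigma> r)"
      using gM u by (intro triangle) auto
    also have "\<dots> \<le> B" using u(2) r by (simp add: \<sigma>_dist B_def)
    finally show ?thesis using u(1) by blast
  qed
  then have "crossing \<sigma> B" unfolding crossing_def by blast
  then show ?thesis using that[of B] B0 l_pos by (simp add: B_def)
qed

end

section \<open>Translates of rank one lines\<close>

context CN_space
begin

lemma isom_in: "isom g \<Longrightarrow> x \<in> M \<Longrightarrow> g x \<in> M"
  and isom_dist: "isom g \<Longrightarrow> x \<in> M \<Longrightarrow> y \<in> M \<Longrightarrow> d (g x) (g y) = d x y"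
  and isom_surj: "isom g \<Longrightarrow> g ` M = M"
  unfolding isom_def by auto

lemma isom_pow: "isom g \<Longrightarrow> isom (g ^^ n)"
proof (induction n)
  case 0
  then show ?case by (simp add: isom_def)
next
  case (Suc n)
  then have IH: "isom (g ^^ n)" by blast
  show ?case
    unfolding isom_def
  proof (intro conjI ballI)
    have "(g ^^ Suc n) ` M = g ` (g ^^ n) ` M" by (simp add: image_image)
    then show "(g ^^ Suc n) ` M = M"
      using isom_surj[OF Suc.prems] isom_surj[OF IH] by simp
    show "d ((g ^^ Suc n) x) ((g ^^ Suc n) y) = d x y" if "x \<in> M" "y \<in> M" for x y
      using isom_in[OF IH] isom_dist[OF IH] isom_dist[OF Suc.prems] that by simp
  qed
qed

lemma left_of_isom:
  assumes "isom g" "y \<in> M" "geodesic_line M d c"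
  shows "left_of (\<lambda>t. g (c t)) s (g y) \<longleftrightarrow> left_of c s y"
    and "right_of (\<lambda>t. g (c t)) s (g y) \<longleftrightarrow> right_of c s y"
  using assms isom_dist[OF assms(1,2)] unfolding left_of_def right_of_def geodesic_line_def by auto

lemma geodesic_line_isom:
  "isom g \<Longrightarrow> geodesic_line M d c \<Longrightarrow> geodesic_line M d (\<lambda>t. g (c t))"
  using isom_in isom_dist unfolding geodesic_line_def by auto

lemma crossing_isom:
  assumes "isom g" "geodesic_line M d c" "crossing c B"
  shows "crossing (\<lambda>t. g (c t)) B"
  unfolding crossing_def
proof (intro ballI allI impI)
  fix y z s
  assume yz: "y \<in> M" "z \<in> M" "left_of (\<lambda>t. g (c t)) (s - B) y" "right_of (\<lambda>t. g (c t)) (s + B) z"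
  have "y \<in> g ` M" "z \<in> g ` M" using yz(1,2) isom_surj[OF assms(1)] by auto
  then obtain y' z' where y'z': "y' \<in> M" "z' \<in> M" "y = g y'" "z = g z'" by blast
  then have "left_of c (s - B) y'" "right_of c (s + B) z'"
    using yz(3,4) left_of_isom[OF assms(1) _ assms(2)] by auto
  then obtain u where u: "u \<in> {0..1}" "d (pt y' z' u) (c s) \<le> B"
    using crossingD[OF assms(3) y'z'(1,2)] by blast
  have "d (pt y z u) (g (c s)) = d (pt y' z' u) (c s)"
    using isom_pt[OF assms(1) y'z'(1,2)] isom_dist[OF assms(1)] u(1) y'z' assms(2)
    unfolding geodesic_line_def by (metis atLeastAtMost_iff pt_in)
  then show "\<exists>u\<in>{0..1}. d (pt y z u) (g (c s)) \<le> B" using u by (intro bexI[of _ u]) auto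
qed

lemma crossing_reverse:
  assumes "crossing c B"
  shows "crossing (\<lambda>t. c (- t)) B"
  unfolding crossing_def
proof (intro ballI allI impI)
  fix y z s
  assume yz: "y \<in> M" "z \<in> M" "left_of (\<lambda>t. c (- t)) (s - B) y" "right_of (\<lambda>t. c (- t)) (s + B) z"
  have "right_of c (- s + B) y" "left_of c (- s - B) z"
    using yz(3,4) by (simp_all add: right_of_reverse)
  then obtain u where u: "u \<in> {0..1}" "d (pt z y u) (c (- s)) \<le> B"
    using crossingD[OF assms yz(2,1)] by blast
  then show "\<exists>u\<in>{0..1}. d (pt y z u) (c (- s)) \<le> B"
    using pt_commute[OF yz(2,1), of u] by (intro bexI[of _ "1 - u"]) auto
qed

text \<open>The segment from c 0 to y passes near c (t + B + 1) and contracts towards c 0 from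
  there. The shift by B + 1 puts the crossing point at distance at least t + 1 from c 0, safely
  beyond time t.\<close>

lemma right_of_gp_near:
  assumes c: "geodesic_line M d c" and B: "crossing c B" "0 < B" and y: "y \<in> M"
    and t: "0 \<le> t" and right: "right_of c (t + 2 * B + 1) y"
  shows "t \<le> d (c 0) y" "d (gp (c 0) y t) (c t) \<le> B"
proof -
  have cM: "c s \<in> M" and cd: "d (c s) (c s') = \<bar>s - s'\<bar>" for s s'
    using c unfolding geodesic_line_def by auto
  have "left_of c 0 (c 0)" unfolding left_of_def by (simp add: cd)
  then have "left_of c (t + B + 1 - B) (c 0)"
    using left_of_mono[OF c cM] t by simp
  moreover have "right_of c (t + B + 1 + B) y" using right by (simp add: algebra_simps)
  ultimately obtain u where u: "u \<in> {0..1}" "d (pt (c 0) y u) (c (t + B + 1)) \<le> B"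
    using crossingD[OF B(1) cM y] by blast
  define p where "p = pt (c 0) y u"
  have p: "p \<in> M" "d p (c (t + B + 1)) \<le> B" using u cM y by (simp_all add: p_def)
  have dp: "t + 1 \<le> d (c 0) p"
    using triangle[of "c 0" p "c (t + B + 1)"] p cM cd[of 0 "t + B + 1"] t B(2) by simp
  have "d (c 0) p = u * d (c 0) y" unfolding p_def using u cM y by (simp add: dist_pt_left)
  then have py: "d (c 0) p \<le> d (c 0) y" using u(1) by (simp add: mult_left_le_one_le)
  then show "t \<le> d (c 0) y" using dp by simp
  have "d (c 0) y > 0" using dp py t by simp
  then have "p = gp (c 0) y (d (c 0) p)"
    unfolding gp_def \<open>d (c 0) p = u * d (c 0) y\<close> by (simp add: p_def)
  then have e: "gp (c 0) y t = gp (c 0) p t"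
    using gp_gp[OF cM y t _ py] dp by simp
  have "c t = gp (c 0) (c (t + B + 1)) t"
    using t B(2) by (intro gp_unique) (auto simp: cM cd)
  then have "d (gp (c 0) y t) (c t) = d (gp (c 0) p t) (gp (c 0) (c (t + B + 1)) t)"
    using e by simp
  also have "\<dots> \<le> t / (t + 1) * d p (c (t + B + 1))"
    using p cM t dp B(2) by (intro gp_dist_le) (auto simp: cd)
  also have "\<dots> \<le> 1 * d p (c (t + B + 1))"
    using t by (intro mult_right_mono) auto
  finally show "d (gp (c 0) y t) (c t) \<le> B" using p(2) by simp
qed

text \<open>If the feet of \<sigma> t on \<tau> were unbounded to the right, the segments from
  \<tau> 0 to \<sigma> t would follow \<tau> for arbitrarily long times while staying near \<sigma>,
  and the two rays would be asymptotic.\<close>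

lemma not_asymptotic_left_of:
  assumes \<sigma>: "geodesic_line M d \<sigma>" and \<tau>: "geodesic_line M d \<tau>" and B: "crossing \<tau> B" "0 < B"
    and na: "\<not> asymptotic d \<sigma> \<tau>"
  obtains S where "\<And>t. 0 \<le> t \<Longrightarrow> left_of \<tau> S (\<sigma> t)"
proof (rule ccontr)
  assume not_thesis: "\<not> thesis"
  have right: "\<exists>t\<ge>0. right_of \<tau> S (\<sigma> t)" for S
  proof -
    have "\<exists>t\<ge>0. \<not> left_of \<tau> S (\<sigma> t)" using not_thesis that by blast
    then show ?thesis using left_or_right[OF \<tau>] \<sigma> unfolding geodesic_line_def by metis
  qed
  have \<sigma>M: "\<sigma> s \<in> M" and \<sigma>d: "d (\<sigma> s) (\<sigma> s') = \<bar>s - s'\<bar>" and \<tau>M: "\<tau> s \<in> M" for s s'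
    using \<sigma> \<tau> unfolding geodesic_line_def by auto
  let ?e = "d (\<sigma> 0) (\<tau> 0)"
  have "d (\<sigma> s) (\<tau> s) \<le> 2 * ?e + B" if s: "0 \<le> s" for s
  proof -
    obtain t where t: "0 \<le> t" "right_of \<tau> (s + ?e + 2 * B + 1) (\<sigma> t)"
      using right[of "s + ?e + 2 * B + 1"] by blast
    have "s + ?e \<le> d (\<tau> 0) (\<sigma> t)"
      using right_of_gp_near(1)[OF \<tau> B \<sigma>M _ t(2)] s by simp
    then have st: "s \<le> t" using triangle[OF \<tau>M[of 0] \<sigma>M[of 0] \<sigma>M[of t]] \<sigma>d[of 0 t] t
      by (simp add: commute)
    have t': "right_of \<tau> (s + 2 * B + 1) (\<sigma> t)"
      by (rule right_of_mono[OF \<tau> \<sigma>M t(2)]) simp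
    note near = right_of_gp_near[OF \<tau> B \<sigma>M s t']
    have "\<sigma> s = gp (\<sigma> 0) (\<sigma> t) s" using s st by (intro gp_unique) (auto simp: \<sigma>M \<sigma>d)
    then have "d (\<sigma> s) (gp (\<tau> 0) (\<sigma> t) s) \<le> 2 * ?e"
      using gp_change_base[of "\<sigma> 0" "\<tau> 0" "\<sigma> t" s] \<sigma>M \<tau>M s st near(1) \<sigma>d by simp
    moreover have "gp (\<tau> 0) (\<sigma> t) s \<in> M" using \<tau>M \<sigma>M s near(1) by simp
    ultimately show ?thesis using triangle[of "\<sigma> s" "gp (\<tau> 0) (\<sigma> t) s" "\<tau> s"] near(2) \<sigma>M \<tau>M by simp
  qed
  then show False using na unfolding asymptotic_def by blast
qed

lemma displacement_pow:
  assumes "isom g" "y \<in> M"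
  shows "d y ((g ^^ n) y) \<le> real n * d y (g y)"
proof (induction n)
  case (Suc n)
  have "d y ((g ^^ Suc n) y) \<le> d y (g y) + d (g y) (g ((g ^^ n) y))"
    using assms isom_pow[OF assms(1), of n] by (simp add: triangle isom_in)
  also have "d (g y) (g ((g ^^ n) y)) = d y ((g ^^ n) y)"
    using assms isom_pow[OF assms(1), of n] by (intro isom_dist) (auto intro: isom_in)
  finally show ?case using Suc by (simp add: algebra_simps)
qed (use assms in simp)

text \<open>
  Otherwise some power of \<open>g\<close> displaces the ray \<open>\<sigma>\<close> by a bounded amount, although large
  powers of \<open>g\<close> move it across a fixed point of the axis \<open>\<tau>\<close>.
\<close>
lemma translates_diverge:
  assumes \<sigma>: "geodesic_line M d \<sigma>" and \<tau>: "geodesic_line M d \<tau>" and B: "crossing \<tau> B" "0 < B"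
    and g: "isom g" "\<And>t. g (\<tau> t) = \<tau> (t + l)" "0 < l"
    and na: "\<not> asymptotic d \<sigma> \<tau>" "\<not> asymptotic d \<sigma> (\<lambda>t. \<tau> (- t))" and m: "0 < m"
  shows "\<exists>t\<ge>0. C < d (\<sigma> t) ((g ^^ m) (\<sigma> t))"
proof (rule ccontr)
  assume "\<not> ?thesis"
  then have C: "d (\<sigma> t) ((g ^^ m) (\<sigma> t)) \<le> C" if "0 \<le> t" for t using that by (simp add: not_less)
  have \<sigma>M: "\<sigma> s \<in> M" and \<sigma>d: "d (\<sigma> s) (\<sigma> s') = \<bar>s - s'\<bar>" and \<tau>M: "\<tau> s \<in> M" for s s'
    using \<sigma> \<tau> unfolding geodesic_line_def by auto
  obtain S1 where S1: "\<And>t. 0 \<le> t \<Longrightarrow> left_of \<tau> S1 (\<sigma> t)"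
    using not_asymptotic_left_of[OF \<sigma> \<tau> B na(1)] by blast
  obtain S2 where "\<And>t. 0 \<le> t \<Longrightarrow> left_of (\<lambda>t. \<tau> (- t)) S2 (\<sigma> t)"
    using not_asymptotic_left_of[OF \<sigma> geodesic_line_reverse[OF \<tau>] crossing_reverse[OF B(1)] B(2) na(2)] by blast
  then have S2: "right_of \<tau> (- S2) (\<sigma> t)" if "0 \<le> t" for t
    using that by (simp add: right_of_reverse)
  define G where "G = g ^^ m"
  have G: "isom G" unfolding G_def by (rule isom_pow[OF g(1)])
  \<comment> \<open>On \<tau> the feet of the ray lie between -S2 and S1. The power m * n of g moves
    them by at least the length of this interval plus 2 * B.\<close>
  obtain n :: nat where n: "(S1 + S2 + 2 * B) / l \<le> real n" using real_arch_simple by blast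
  have "n \<le> m * n" using m by simp
  then have "real n \<le> real (m * n)" by (rule of_nat_mono)
  then have "real n * l \<le> real (m * n) * l" using g(3) by (intro mult_right_mono) auto
  moreover have "S1 + S2 + 2 * B \<le> real n * l" using n g(3) by (simp add: pos_divide_le_eq)
  ultimately have n: "S1 + 2 * B \<le> - S2 + real (m * n) * l" by linarith
  have pow: "(g ^^ k) (\<tau> t) = \<tau> (t + real k * l)" for k t
    by (induction k) (simp_all add: g(2) algebra_simps)
  have Gn: "G ^^ n = g ^^ (m * n)" unfolding G_def by (simp add: funpow_mult)
  have Gni: "isom (G ^^ n)" by (rule isom_pow[OF G])
  \<comment> \<open>\<sigma> t and its image under \<open>G ^^ n\<close> lie on different sides of
    \<tau> (S1 + B), so the segment between them passes near this fixed point. Its length is at most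
    n * C, which bounds t.\<close>
  have "t \<le> d (\<sigma> 0) (\<tau> (S1 + B)) + B + real n * C" if t: "0 \<le> t" for t
  proof -
    have "right_of \<tau> (- S2 + real (m * n) * l) ((G ^^ n) (\<sigma> t))"
      using isom_left_of(2)[where c = \<tau> and c' = \<tau>, OF Gni \<sigma>M \<tau>M] pow S2[OF t] unfolding Gn by blast
    then have "right_of \<tau> (S1 + B + B) ((G ^^ n) (\<sigma> t))"
      using right_of_mono[OF \<tau> isom_in[OF Gni \<sigma>M]] n by simp
    moreover have "left_of \<tau> (S1 + B - B) (\<sigma> t)" using S1[OF t] by simp
    ultimately obtain u where u: "u \<in> {0..1}" "d (pt (\<sigma> t) ((G ^^ n) (\<sigma> t)) u) (\<tau> (S1 + B)) \<le> B"
      using crossingD[OF B(1) \<sigma>M isom_in[OF Gni \<sigma>M]] by blast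
    let ?p = "pt (\<sigma> t) ((G ^^ n) (\<sigma> t)) u"
    have p: "?p \<in> M" using u(1) \<sigma>M isom_in[OF Gni \<sigma>M] by simp
    have "d (\<sigma> t) ?p = u * d (\<sigma> t) ((G ^^ n) (\<sigma> t))"
      using u(1) \<sigma>M isom_in[OF Gni \<sigma>M] by (simp add: dist_pt_left)
    also have "\<dots> \<le> d (\<sigma> t) ((G ^^ n) (\<sigma> t))" using u(1) by (simp add: mult_left_le_one_le)
    also have "\<dots> \<le> real n * d (\<sigma> t) (G (\<sigma> t))" by (rule displacement_pow[OF G \<sigma>M])
    also have "\<dots> \<le> real n * C" using C[OF t] by (simp add: G_def mult_left_mono)
    finally have "d (\<sigma> t) (\<tau> (S1 + B)) \<le> real n * C + B"
      using triangle[OF \<sigma>M p \<tau>M] u(2) by (meson add_mono order_trans)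
    then show ?thesis
      using triangle[OF \<sigma>M[of 0] \<tau>M[of "S1 + B"] \<sigma>M[of t]] \<sigma>d[of 0 t] t by (simp add: commute)
  qed
  from this[of "\<bar>d (\<sigma> 0) (\<tau> (S1 + B)) + B + real n * C\<bar> + 1"] show False by linarith
qed

text \<open>Segments to a point far to the right of two translates follow both of them. If such
  points existed arbitrarily far out, the translates would stay at bounded distance, against
  \<open>translates_diverge\<close>. Finitely many pairs j, k allow a common T.\<close>

lemma translates_separated:
  assumes \<sigma>: "geodesic_line M d \<sigma>" and A: "crossing \<sigma> A" "0 < A"
    and \<tau>: "geodesic_line M d \<tau>" and B: "crossing \<tau> B" "0 < B"
    and g: "isom g" "\<And>t. g (\<tau> t) = \<tau> (t + l)" "0 < l"
    and na: "\<not> asymptotic d \<sigma> \<tau>" "\<not> asymptotic d \<sigma> (\<lambda>t. \<tau> (- t))"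
  obtains T where "\<And>y j k. \<lbrakk>y \<in> M; j < k; k \<le> n; right_of (\<lambda>t. (g ^^ j) (\<sigma> t)) T y\<rbrakk>
    \<Longrightarrow> \<not> right_of (\<lambda>t. (g ^^ k) (\<sigma> t)) T y"
proof -
  have \<sigma>M: "\<sigma> s \<in> M" for s
    using \<sigma> unfolding geodesic_line_def by auto
  define c where "c j t = (g ^^ j) (\<sigma> t)" for j t
  have c: "geodesic_line M d (c j)" "crossing (c j) A" for j
    unfolding c_def using geodesic_line_isom[OF isom_pow[OF g(1)] \<sigma>]
      crossing_isom[OF isom_pow[OF g(1)] \<sigma> A(1)] by auto
  have cM: "c j t \<in> M" for j t using c(1) unfolding geodesic_line_def by auto
  have ex: "\<exists>T. \<forall>y\<in>M. \<not> (right_of (c j) T y \<and> right_of (c k) T y)" if jk: "j < k" for j k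
  proof (rule ccontr)
    assume "\<not> ?thesis"
    then have H: "\<exists>y\<in>M. right_of (c j) T y \<and> right_of (c k) T y" for T by blast
    let ?C = "2 * A + 2 * d (c j 0) (c k 0)"
    have bd: "d (c j t) (c k t) \<le> ?C" if t: "0 \<le> t" for t
    proof -
      obtain y where y: "y \<in> M" "right_of (c j) (t + 2 * A + 1) y" "right_of (c k) (t + 2 * A + 1) y"
        using H by blast
      note nj = right_of_gp_near[OF c A(2) y(1) t y(2)] and nk = right_of_gp_near[OF c A(2) y(1) t y(3)]
      have "d (gp (c j 0) y t) (gp (c k 0) y t) \<le> 2 * d (c j 0) (c k 0)"
        using cM y(1) t nj(1) nk(1) by (intro gp_change_base) auto
      moreover have "gp (c j 0) y t \<in> M" "gp (c k 0) y t \<in> M" using cM y(1) t nj(1) nk(1) by auto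
      ultimately show ?thesis
        using triangle[of "c j t" "gp (c j 0) y t" "c k t"] triangle[of "gp (c j 0) y t" "gp (c k 0) y t" "c k t"]
          nj(2) nk(2) cM by (simp add: commute)
    qed
    obtain m where m: "0 < m" "k = j + m" using jk less_imp_add_positive by metis
    obtain t where t: "0 \<le> t" "?C < d (\<sigma> t) ((g ^^ m) (\<sigma> t))"
      using translates_diverge[OF \<sigma> \<tau> B g na m(1)] by blast
    have "d (c j t) (c k t) = d (\<sigma> t) ((g ^^ m) (\<sigma> t))"
      unfolding c_def m(2) funpow_add o_def
      using isom_dist[OF isom_pow[OF g(1), of j] \<sigma>M isom_in[OF isom_pow[OF g(1), of m] \<sigma>M]] .
    then show False using t bd[of t] by simp
  qed
  then obtain T where T: "\<And>j k y. j < k \<Longrightarrow> y \<in> M \<Longrightarrow> \<not> (right_of (c j) (T j k) y \<and> right_of (c k) (T j k) y)"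
    by metis
  define T' where "T' = Max ((\<lambda>(j, k). T j k) ` ({..n} \<times> {..n}))"
  have T': "T j k \<le> T'" if "j < k" "k \<le> n" for j k
    unfolding T'_def using that by (intro Max_ge) (auto intro: image_eqI[of _ _ "(j, k)"])
  show ?thesis
  proof (rule that[of T'])
    fix y j k assume y: "y \<in> M" "j < k" "k \<le> n" "right_of (\<lambda>t. (g ^^ j) (\<sigma> t)) T' y"
    have "right_of (c j) (T j k) y"
      using right_of_mono[OF c(1) y(1) _ T'[OF y(2,3)]] y(4) unfolding c_def by blast
    then have "\<not> right_of (c k) (T j k) y" using T y by blast
    then show "\<not> right_of (\<lambda>t. (g ^^ k) (\<sigma> t)) T' y"
      using right_of_mono[OF c(1)[of k] y(1) _ T'[OF y(2,3)]] unfolding c_def by blast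
  qed
qed

end

context proper_CN_space
begin

text \<open>
  \<open>U k\<close> and \<open>V j\<close> are pairwise disjoint shadows of translates of the two ends of \<open>\<sigma>\<close>; for \<open>y\<close>
  outside \<open>U k\<close> and \<open>g\<^sup>j w\<close> outside \<open>V j\<close> the segment from \<open>y\<close> to \<open>g\<^sup>k h\<^sup>N w\<close> follows \<open>g\<^sup>k \<sigma>\<close>.
\<close>
lemma segments_through_ball:
  fixes n :: nat
  assumes \<sigma>: "rank_one_line M d \<sigma> a" and \<tau>: "rank_one_line M d \<tau> l"
    and g: "isom g" "\<And>t. g (\<tau> t) = \<tau> (t + l)" and h: "isom h" "\<And>t. h (\<sigma> t) = \<sigma> (t + a)"
    and na: "\<not> asymptotic d \<sigma> \<tau>" "\<not> asymptotic d \<sigma> (\<lambda>t. \<tau> (- t))"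
      "\<not> asymptotic d (\<lambda>t. \<sigma> (- t)) \<tau>" "\<not> asymptotic d (\<lambda>t. \<sigma> (- t)) (\<lambda>t. \<tau> (- t))"
    and x0: "x0 \<in> M"
  obtains U V :: "nat \<Rightarrow> 'a \<Rightarrow> bool" and N0 :: nat and D :: real where
    "\<And>y j k. \<lbrakk>y \<in> M; j < k; k \<le> n\<rbrakk> \<Longrightarrow> \<not> (U j y \<and> U k y)"
    "\<And>y j k. \<lbrakk>y \<in> M; j < k; k \<le> n\<rbrakk> \<Longrightarrow> \<not> (V j y \<and> V k y)"
    "\<And>N j k y w. \<lbrakk>N0 \<le> N; k \<le> n; y \<in> M; w \<in> M; \<not> U k y; \<not> V j ((g ^^ j) w)\<rbrakk> \<Longrightarrow>
       \<exists>u\<in>{0..1}. d (pt y ((g ^^ k) ((h ^^ N) w)) u) x0 \<le> D"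
proof -
  interpret s: rank_one_line M d \<sigma> a by (rule \<sigma>)
  interpret t: rank_one_line M d \<tau> l by (rule \<tau>)
  obtain A where A: "0 < A" "crossing \<sigma> A" using s.ex_crossing by blast
  obtain B where B: "0 < B" "crossing \<tau> B" using t.ex_crossing by blast
  obtain T1 where T1: "\<And>y j k. \<lbrakk>y \<in> M; j < k; k \<le> n; right_of (\<lambda>t. (g ^^ j) (\<sigma> t)) T1 y\<rbrakk>
    \<Longrightarrow> \<not> right_of (\<lambda>t. (g ^^ k) (\<sigma> t)) T1 y"
    using translates_separated[OF s.line A(2,1) t.line B(2,1) g t.l_pos na(1,2)] by blast
  obtain T2 where T2: "\<And>y j k. \<lbrakk>y \<in> M; j < k; k \<le> n; right_of (\<lambda>t. (g ^^ j) (\<sigma> (- t))) T2 y\<rbrakk>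
    \<Longrightarrow> \<not> right_of (\<lambda>t. (g ^^ k) (\<sigma> (- t))) T2 y"
    using translates_separated[OF geodesic_line_reverse[OF s.line] crossing_reverse[OF A(2)] A(1)
        t.line B(2,1) g t.l_pos na(3,4)] by blast
  define T where "T = max T1 T2"
  define c where "c k t = (g ^^ k) (\<sigma> t)" for k t
  have c: "geodesic_line M d (c j)" "crossing (c j) A" for j
    unfolding c_def using geodesic_line_isom[OF isom_pow[OF g(1)] s.line]
      crossing_isom[OF isom_pow[OF g(1)] s.line A(2)] by auto
  have cM: "c j t \<in> M" for j t using c(1) unfolding geodesic_line_def by auto
  define U where "U k y = right_of (c k) T y" for k y
  define V where "V k y = left_of (c k) (- T) y" for k y
  \<comment> \<open>This power of h moves feet right of -T to the right of T + 2 * A, leaving the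
    margin A on both sides of the crossing point at T + A.\<close>
  obtain N0 :: nat where N0: "(2 * T + 2 * A) / a \<le> real N0" using real_arch_simple by blast
  \<comment> \<open>Only finitely many crossing points \<open>c k (T + A)\<close> occur, so their
    distances from x0 are bounded.\<close>
  define D where "D = A + Max ((\<lambda>k. d (c k (T + A)) x0) ` {..n})"
  show ?thesis
  proof (rule that[of U V N0 D])
    fix y j k assume y: "y \<in> M" "j < k" "k \<le> n"
    show "\<not> (U j y \<and> U k y)"
      using T1[OF y] right_of_mono[OF c(1) y(1), of _ T T1] unfolding U_def c_def T_def by auto
    have "V i y \<Longrightarrow> right_of (\<lambda>t. (g ^^ i) (\<sigma> (- t))) T2 y" for i
      using left_of_mono[OF c(1) y(1), of _ "- T" "- T2"] unfolding V_def right_of_reverse c_def T_def by simp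
    then show "\<not> (V j y \<and> V k y)" using T2[OF y] by blast
  next
    fix N j k y w
    assume N: "N0 \<le> N" and k: "k \<le> n" and yw: "y \<in> M" "w \<in> M" and U: "\<not> U k y" and V: "\<not> V j ((g ^^ j) w)"
    have left: "left_of (c k) T y" using U left_or_right[OF c(1) yw(1)] unfolding U_def by blast
    have hN: "isom (h ^^ N)" and gk: "isom (g ^^ k)" and gj: "isom (g ^^ j)"
      using isom_pow g(1) h(1) by auto
    have pow: "(h ^^ i) (\<sigma> t) = \<sigma> (t + real i * a)" for i t
      by (induction i) (simp_all add: h(2) algebra_simps)
    have "right_of (c j) (- T) ((g ^^ j) w)"
      using V left_or_right[OF c(1) isom_in[OF gj yw(2)]] unfolding V_def by blast
    then have "right_of \<sigma> (- T) w"
      unfolding c_def using left_of_isom(2)[OF gj yw(2) s.line] by blast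
    then have "right_of \<sigma> (- T + real N * a) ((h ^^ N) w)"
      using isom_left_of(2)[where c = \<sigma> and c' = \<sigma>, OF hN yw(2) s.\<sigma>_in pow] by blast
    then have r: "right_of (c k) (- T + real N * a) ((g ^^ k) ((h ^^ N) w))"
      unfolding c_def using left_of_isom(2)[OF gk isom_in[OF hN yw(2)] s.line] by blast
    have "(2 * T + 2 * A) / a \<le> real N" using N0 N by linarith
    then have "2 * T + 2 * A \<le> real N * a" using s.l_pos by (simp add: pos_divide_le_eq)
    moreover have z: "(g ^^ k) ((h ^^ N) w) \<in> M" using isom_in[OF gk isom_in[OF hN yw(2)]] .
    ultimately have "right_of (c k) (T + A + A) ((g ^^ k) ((h ^^ N) w))"
      using right_of_mono[OF c(1) _ r] by simp
    moreover have "left_of (c k) (T + A - A) y" using left by simp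
    ultimately obtain u where u: "u \<in> {0..1}" "d (pt y ((g ^^ k) ((h ^^ N) w)) u) (c k (T + A)) \<le> A"
      using crossingD[OF c(2) yw(1) z] by blast
    have "d (c k (T + A)) x0 \<le> Max ((\<lambda>k. d (c k (T + A)) x0) ` {..n})" using k by (intro Max_ge) auto
    moreover have "pt y ((g ^^ k) ((h ^^ N) w)) u \<in> M" using u(1) yw z by simp
    ultimately have "d (pt y ((g ^^ k) ((h ^^ N) w)) u) x0 \<le> D"
      using triangle[of "pt y ((g ^^ k) ((h ^^ N) w)) u" "c k (T + A)" x0] u(2) cM x0 by (simp add: D_def)
    then show "\<exists>u\<in>{0..1}. d (pt y ((g ^^ k) ((h ^^ N) w)) u) x0 \<le> D" using u(1) by blast
  qed
qed

end

section \<open>Hadamard spaces, axes and limit points\<close>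

text \<open>The third vertex (p, q) of a plane triangle with vertices 0 and A on the first axis. The
  second equation is free of division so as to cover A = 0.\<close>

lemma ex_comparison_coordinates:
  fixes A B C :: real
  assumes "0 \<le> A" "0 \<le> B" "0 \<le> C" "A \<le> B + C" "B \<le> A + C" "C \<le> A + B"
  obtains p q where "p\<^sup>2 + q\<^sup>2 = B\<^sup>2" "2 * A * p = A\<^sup>2 + B\<^sup>2 - C\<^sup>2"
proof (cases "A = 0")
  case True
  then have "B = C" using assms by simp
  then show ?thesis using True by (intro that[of B 0]) auto
next
  case False
  define p where "p = (A\<^sup>2 + B\<^sup>2 - C\<^sup>2) / (2 * A)"
  have p: "2 * A * p = A\<^sup>2 + B\<^sup>2 - C\<^sup>2" using False by (simp add: p_def)
  have "C\<^sup>2 \<le> (A + B)\<^sup>2" "(A - B)\<^sup>2 \<le> C\<^sup>2"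
    using assms by (auto intro!: power_mono simp: abs_le_square_iff[symmetric])
  then have "\<bar>A\<^sup>2 + B\<^sup>2 - C\<^sup>2\<bar> \<le> 2 * A * B" by (simp add: abs_le_iff power2_eq_square algebra_simps)
  then have "\<bar>2 * A * p\<bar> \<le> 2 * A * B" by (simp only: p)
  then have "A * \<bar>p\<bar> \<le> A * B" using assms(1) by (simp add: abs_mult)
  then have "\<bar>p\<bar> \<le> B" using assms(1) False by simp
  then have "p\<^sup>2 \<le> B\<^sup>2" using assms(2) by (simp add: abs_le_square_iff[symmetric])
  then show ?thesis using p by (intro that[of p "sqrt (B\<^sup>2 - p\<^sup>2)"]) auto
qed

text \<open>Compare the point at s * A on the side from x to y with the vertex z, taken as the last
  point of the side from x to z, and compute in the plane by Stewart's theorem.\<close>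

lemma CAT0_imp_CN_space:
  assumes "CAT0_space M d"
  shows "CN_space M d"
proof -
  have ms: "Metric_space M d"
    and geo: "\<And>x y. x \<in> M \<Longrightarrow> y \<in> M \<Longrightarrow> \<exists>c. geodesic_segment M d c x y"
    using assms unfolding CAT0_space_def geodesic_metric_space_def by auto
  interpret Metric_space M d by (rule ms)
  show ?thesis
  proof (intro CN_space.intro CN_space_axioms.intro ms)
    fix x y s assume x: "x \<in> M" and y: "y \<in> M" and s: "0 \<le> (s::real)" "s \<le> 1"
    obtain c where c: "geodesic_segment M d c x y" using geo[OF x y] by blast
    define A where "A = d x y"
    have sA: "s * A \<in> {0..A}" using s by (auto simp: A_def mult_left_le_one_le)
    have "(d (c (s * A)) z)\<^sup>2 \<le> (1 - s) * (d x z)\<^sup>2 + s * (d y z)\<^sup>2 - s * (1 - s) * A\<^sup>2" if z: "z \<in> M" for z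
    proof -
      obtain e where e: "geodesic_segment M d e x z" using geo[OF x z] by blast
      define B C where "B = d x z" and "C = d y z"
      have "A \<le> B + C" "B \<le> A + C" "C \<le> A + B"
        using triangle[OF x z y] triangle[OF x y z] triangle[OF y x z]
        by (simp_all add: A_def B_def C_def commute)
      then obtain p q where pq: "p\<^sup>2 + q\<^sup>2 = B\<^sup>2" "2 * A * p = A\<^sup>2 + B\<^sup>2 - C\<^sup>2"
        using ex_comparison_coordinates[of A B C] by (auto simp: A_def B_def C_def)
      let ?z = "Complex p q"
      have dz: "(dist (complex_of_real a) ?z)\<^sup>2 = a\<^sup>2 - 2 * a * p + B\<^sup>2" for a
        using pq(1) by (simp add: dist_norm cmod_power2) (simp add: power2_eq_square algebra_simps)
      have "(dist 0 ?z)\<^sup>2 = B\<^sup>2" using dz[of 0] by simp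
      then have 1: "dist 0 ?z = B" by (simp add: B_def)
      have "(dist (complex_of_real A) ?z)\<^sup>2 = C\<^sup>2" using dz[of A] pq(2) by (simp add: power2_eq_square)
      then have 2: "dist (complex_of_real A) ?z = C" by (simp add: C_def)
      have 3: "dist 0 (complex_of_real A) = A" by (simp add: A_def)
      have 4: "complex_of_real (s * A) \<in> closed_segment 0 (complex_of_real A)"
        using s unfolding in_segment by (intro exI[of _ s]) (simp add: scaleR_conv_of_real)
      have 5: "dist 0 (complex_of_real (s * A)) = s * A"
        using s by (simp add: A_def norm_mult)
      have all: "\<forall>x' y' z' :: complex. dist x' y' = d x y \<longrightarrow> dist x' z' = d x z \<longrightarrow> dist y' z' = d y z \<longrightarrow>
         (\<forall>s\<in>{0..d x y}. \<forall>t\<in>{0..d x z}. \<forall>p'\<in>closed_segment x' y'. \<forall>q'\<in>closed_segment x' z'.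
             dist x' p' = s \<longrightarrow> dist x' q' = t \<longrightarrow> d (c s) (e t) \<le> dist p' q')"
        using assms x y z c e unfolding CAT0_space_def by blast
      have "d (c (s * A)) (e B) \<le> dist (complex_of_real (s * A)) ?z"
        using all[rule_format, of 0 "complex_of_real A" ?z "s * A" B "complex_of_real (s * A)" ?z]
          1 2 3 4 5 sA unfolding A_def[symmetric] B_def[symmetric] C_def[symmetric]
        by (simp add: B_def)
      moreover have "e B = z" using e unfolding geodesic_segment_def B_def by blast
      ultimately have "(d (c (s * A)) z)\<^sup>2 \<le> (dist (complex_of_real (s * A)) ?z)\<^sup>2"
        by (intro power_mono) auto
      also have "\<dots> = (s * A)\<^sup>2 - s * (2 * A * p) + B\<^sup>2" unfolding dz by simp
      also have "\<dots> = (1 - s) * B\<^sup>2 + s * C\<^sup>2 - s * (1 - s) * A\<^sup>2"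
        unfolding pq(2) by (simp add: power2_eq_square algebra_simps)
      finally show ?thesis by (simp add: B_def C_def)
    qed
    moreover have "c (s * A) \<in> M" using c sA unfolding geodesic_segment_def A_def by blast
    ultimately show "\<exists>p\<in>M. \<forall>z\<in>M. (d p z)\<^sup>2 \<le> (1 - s) * (d x z)\<^sup>2 + s * (d y z)\<^sup>2 - s * (1 - s) * (d x y)\<^sup>2"
      unfolding A_def by blast
  qed
qed

lemma hadamard_imp_proper_CN_space:
  assumes "hadamard_space M d" "locally_compact_space (Metric_space.mtopology M d)"
  shows "proper_CN_space M d"
proof -
  interpret CN_space M d using assms(1) CAT0_imp_CN_space unfolding hadamard_space_def by blast
  show ?thesis
  proof
    show "mcomplete" using assms(1) unfolding hadamard_space_def by blast
    then show "compactin mtopology (mcball x R)" if "x \<in> M" for x R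
      using compactin_mcball assms(2) that by blast
  qed
qed

section \<open>End points of axes and a criterion for limit points\<close>

context CN_space
begin

lemma endpoint_eq:
  assumes "\<And>t. 0 \<le> t \<Longrightarrow> c t \<in> M" "\<And>t. 0 \<le> t \<Longrightarrow> c' t \<in> M" "asymptotic d c c'"
  shows "endpoint M d c = endpoint M d c'"
proof -
  have sub: "endpoint M d a \<subseteq> endpoint M d b"
    if ab: "\<And>t. 0 \<le> t \<Longrightarrow> a t \<in> M" "\<And>t. 0 \<le> t \<Longrightarrow> b t \<in> M" "asymptotic d a b" for a b
  proof
    fix e assume "e \<in> endpoint M d a"
    then have e: "geodesic_ray M d e" "asymptotic d a e" unfolding endpoint_def by auto
    obtain B C where BC: "\<And>t. 0 \<le> t \<Longrightarrow> d (a t) (b t) \<le> B" "\<And>t. 0 \<le> t \<Longrightarrow> d (a t) (e t) \<le> C"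
      using ab(3) e(2) unfolding asymptotic_def by blast
    have "d (b t) (e t) \<le> B + C" if "0 \<le> t" for t
      using BC[OF that] triangle[of "b t" "a t" "e t"] ab that e(1)
      unfolding geodesic_ray_def by (simp add: commute)
    then have "asymptotic d b e" unfolding asymptotic_def by blast
    then show "e \<in> endpoint M d b" using e(1) unfolding endpoint_def by blast
  qed
  have "asymptotic d c' c" using assms(3) unfolding asymptotic_def by (simp add: commute)
  then show ?thesis using sub[of c c'] sub[of c' c] assms by blast
qed

lemma isom_inv_into:
  assumes "isom g"
  shows "isom (inv_into M g)" "\<And>x. x \<in> M \<Longrightarrow> inv_into M g (g x) = x"
    "\<And>x. x \<in> M \<Longrightarrow> g (inv_into M g x) = x"
proof -
  have inj: "inj_on g M"
  proof (rule inj_onI)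
    fix x y assume xy: "x \<in> M" "y \<in> M" "g x = g y"
    then have "d (g x) (g y) = 0" using isom_in[OF assms] by simp
    then show "x = y" using isom_dist[OF assms xy(1,2)] xy by simp
  qed
  show i: "\<And>x. x \<in> M \<Longrightarrow> inv_into M g (g x) = x" using inj by simp
  show j: "\<And>x. x \<in> M \<Longrightarrow> g (inv_into M g x) = x"
    using isom_surj[OF assms] by (simp add: f_inv_into_f)
  have in_M: "inv_into M g x \<in> M" if "x \<in> M" for x
    using isom_surj[OF assms] that by (simp add: inv_into_into)
  show "isom (inv_into M g)"
    unfolding isom_def
  proof (intro conjI ballI equalityI subsetI)
    show "x \<in> M" if "x \<in> inv_into M g ` M" for x using that in_M by auto
    show "x \<in> inv_into M g ` M" if "x \<in> M" for x
      using i[OF that] isom_in[OF assms that] by (metis image_eqI)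
    show "d (inv_into M g x) (inv_into M g y) = d x y" if "x \<in> M" "y \<in> M" for x y
      using isom_dist[OF assms in_M[OF that(1)] in_M[OF that(2)]] j that by simp
  qed
qed

lemma axis_translations:
  assumes g: "isom g" and line: "geodesic_line M d \<sigma>" and "\<And>t. g (\<sigma> t) = \<sigma> (t + l)"
  shows "\<exists>g'. isom g' \<and> (\<forall>t. g' (\<sigma> t) = \<sigma> (t + of_int k * l))"
proof -
  have \<sigma>M: "\<sigma> t \<in> M" for t using line unfolding geodesic_line_def by auto
  have pow: "(g ^^ n) (\<sigma> t) = \<sigma> (t + real n * l)" for n t
    by (induction n) (simp_all add: assms(3) algebra_simps)
  define n where "n = nat \<bar>k\<bar>"
  show ?thesis
  proof (cases "0 \<le> k")
    case True
    then have "of_int k = real n" by (simp add: n_def)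
    then show ?thesis using pow isom_pow[OF g] by (intro exI[of _ "g ^^ n"]) simp
  next
    case False
    then have k: "of_int k = - real n" by (simp add: n_def)
    have "inv_into M (g ^^ n) (\<sigma> t) = \<sigma> (t + of_int k * l)" for t
    proof -
      have "(g ^^ n) (\<sigma> (t + of_int k * l)) = \<sigma> t" unfolding pow k by simp
      then show ?thesis using isom_inv_into(2)[OF isom_pow[OF g, of n] \<sigma>M] by metis
    qed
    then show ?thesis using isom_inv_into(1)[OF isom_pow[OF g, of n]] by blast
  qed
qed

text \<open>Iterating g keeps \<sigma> (n * l) and \<tau> (n * l') at constant distance, which
  forces l = l'. Then the distance is the same at all multiples of l, and moving both points to such
  a multiple costs at most 2 * l.\<close>

lemma axes_parallel:
  assumes g: "isom g" and \<sigma>: "geodesic_line M d \<sigma>" "\<And>t. g (\<sigma> t) = \<sigma> (t + l)" "0 < l"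
    and \<tau>: "geodesic_line M d \<tau>" "\<And>t. g (\<tau> t) = \<tau> (t + l')" "0 < l'"
  obtains C where "\<And>t. d (\<sigma> t) (\<tau> t) \<le> C"
proof -
  have M: "\<sigma> s \<in> M" "\<tau> s \<in> M" "d (\<sigma> s) (\<sigma> s') = \<bar>s - s'\<bar>" "d (\<tau> s) (\<tau> s') = \<bar>s - s'\<bar>" for s s'
    using \<sigma>(1) \<tau>(1) unfolding geodesic_line_def by auto
  let ?D = "d (\<sigma> 0) (\<tau> 0)"
  have pow: "(g ^^ n) (\<sigma> t) = \<sigma> (t + real n * l)" "(g ^^ n) (\<tau> t) = \<tau> (t + real n * l')" for n t
    by (induction n) (simp_all add: \<sigma>(2) \<tau>(2) algebra_simps)
  have eq: "d (\<sigma> (t + real n * l)) (\<tau> (s + real n * l')) = d (\<sigma> t) (\<tau> s)" for n s t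
    using isom_dist[OF isom_pow[OF g, of n] M(1,2), of t s] unfolding pow .
  have diff: "\<bar>real n * l - real n * l'\<bar> \<le> 2 * ?D" for n
  proof -
    have "real n * l \<le> ?D + real n * l' + ?D"
      using triangle[OF M(1)[of 0] M(2)[of 0] M(1)[of "real n * l"]]
        triangle[OF M(2)[of 0] M(2)[of "real n * l'"] M(1)[of "real n * l"]] eq[of 0 n 0]
        M(3)[of 0 "real n * l"] M(4)[of 0 "real n * l'"] \<sigma>(3) \<tau>(3) by (simp add: commute)
    moreover have "real n * l' \<le> ?D + real n * l + ?D"
      using triangle[OF M(2)[of 0] M(1)[of 0] M(2)[of "real n * l'"]]
        triangle[OF M(1)[of 0] M(1)[of "real n * l"] M(2)[of "real n * l'"]] eq[of 0 n 0]
        M(3)[of 0 "real n * l"] M(4)[of 0 "real n * l'"] \<sigma>(3) \<tau>(3) by (simp add: commute)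
    ultimately show ?thesis by linarith
  qed
  have ll: "l = l'"
  proof (rule ccontr)
    assume "l \<noteq> l'"
    then have p: "0 < \<bar>l - l'\<bar>" by simp
    obtain n :: nat where "2 * ?D / \<bar>l - l'\<bar> < real n" using reals_Archimedean2 by blast
    then have "2 * ?D < real n * \<bar>l - l'\<bar>" using p by (simp add: pos_divide_less_eq)
    then show False using diff[of n] by (simp add: right_diff_distrib[symmetric] abs_mult)
  qed
  have "d (\<sigma> t) (\<tau> t) \<le> 2 * l + ?D" for t
  proof -
    define k where "k = \<lfloor>t / l\<rfloor>"
    define r where "r = t - of_int k * l"
    have "r = l * (t / l - of_int k)" using \<sigma>(3) by (simp add: r_def algebra_simps)
    moreover have "0 \<le> t / l - of_int k" "t / l - of_int k \<le> 1" unfolding k_def by linarith+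
    ultimately have r: "0 \<le> r" "r \<le> l" using \<sigma>(3) by (simp_all add: mult_left_le)
    have "d (\<sigma> (of_int k * l)) (\<tau> (of_int k * l)) = ?D"
    proof (cases "0 \<le> k")
      case True
      then have k: "real (nat k) = of_int k" by simp
      show ?thesis using eq[of 0 "nat k" 0] unfolding k ll by simp
    next
      case False
      then have k: "real (nat (- k)) = - of_int k" by simp
      show ?thesis using eq[of "of_int k * l" "nat (- k)" "of_int k * l"] unfolding k ll by simp
    qed
    moreover have "d (\<sigma> t) (\<sigma> (of_int k * l)) \<le> l" "d (\<tau> t) (\<tau> (of_int k * l)) \<le> l"
      using r M(3,4) by (simp_all add: r_def)
    ultimately show ?thesis
      using triangle[OF M(1)[of t] M(1)[of "of_int k * l"] M(2)[of t]]
        triangle[OF M(1)[of "of_int k * l"] M(2)[of "of_int k * l"] M(2)[of t]]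
      by (simp add: commute)
  qed
  then show ?thesis by (rule that)
qed

text \<open>This justifies the definite descriptions: any two axes are parallel, so their end points
  agree.\<close>

lemma fixed_points_of_axis:
  assumes "isom g" "is_axis M d g \<sigma>"
  shows "attractive_point M d g = endpoint M d \<sigma>"
    "repulsive_point M d g = endpoint M d (\<lambda>t. \<sigma> (- t))"
proof -
  have *: "endpoint M d \<tau> = endpoint M d \<sigma> \<and> endpoint M d (\<lambda>t. \<tau> (- t)) = endpoint M d (\<lambda>t. \<sigma> (- t))"
    if \<tau>: "is_axis M d g \<tau>" for \<tau>
  proof -
    obtain l l' where l: "geodesic_line M d \<tau>" "0 < l" "\<And>t. g (\<tau> t) = \<tau> (t + l)"
      "geodesic_line M d \<sigma>" "0 < l'" "\<And>t. g (\<sigma> t) = \<sigma> (t + l')"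
      using assms(2) \<tau> unfolding is_axis_def by blast
    obtain C where C: "\<And>t. d (\<tau> t) (\<sigma> t) \<le> C"
      using axes_parallel[OF assms(1) l(1,3,2) l(4,6,5)] by blast
    then have "asymptotic d \<tau> \<sigma>" "asymptotic d (\<lambda>t. \<tau> (- t)) (\<lambda>t. \<sigma> (- t))"
      unfolding asymptotic_def by blast+
    moreover have "\<And>t. \<tau> t \<in> M" "\<And>t. \<sigma> t \<in> M" using l unfolding geodesic_line_def by auto
    ultimately show ?thesis using endpoint_eq by simp
  qed
  show "attractive_point M d g = endpoint M d \<sigma>"
    unfolding attractive_point_def using assms(2) * by (intro the_equality) blast+
  show "repulsive_point M d g = endpoint M d (\<lambda>t. \<sigma> (- t))"
    unfolding repulsive_point_def using assms(2) * by (intro the_equality) blast+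
qed

lemma isometry_group_imp_isom:
  assumes "f \<in> carrier (isometry_group M d)"
  shows "isom f"
  using assms unfolding isometry_group_def isom_def Bij_def bij_betw_def by auto

text \<open>
  Limit points can be tested with a single base point and a single width: by convexity, being
  close at radius \<open>R\<close> forces being very close at much smaller radii.
\<close>
lemma endpoint_in_boundary_limit_points_iff:
  assumes c: "geodesic_ray M d c" and S: "S \<subseteq> M"
  shows "endpoint M d c \<in> boundary_limit_points M d S \<longleftrightarrow>
    (\<forall>R>0. \<exists>y\<in>S. R < d (c 0) y \<and> d (gp (c 0) y R) (c R) < 1)" (is "?l \<longleftrightarrow> ?r")
proof -
  let ?\<xi> = "endpoint M d c"
  have cM: "c t \<in> M" if "0 \<le> t" for t
    using c that unfolding geodesic_ray_def by auto
  have c\<xi>: "c \<in> ?\<xi>" using c cM unfolding endpoint_def asymptotic_def by force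
  have bd: "?\<xi> \<in> geom_boundary M d" using c unfolding geom_boundary_def by blast
  define \<S> where "\<S> = {Inl ` U | U. openin mtopology U} \<union>
      {cone_nbhd M d c R \<epsilon> | c R \<epsilon>. geodesic_ray M d c \<and> R > 0 \<and> \<epsilon> > 0}"
  have top: "cone_topology M d = topology_generated_by \<S>" unfolding cone_topology_def \<S>_def by simp
  have nb1: "cone_nbhd M d c R 1 \<in> \<S>" if "0 < R" for R
    unfolding \<S>_def using c that
    by (intro UnI2 CollectI exI[of _ c] exI[of _ R] exI[of _ "1::real"]) simp
  have nb2: "Inr ?\<xi> \<in> cone_nbhd M d c R 1" if "0 < R" for R
    unfolding cone_nbhd_def using bd c\<xi> cM[of R] that
    by (intro UnI2 imageI CollectI conjI bexI[OF _ c\<xi>]) simp_all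
  show ?thesis
  proof
    assume ?l
    then have cl: "Inr ?\<xi> \<in> topology_generated_by \<S> closure_of (Inl ` S)"
      unfolding boundary_limit_points_def top by blast
    show ?r
    proof (intro allI impI)
      fix R :: real assume R: "0 < R"
      obtain y where y: "y \<in> S" "Inl y \<in> cone_nbhd M d c R 1"
        using cl nb2[OF R] topology_generated_by_Basis[OF nb1[OF R]] unfolding in_closure_of by blast
      then obtain e where e: "R < d (c 0) y" "geodesic_segment M d e (c 0) y" "d (e R) (c R) < 1"
        unfolding cone_nbhd_def by auto
      then have "d (gp (c 0) y R) (c R) < 1" using geodesic_segment_eq_gp[OF e(2), of R] R by simp
      then show "\<exists>y\<in>S. R < d (c 0) y \<and> d (gp (c 0) y R) (c R) < 1" using y e by blast
    qed
  next
    assume r: ?r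
    \<comment> \<open>Asking for all R \<ge> R0 makes the property stable under finite
      intersections. Open subsets of M contain no boundary point, so only cone neighbourhoods occur,
      possibly with another base point.\<close>
    have basis: "\<exists>R0>0. \<forall>R\<ge>R0. \<forall>y\<in>M. R < d (c 0) y \<and> d (gp (c 0) y R) (c R) < 1 \<longrightarrow> Inl y \<in> T"
      if T: "T \<in> \<S>" "Inr ?\<xi> \<in> T" for T
    proof -
      obtain c' R' \<epsilon> where T': "T = cone_nbhd M d c' R' \<epsilon>" "geodesic_ray M d c'" "0 < R'" "0 < \<epsilon>"
        using T unfolding \<S>_def by blast
      obtain e where e: "e \<in> ?\<xi>" "e 0 = c' 0" "d (e R') (c' R') < \<epsilon>"
        using T(2) unfolding T'(1) cone_nbhd_def by auto
      then obtain A where A: "geodesic_ray M d e" "\<And>t. 0 \<le> t \<Longrightarrow> d (c t) (e t) \<le> A"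
        unfolding endpoint_def asymptotic_def by blast
      have eM: "e t \<in> M" if "0 \<le> t" for t using A(1) that unfolding geodesic_ray_def by auto
      have ed: "d (e s) (e t) = \<bar>s - t\<bar>" if "0 \<le> s" "0 \<le> t" for s t
        using A(1) that unfolding geodesic_ray_def by auto
      define b where "b = d (c 0) (e 0)"
      \<comment> \<open>Bounds the distance from q' to e \<rho>: 2 * b for the change of base point,
        b for each of the two passages between R and \<rho>, 1 from the test, and A between the
        asymptotic rays.\<close>
      define K where "K = 4 * b + 1 + A"
      define \<delta> where "\<delta> = \<epsilon> - d (e R') (c' R')"
      have \<delta>: "0 < \<delta>" using e(3) by (simp add: \<delta>_def)
      have b0: "0 \<le> b" by (simp add: b_def)
      have "0 \<le> A" using A(2)[of 0] nonneg[of "c 0" "e 0"] by linarith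
      then have K: "0 < K" using b0 by (simp add: K_def)
      \<comment> \<open>Makes \<rho> = R - b so large that the contraction from radius \<rho> to R'
        turns K into less than \<delta>.\<close>
      define R0 where "R0 = b + R' + R' * K / \<delta> + 1"
      have R0: "0 < R0" "R' * K / \<delta> > 0" using b0 T'(3) K \<delta> by (auto simp: R0_def add_pos_pos)
      have "Inl y \<in> T" if R: "R0 \<le> R" and y: "y \<in> M" "R < d (c 0) y" "d (gp (c 0) y R) (c R) < 1" for R y
      proof -
        define \<rho> where "\<rho> = R - b"
        have \<rho>: "R' < \<rho>" "R' * K / \<delta> < \<rho>" "0 < \<rho>" "\<rho> \<le> R" "R' * K / \<rho> < \<delta>"
        proof -
          show 1: "R' < \<rho>" "R' * K / \<delta> < \<rho>" "\<rho> \<le> R"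
            using R R0(2) T'(3) b0 unfolding R0_def \<rho>_def by linarith+
          then show 0: "0 < \<rho>" using T'(3) by simp
          show "R' * K / \<rho> < \<delta>" using 1(2) 0 \<delta> by (simp add: field_simps)
        qed
        have R00: "0 \<le> R" using \<rho> by simp
        have ey: "\<rho> \<le> d (e 0) y"
          using triangle[OF cM[of 0] eM[of 0] y(1)] y(2) by (simp add: \<rho>_def b_def)
        define q' where "q' = gp (e 0) y \<rho>"
        have q': "q' \<in> M" "d (e 0) q' = \<rho>"
          unfolding q'_def using eM[of 0] y(1) \<rho> ey by (auto simp: dist_gp)
        have m: "gp (c 0) y \<rho> \<in> M" "gp (c 0) y R \<in> M" "c R \<in> M" "e R \<in> M" "e \<rho> \<in> M"
          using cM[of 0] eM[of 0] cM[of R] eM[of R] eM[of \<rho>] y R00 \<rho> by auto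
        have "d q' (gp (c 0) y \<rho>) \<le> 2 * b"
          unfolding q'_def b_def using gp_change_base[of "e 0" "c 0" y \<rho>] cM[of 0] eM[of 0] y \<rho> ey
          by (simp add: commute)
        moreover have "d (gp (c 0) y \<rho>) (gp (c 0) y R) = b"
          using dist_gp_gp[of "c 0" y \<rho> R] cM[of 0] y \<rho> R00 b0 by (simp add: \<rho>_def)
        moreover have "d (c R) (e R) \<le> A" using A(2) R00 by blast
        moreover have "d (e R) (e \<rho>) = b" using ed[of R \<rho>] R00 \<rho> b0 by (simp add: \<rho>_def)
        moreover have "d q' (e \<rho>) \<le> d q' (gp (c 0) y \<rho>) + d (gp (c 0) y \<rho>) (gp (c 0) y R)
            + d (gp (c 0) y R) (c R) + d (c R) (e R) + d (e R) (e \<rho>)"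
          using triangle[OF q'(1) m(1) m(5)] triangle[OF m(1) m(2) m(5)] triangle[OF m(2) m(3) m(5)]
            triangle[OF m(3) m(4) m(5)] by linarith
        ultimately have q'e: "d q' (e \<rho>) \<le> K" using y(3) by (simp add: K_def)
        have g1: "gp (e 0) y R' = gp (e 0) q' R'"
          unfolding q'_def using gp_gp[of "e 0" y R' \<rho>] eM[of 0] y(1) T'(3) \<rho> ey by simp
        have g2: "e R' = gp (e 0) (e \<rho>) R'" using ray_gp[OF A(1), of R' \<rho>] T'(3) \<rho> by simp
        have "d (gp (e 0) q' R') (gp (e 0) (e \<rho>) R') \<le> R' / \<rho> * d q' (e \<rho>)"
          using eM[of 0] q' m T'(3) \<rho> ed[of 0 \<rho>] by (intro gp_dist_le) auto
        also have "\<dots> \<le> R' / \<rho> * K" using q'e T'(3) \<rho> by (intro mult_left_mono) auto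
        also have "\<dots> < \<delta>" using \<rho>(5) by simp
        finally have near: "d (gp (e 0) y R') (e R') < \<delta>" using g1 g2 by simp
        have "gp (e 0) y R' \<in> M" using eM[of 0] y(1) T'(3) \<rho> ey by simp
        then have "d (gp (e 0) y R') (c' R') < \<epsilon>"
          using triangle[of "gp (e 0) y R'" "e R'" "c' R'"] near eM[of R'] T'(2,3)
          unfolding geodesic_ray_def \<delta>_def by force
        moreover have "geodesic_segment M d (gp (e 0) y) (c' 0) y"
          using geodesic_segment_gp[of "e 0" y] eM[of 0] y(1) e(2) by simp
        moreover have "R' < d (c' 0) y" using ey \<rho>(1) e(2) by simp
        ultimately show ?thesis unfolding T'(1) cone_nbhd_def using y(1) by blast
      qed
      then show ?thesis using R0(1) by blast
    qed
    have gen: "Inr ?\<xi> \<in> T \<Longrightarrow> \<exists>R0>0. \<forall>R\<ge>R0. \<forall>y\<in>M. R < d (c 0) y \<and> d (gp (c 0) y R) (c R) < 1 \<longrightarrow> Inl y \<in> T"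
      if "generate_topology_on \<S> T" for T
      using that
    proof (induction rule: generate_topology_on.induct)
      case (Int a b)
      obtain R1 where R1: "R1 > 0" "\<forall>R\<ge>R1. \<forall>y\<in>M. R < d (c 0) y \<and> d (gp (c 0) y R) (c R) < 1 \<longrightarrow> Inl y \<in> a"
        using Int by auto
      obtain R2 where R2: "R2 > 0" "\<forall>R\<ge>R2. \<forall>y\<in>M. R < d (c 0) y \<and> d (gp (c 0) y R) (c R) < 1 \<longrightarrow> Inl y \<in> b"
        using Int by auto
      show ?case using R1 R2 by (intro exI[of _ "max R1 R2"]) auto
    next
      case (UN K)
      then obtain k where "k \<in> K" "Inr ?\<xi> \<in> k" by blast
      then show ?case using UN.IH by (meson UnionI)
    next
      case (Basis T)
      then show ?case using basis by blast
    qed simp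
    have "Inr ?\<xi> \<in> topspace (topology_generated_by \<S>)"
      using nb1[of 1] nb2[of 1] by auto
    moreover have "\<exists>z\<in>Inl ` S. z \<in> T" if T: "Inr ?\<xi> \<in> T" "openin (topology_generated_by \<S>) T" for T
    proof -
      obtain R0 where R0: "R0 > 0" "\<forall>R\<ge>R0. \<forall>y\<in>M. R < d (c 0) y \<and> d (gp (c 0) y R) (c R) < 1 \<longrightarrow> Inl y \<in> T"
        using gen[of T] T by (auto simp: openin_topology_generated_by_iff)
      obtain y where "y \<in> S" "R0 < d (c 0) y" "d (gp (c 0) y R0) (c R0) < 1" using r R0(1) by blast
      then show ?thesis using R0(2) S by blast
    qed
    ultimately have "Inr ?\<xi> \<in> topology_generated_by \<S> closure_of (Inl ` S)"
      unfolding in_closure_of by blast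
    then show ?l using bd unfolding boundary_limit_points_def top by blast
  qed
qed

end

lemma rank_one_imp_line:
  assumes "proper_CN_space M d" "rank_one M d h"
  obtains \<sigma> l where "rank_one_line M d \<sigma> l" "\<And>t. h (\<sigma> t) = \<sigma> (t + l)" "CN_space.isom M d h"
    "attractive_point M d h = endpoint M d \<sigma>" "repulsive_point M d h = endpoint M d (\<lambda>t. \<sigma> (- t))"
proof -
  interpret proper_CN_space M d by (rule assms(1))
  have h: "isom h" using assms(2) isometry_group_imp_isom unfolding rank_one_def by blast
  obtain \<sigma> where \<sigma>: "is_axis M d h \<sigma>" "\<not> bounds_flat_half_plane M d \<sigma>"
    using assms(2) unfolding rank_one_def by blast
  then obtain l where l: "geodesic_line M d \<sigma>" "0 < l" "\<And>t. h (\<sigma> t) = \<sigma> (t + l)"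
    unfolding is_axis_def by blast
  have "rank_one_line M d \<sigma> l"
    using l \<sigma>(2) axis_translations[OF h l(1,3)] by unfold_locales
  then show ?thesis using that l(3) h fixed_points_of_axis[OF h \<sigma>(1)] by blast
qed

section \<open>Rays in products\<close>

definition prod_ray :: "'i set \<Rightarrow> ('i \<Rightarrow> real \<Rightarrow> 'a) \<Rightarrow> ('i \<Rightarrow> real) \<Rightarrow> real \<Rightarrow> 'i \<Rightarrow> 'a" where
  "prod_ray I \<sigma>s \<theta> t = (\<lambda>i\<in>I. \<sigma>s i (\<theta> i * t))"

text \<open>The assumption \<open>ex_ray\<close> supplies a ray for factors in which a ray of the
  product is constant, since \<open>ray_decomposition\<close> asks for one there as well.\<close>

locale CN_product =
  fixes I :: "'i set" and X :: "'i \<Rightarrow> 'a set" and d :: "'i \<Rightarrow> 'a \<Rightarrow> 'a \<Rightarrow> real"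
  assumes finite_I: "finite I"
    and factor: "i \<in> I \<Longrightarrow> proper_CN_space (X i) (d i)"
    and ex_ray: "i \<in> I \<Longrightarrow> \<exists>c. geodesic_ray (X i) (d i) c"
begin

abbreviation P :: "('i \<Rightarrow> 'a) set" where "P \<equiv> Pi\<^sub>E I X"
abbreviation D :: "('i \<Rightarrow> 'a) \<Rightarrow> ('i \<Rightarrow> 'a) \<Rightarrow> real" where "D \<equiv> l2_dist I d"
abbreviation fpt :: "'i \<Rightarrow> 'a \<Rightarrow> 'a \<Rightarrow> real \<Rightarrow> 'a" where "fpt i \<equiv> CN_space.pt (X i) (d i)"
abbreviation fgp :: "'i \<Rightarrow> 'a \<Rightarrow> 'a \<Rightarrow> real \<Rightarrow> 'a" where "fgp i \<equiv> CN_space.gp (X i) (d i)"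

lemma cn: "i \<in> I \<Longrightarrow> CN_space (X i) (d i)"
  using factor proper_CN_space.axioms(1) by blast

lemma ms: "i \<in> I \<Longrightarrow> Metric_space (X i) (d i)"
  using cn CN_space.axioms(1) by blast

lemma D_sq: "(D x y)\<^sup>2 = (\<Sum>i\<in>I. (d i (x i) (y i))\<^sup>2)"
  unfolding l2_dist_def L2_set_def by (simp add: sum_nonneg)

lemma D_nonneg: "0 \<le> D x y"
  unfolding l2_dist_def by (rule L2_set_nonneg)

lemma component_le_D: "i \<in> I \<Longrightarrow> d i (x i) (y i) \<le> D x y"
  unfolding l2_dist_def
  using member_le_L2_set[OF finite_I, of i "\<lambda>i. d i (x i) (y i)"] by simp

lemma D_le_sum: "D x y \<le> (\<Sum>i\<in>I. d i (x i) (y i))"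
  unfolding l2_dist_def
  by (rule L2_set_le_sum) (simp add: Metric_space.nonneg[OF ms])

lemma Metric_space_P: "Metric_space P D"
proof
  show "0 \<le> D x y" for x y by (rule D_nonneg)
  show "D x y = D y x" for x y
    unfolding l2_dist_def by (rule L2_set_cong) (auto simp: Metric_space.commute[OF ms])
  show "D x y = 0 \<longleftrightarrow> x = y" if "x \<in> P" "y \<in> P" for x y
  proof
    assume "D x y = 0"
    then have "x i = y i" if i: "i \<in> I" for i
      using component_le_D[OF i, of x y] Metric_space.nonneg[OF ms[OF i], of "x i" "y i"]
        Metric_space.zero[OF ms[OF i] PiE_mem[OF \<open>x \<in> P\<close> i] PiE_mem[OF \<open>y \<in> P\<close> i]] by simp
    then show "x = y" using that by (intro PiE_ext) auto
  next
    assume "x = y"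
    then have "(D x y)\<^sup>2 = 0"
      unfolding D_sq using Metric_space.zero[OF ms] that by (auto intro!: sum.neutral simp: PiE_mem)
    then show "D x y = 0" by simp
  qed
  show "D x z \<le> D x y + D y z" if "x \<in> P" "y \<in> P" "z \<in> P" for x y z
  proof -
    have "D x z \<le> L2_set (\<lambda>i. d i (x i) (y i) + d i (y i) (z i)) I"
      unfolding l2_dist_def
      using Metric_space.triangle[OF ms] Metric_space.nonneg[OF ms] that
      by (intro L2_set_mono) (auto simp: PiE_mem)
    also have "\<dots> \<le> D x y + D y z" unfolding l2_dist_def by (rule L2_set_triangle_ineq)
    finally show ?thesis .
  qed
qed

definition ppt :: "('i \<Rightarrow> 'a) \<Rightarrow> ('i \<Rightarrow> 'a) \<Rightarrow> real \<Rightarrow> 'i \<Rightarrow> 'a" where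
  "ppt x y s = (\<lambda>i\<in>I. fpt i (x i) (y i) s)"

lemma ppt_in: "\<lbrakk>x \<in> P; y \<in> P; 0 \<le> s; s \<le> 1\<rbrakk> \<Longrightarrow> ppt x y s \<in> P"
  unfolding ppt_def by (auto intro!: CN_space.pt_in[OF cn])

lemma ppt_CN:
  assumes "x \<in> P" "y \<in> P" "z \<in> P" "0 \<le> s" "s \<le> 1"
  shows "(D (ppt x y s) z)\<^sup>2 \<le> (1 - s) * (D x z)\<^sup>2 + s * (D y z)\<^sup>2 - s * (1 - s) * (D x y)\<^sup>2"
proof -
  have "(D (ppt x y s) z)\<^sup>2 \<le> (\<Sum>i\<in>I. (1 - s) * (d i (x i) (z i))\<^sup>2 + s * (d i (y i) (z i))\<^sup>2
      - s * (1 - s) * (d i (x i) (y i))\<^sup>2)"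
    unfolding D_sq ppt_def
    using CN_space.pt_CN[OF cn] assms by (intro sum_mono) (auto simp: PiE_mem)
  also have "\<dots> = (1 - s) * (D x z)\<^sup>2 + s * (D y z)\<^sup>2 - s * (1 - s) * (D x y)\<^sup>2"
    unfolding D_sq by (simp add: sum.distrib sum_subtractf sum_distrib_left)
  finally show ?thesis .
qed

sublocale P: CN_space P D
proof (intro CN_space.intro CN_space_axioms.intro Metric_space_P)
  fix x y s assume *: "x \<in> P" "y \<in> P" "0 \<le> s" "s \<le> (1::real)"
  then show "\<exists>p\<in>P. \<forall>z\<in>P. (D p z)\<^sup>2 \<le> (1 - s) * (D x z)\<^sup>2 + s * (D y z)\<^sup>2 - s * (1 - s) * (D x y)\<^sup>2"
    using ppt_CN ppt_in by (intro bexI[of _ "ppt x y s"]) auto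
qed

text \<open>The componentwise point satisfies the product inequality by summation, and this
  determines it.\<close>

lemma P_pt_eq:
  assumes "x \<in> P" "y \<in> P" "0 \<le> s" "s \<le> 1"
  shows "P.pt x y s = ppt x y s"
proof (rule P.pt_unique[OF assms ppt_in[OF assms], symmetric])
  have "(D (ppt x y s) x)\<^sup>2 \<le> (s * D x y)\<^sup>2"
    using ppt_CN[OF assms(1,2,1,3,4)] assms by (simp add: P.commute[of y x] power2_eq_square algebra_simps)
  then show "D x (ppt x y s) \<le> s * D x y"
    using assms D_nonneg by (metis P.commute power2_le_imp_le zero_le_mult_iff)
  have "(D (ppt x y s) y)\<^sup>2 \<le> ((1 - s) * D x y)\<^sup>2"
    using ppt_CN[OF assms(1,2,2,3,4)] assms by (simp add: power2_eq_square algebra_simps)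
  then show "D (ppt x y s) y \<le> (1 - s) * D x y"
    by (rule power2_le_imp_le) (use assms D_nonneg in auto)
qed

lemma P_gp_component:
  assumes "x \<in> P" "y \<in> P" "0 \<le> t" "t \<le> D x y" "i \<in> I"
  shows "P.gp x y t i = fgp i (x i) (y i) (t * d i (x i) (y i) / D x y)"
proof -
  have xy: "x i \<in> X i" "y i \<in> X i" using assms by (auto simp: PiE_mem)
  have r: "0 \<le> t / D x y" "t / D x y \<le> 1" using P.ratio_bounds assms by auto
  have "P.gp x y t i = fpt i (x i) (y i) (t / D x y)"
    unfolding P.gp_def P_pt_eq[OF assms(1,2) r] ppt_def using assms(5) by simp
  also have "\<dots> = fgp i (x i) (y i) (t * d i (x i) (y i) / D x y)"
  proof (cases "d i (x i) (y i) = 0")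
    case True
    then have "x i = y i" using Metric_space.zero[OF ms[OF assms(5)] xy] by simp
    then show ?thesis
      using CN_space.pt_refl[OF cn[OF assms(5)] xy(2)] r True by (simp add: CN_space.gp_def[OF cn[OF assms(5)]])
  next
    case False
    then show ?thesis by (simp add: CN_space.gp_def[OF cn[OF assms(5)]])
  qed
  finally show ?thesis .
qed

lemma ray_components:
  assumes c: "geodesic_ray P D c" and i: "i \<in> I" and st: "0 \<le> s" "0 \<le> t"
  shows "d i (c s i) (c t i) = d i (c 0 i) (c 1 i) * \<bar>s - t\<bar>"
proof -
  interpret CN_space "X i" "d i" by (rule cn[OF i])
  define T where "T = max 1 (max s t)"
  have T: "1 \<le> T" "s \<le> T" "t \<le> T" by (auto simp: T_def)
  have cP: "c u \<in> P" if "0 \<le> u" for u using c that unfolding geodesic_ray_def by auto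
  have cX: "c u i \<in> X i" if "0 \<le> u" for u using cP[OF that] i by (auto simp: PiE_mem)
  have DT: "D (c 0) (c T) = T" using c T unfolding geodesic_ray_def by auto
  have comp: "c u i = fpt i (c 0 i) (c T i) (u / T)" if u: "0 \<le> u" "u \<le> T" for u
  proof -
    have "c u = P.pt (c 0) (c T) (u / T)"
      using P.ray_gp[OF c u] by (simp add: P.gp_def DT)
    then show ?thesis using P_pt_eq[of "c 0" "c T" "u / T"] cP u T i by (simp add: ppt_def)
  qed
  have dist: "d i (c u i) (c v i) = \<bar>u / T - v / T\<bar> * d i (c 0 i) (c T i)"
    if "0 \<le> u" "u \<le> T" "0 \<le> v" "v \<le> T" for u v
    unfolding comp[OF that(1,2)] comp[OF that(3,4)]
    using cX that T by (intro dist_pt_pt) auto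
  have "d i (c 0 i) (c 1 i) = (1 / T) * d i (c 0 i) (c T i)" using dist[of 0 1] T by simp
  moreover have "d i (c s i) (c t i) = \<bar>s - t\<bar> * ((1 / T) * d i (c 0 i) (c T i))"
    using dist[of s t] st T by (simp add: diff_divide_distrib[symmetric])
  ultimately show ?thesis by simp
qed

lemma ex_ray_decomposition:
  assumes c: "geodesic_ray P D c"
  obtains \<sigma>s \<theta> where "ray_decomposition I X d c \<sigma>s \<theta>"
proof -
  define \<theta> where "\<theta> = (\<lambda>i\<in>I. d i (c 0 i) (c 1 i))"
  have cP: "c u \<in> P" if "0 \<le> u" for u using c that unfolding geodesic_ray_def by auto
  have cX: "c u i \<in> X i" if "0 \<le> u" "i \<in> I" for u i using cP[OF that(1)] that(2) by (auto simp: PiE_mem)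
  have \<theta>: "0 \<le> \<theta> i" if "i \<in> I" for i using that Metric_space.nonneg[OF ms] by (simp add: \<theta>_def)
  have dist: "d i (c s i) (c t i) = \<theta> i * \<bar>s - t\<bar>" if "i \<in> I" "0 \<le> s" "0 \<le> t" for i s t
    using ray_components[OF c that] that(1) by (simp add: \<theta>_def)
  have "\<exists>e. geodesic_ray (X i) (d i) e \<and> (\<forall>t\<ge>0. c t i = e (\<theta> i * t))" if i: "i \<in> I" for i
  proof (cases "\<theta> i = 0")
    case True
    interpret proper_CN_space "X i" "d i" by (rule factor[OF i])
    \<comment> \<open>A constant component is represented by any ray from that point, evaluated only
      at time 0.\<close>
    obtain e0 where "geodesic_ray (X i) (d i) e0" using ex_ray[OF i] by blast
    then obtain e where e: "geodesic_ray (X i) (d i) e" "e 0 = c 0 i"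
      using asymptotic_ray_from cX[OF _ i, of 0] by (metis order_refl)
    have "c t i = e (\<theta> i * t)" if "0 \<le> t" for t
      using dist[OF i that, of 0] True cX[OF that i] cX[OF _ i, of 0] e(2) by simp
    then show ?thesis using e(1) by blast
  next
    case False
    then have p: "0 < \<theta> i" using \<theta>[OF i] by simp
    have "geodesic_ray (X i) (d i) (\<lambda>t. c (t / \<theta> i) i)"
      unfolding geodesic_ray_def
    proof (intro conjI allI impI)
      show "c (t / \<theta> i) i \<in> X i" if "0 \<le> t" for t using cX[OF _ i] p that by simp
      show "d i (c (s / \<theta> i) i) (c (t / \<theta> i) i) = \<bar>s - t\<bar>" if "0 \<le> s" "0 \<le> t" for s t
      proof -
        have "d i (c (s / \<theta> i) i) (c (t / \<theta> i) i) = \<theta> i * \<bar>(s - t) / \<theta> i\<bar>"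
          using dist[OF i, of "s / \<theta> i" "t / \<theta> i"] p that by (simp add: diff_divide_distrib)
        also have "\<dots> = \<bar>s - t\<bar>" using p by (simp add: abs_divide)
        finally show ?thesis .
      qed
    qed
    then show ?thesis using p by (intro exI[of _ "\<lambda>t. c (t / \<theta> i) i"]) simp
  qed
  then obtain \<sigma>s where \<sigma>s: "\<And>i. i \<in> I \<Longrightarrow> geodesic_ray (X i) (d i) (\<sigma>s i)"
    "\<And>i t. i \<in> I \<Longrightarrow> 0 \<le> t \<Longrightarrow> c t i = \<sigma>s i (\<theta> i * t)" by metis
  have "L2_set \<theta> I = D (c 0) (c 1)"
    unfolding l2_dist_def by (rule L2_set_cong) (simp_all add: \<theta>_def)
  also have "\<dots> = 1" using c unfolding geodesic_ray_def by simp
  finally have L: "L2_set \<theta> I = 1" .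
  have "\<theta> \<in> I \<rightarrow>\<^sub>E {0..}" using \<theta> by (auto simp: \<theta>_def)
  moreover have "c t = (\<lambda>i\<in>I. \<sigma>s i (\<theta> i * t))" if "0 \<le> t" for t
    using \<sigma>s cP[OF that] that by (intro ext) (auto simp: restrict_def PiE_iff extensional_def)
  ultimately show ?thesis using that[of \<sigma>s \<theta>] \<sigma>s L unfolding ray_decomposition_def by blast
qed

lemma ray_decomposition_imp_ray:
  assumes "ray_decomposition I X d c \<sigma>s \<theta>"
  shows "geodesic_ray P D c"
proof -
  have r: "\<And>i. i \<in> I \<Longrightarrow> geodesic_ray (X i) (d i) (\<sigma>s i)" "\<And>i. i \<in> I \<Longrightarrow> 0 \<le> \<theta> i" "L2_set \<theta> I = 1"
    "\<And>t. 0 \<le> t \<Longrightarrow> c t = (\<lambda>i\<in>I. \<sigma>s i (\<theta> i * t))"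
    using assms unfolding ray_decomposition_def by auto
  have "D (c s) (c t) = \<bar>s - t\<bar>" if "0 \<le> s" "0 \<le> t" for s t
  proof -
    have "D (c s) (c t) = L2_set (\<lambda>i. \<bar>s - t\<bar> * \<theta> i) I"
      unfolding l2_dist_def
    proof (rule L2_set_cong)
      fix i assume i: "i \<in> I"
      have "d i (\<sigma>s i (\<theta> i * s)) (\<sigma>s i (\<theta> i * t)) = \<bar>\<theta> i * s - \<theta> i * t\<bar>"
        using r(1,2)[OF i] that unfolding geodesic_ray_def by simp
      also have "\<dots> = \<bar>s - t\<bar> * \<theta> i"
        using r(2)[OF i] by (simp add: right_diff_distrib[symmetric] abs_mult)
      finally show "d i (c s i) (c t i) = \<bar>s - t\<bar> * \<theta> i" using i that by (simp add: r(4))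
    qed simp
    also have "\<dots> = \<bar>s - t\<bar> * L2_set \<theta> I" by (simp add: L2_set_right_distrib)
    finally show ?thesis using r(3) by simp
  qed
  moreover have "c t \<in> P" if "0 \<le> t" for t
    using r(1,2) that unfolding geodesic_ray_def r(4)[OF that] by auto
  ultimately show ?thesis unfolding geodesic_ray_def by blast
qed

text \<open>Different speeds in a factor would make the distance there, and hence in the product,
  grow linearly. At a positive speed reparametrisation gives asymptotic components; at speed 0 the
  component ray is invisible.\<close>

lemma asymptotic_decompositions:
  assumes c: "ray_decomposition I X d c \<sigma>s \<theta>" and c': "ray_decomposition I X d c' \<sigma>s' \<theta>'"
    and asym: "asymptotic D c c'"
  shows "\<theta> = \<theta>'" and "\<And>i. \<lbrakk>i \<in> I; 0 < \<theta> i\<rbrakk> \<Longrightarrow> asymptotic (d i) (\<sigma>s i) (\<sigma>s' i)"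
proof -
  have r: "\<And>i. i \<in> I \<Longrightarrow> geodesic_ray (X i) (d i) (\<sigma>s i)" "\<And>i. i \<in> I \<Longrightarrow> 0 \<le> \<theta> i"
    "\<And>t. 0 \<le> t \<Longrightarrow> c t = (\<lambda>i\<in>I. \<sigma>s i (\<theta> i * t))" "\<theta> \<in> I \<rightarrow>\<^sub>E {0..}"
    using c unfolding ray_decomposition_def by auto
  have r': "\<And>i. i \<in> I \<Longrightarrow> geodesic_ray (X i) (d i) (\<sigma>s' i)" "\<And>i. i \<in> I \<Longrightarrow> 0 \<le> \<theta>' i"
    "\<And>t. 0 \<le> t \<Longrightarrow> c' t = (\<lambda>i\<in>I. \<sigma>s' i (\<theta>' i * t))" "\<theta>' \<in> I \<rightarrow>\<^sub>E {0..}"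
    using c' unfolding ray_decomposition_def by auto
  obtain B where "\<And>t. 0 \<le> t \<Longrightarrow> D (c t) (c' t) \<le> B" using asym unfolding asymptotic_def by blast
  then have B: "d i (\<sigma>s i (\<theta> i * t)) (\<sigma>s' i (\<theta>' i * t)) \<le> B" if "0 \<le> t" "i \<in> I" for t i
    using component_le_D[OF that(2), of "c t" "c' t"] that r(3) r'(3) by (simp add: order_trans)
  have eq: "\<theta> i = \<theta>' i" if i: "i \<in> I" for i
  proof (rule ccontr)
    interpret Metric_space "X i" "d i" by (rule ms[OF i])
    have M: "\<sigma>s i t \<in> X i" "\<sigma>s' i t \<in> X i" "d i (\<sigma>s i 0) (\<sigma>s i t) = t" "d i (\<sigma>s' i 0) (\<sigma>s' i t) = t" if "0 \<le> t" for t
      using r(1)[OF i] r'(1)[OF i] that unfolding geodesic_ray_def by auto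
    let ?e = "d i (\<sigma>s i 0) (\<sigma>s' i 0)"
    have bd: "\<bar>\<theta> i - \<theta>' i\<bar> * t \<le> ?e + B" if t: "0 \<le> t" for t
    proof -
      let ?a = "\<sigma>s i (\<theta> i * t)" and ?b = "\<sigma>s' i (\<theta>' i * t)"
      have nn: "0 \<le> \<theta> i * t" "0 \<le> \<theta>' i * t" using r(2)[OF i] r'(2)[OF i] t by auto
      have "\<theta> i * t \<le> ?e + \<theta>' i * t + B"
        using triangle[of "\<sigma>s i 0" "\<sigma>s' i 0" ?a] triangle[of "\<sigma>s' i 0" ?b ?a] M(1,2)[of 0]
          M[OF nn(1)] M[OF nn(2)] B[OF t i] by (simp add: commute)
      moreover have "\<theta>' i * t \<le> ?e + \<theta> i * t + B"
        using triangle[of "\<sigma>s' i 0" "\<sigma>s i 0" ?b] triangle[of "\<sigma>s i 0" ?a ?b] M(1,2)[of 0]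
          M[OF nn(1)] M[OF nn(2)] B[OF t i] by (simp add: commute)
      moreover have "\<bar>\<theta> i - \<theta>' i\<bar> * t = \<bar>\<theta> i * t - \<theta>' i * t\<bar>"
        using t by (simp add: left_diff_distrib[symmetric] abs_mult)
      ultimately show ?thesis by (simp add: abs_le_iff)
    qed
    assume "\<theta> i \<noteq> \<theta>' i"
    then have p: "0 < \<bar>\<theta> i - \<theta>' i\<bar>" by simp
    define t where "t = (\<bar>?e + B\<bar> + 1) / \<bar>\<theta> i - \<theta>' i\<bar>"
    have "\<bar>\<theta> i - \<theta>' i\<bar> * t = \<bar>?e + B\<bar> + 1" "0 \<le> t" using p by (auto simp: t_def)
    then show False using bd[of t] by linarith
  qed
  then show th: "\<theta> = \<theta>'" using r(4) r'(4) by (intro PiE_ext) auto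
  show "asymptotic (d i) (\<sigma>s i) (\<sigma>s' i)" if i: "i \<in> I" "0 < \<theta> i" for i
    unfolding asymptotic_def
  proof (intro exI allI impI)
    fix t :: real assume "0 \<le> t"
    then show "d i (\<sigma>s i t) (\<sigma>s' i t) \<le> B"
      using B[of "t / \<theta> i" i] i th by simp
  qed
qed

lemma asymptotic_of_endpoint:
  assumes "geodesic_ray P D c" "e \<in> endpoint P D c" "e' \<in> endpoint P D c"
  shows "asymptotic D e e'"
proof -
  have M: "c t \<in> P" "e t \<in> P" "e' t \<in> P" if "0 \<le> t" for t
    using assms that unfolding endpoint_def geodesic_ray_def by auto
  obtain A B where AB: "\<And>t. 0 \<le> t \<Longrightarrow> D (c t) (e t) \<le> A" "\<And>t. 0 \<le> t \<Longrightarrow> D (c t) (e' t) \<le> B"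
    using assms unfolding endpoint_def asymptotic_def by blast
  have "D (e t) (e' t) \<le> A + B" if t: "0 \<le> t" for t
    using P.triangle[OF M(2)[OF t] M(1)[OF t] M(3)[OF t]] AB[OF t] P.commute[of "e t" "c t"] by linarith
  then show ?thesis unfolding asymptotic_def by blast
qed

lemma self_endpoint: "geodesic_ray P D c \<Longrightarrow> c \<in> endpoint P D c"
  unfolding endpoint_def asymptotic_def geodesic_ray_def by auto

lemma ray_slope_endpoint:
  assumes "ray_decomposition I X d c \<sigma>s \<theta>"
  shows "ray_slope I X d (endpoint P D c) = \<theta>"
  unfolding ray_slope_def
proof (rule the_equality)
  have c: "geodesic_ray P D c" by (rule ray_decomposition_imp_ray[OF assms])
  show "\<exists>\<sigma>\<in>endpoint P D c. \<exists>\<sigma>s. ray_decomposition I X d \<sigma> \<sigma>s \<theta>"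
    using assms self_endpoint[OF c] by blast
  show "\<theta>' = \<theta>" if "\<exists>\<sigma>\<in>endpoint P D c. \<exists>\<sigma>s. ray_decomposition I X d \<sigma> \<sigma>s \<theta>'" for \<theta>'
    using that asymptotic_decompositions(1)[OF assms] asymptotic_of_endpoint[OF c self_endpoint[OF c]] by blast
qed

lemma furstenberg_proj_endpoint:
  assumes dec: "ray_decomposition I X d c \<sigma>s \<theta>" and pos: "\<And>i. i \<in> I \<Longrightarrow> 0 < \<theta> i"
  shows "furstenberg_proj I X d (endpoint P D c) = (\<lambda>i\<in>I. endpoint (X i) (d i) (\<sigma>s i))"
  unfolding furstenberg_proj_def
proof (rule the_equality)
  have c: "geodesic_ray P D c" by (rule ray_decomposition_imp_ray[OF dec])
  show "\<exists>\<sigma>\<in>endpoint P D c. \<exists>\<sigma>s' \<theta>. ray_decomposition I X d \<sigma> \<sigma>s' \<theta> \<and>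
      (\<lambda>i\<in>I. endpoint (X i) (d i) (\<sigma>s i)) = (\<lambda>i\<in>I. endpoint (X i) (d i) (\<sigma>s' i))"
    using dec self_endpoint[OF c] by blast
  fix \<eta> assume "\<exists>\<sigma>\<in>endpoint P D c. \<exists>\<sigma>s \<theta>. ray_decomposition I X d \<sigma> \<sigma>s \<theta> \<and>
      \<eta> = (\<lambda>i\<in>I. endpoint (X i) (d i) (\<sigma>s i))"
  then obtain e \<sigma>s' \<theta>' where e: "e \<in> endpoint P D c" "ray_decomposition I X d e \<sigma>s' \<theta>'"
    "\<eta> = (\<lambda>i\<in>I. endpoint (X i) (d i) (\<sigma>s' i))" by blast
  have "endpoint (X i) (d i) (\<sigma>s i) = endpoint (X i) (d i) (\<sigma>s' i)" if i: "i \<in> I" for i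
  proof (rule CN_space.endpoint_eq[OF cn[OF i]])
    show "\<sigma>s i t \<in> X i" "\<sigma>s' i t \<in> X i" if "0 \<le> t" for t
      using dec e(2) i that unfolding ray_decomposition_def geodesic_ray_def by auto
    show "asymptotic (d i) (\<sigma>s i) (\<sigma>s' i)"
      using asymptotic_decompositions(2)[OF dec e(2) asymptotic_of_endpoint[OF c self_endpoint[OF c] e(1)] i pos[OF i]] .
  qed
  then show "\<eta> = (\<lambda>i\<in>I. endpoint (X i) (d i) (\<sigma>s i))"
    unfolding e(3) by (intro restrict_ext) simp
qed

lemma prod_ray_decomposition:
  assumes "\<And>i. i \<in> I \<Longrightarrow> geodesic_ray (X i) (d i) (\<sigma>s i)" "\<theta> \<in> E_plus I"
  shows "ray_decomposition I X d (prod_ray I \<sigma>s \<theta>) \<sigma>s \<theta>"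
proof -
  have "\<theta> \<in> I \<rightarrow>\<^sub>E {0..}" "L2_set \<theta> I = 1"
    using assms(2) unfolding E_plus_def by (auto simp: PiE_mem PiE_iff less_imp_le)
  then show ?thesis using assms(1) unfolding ray_decomposition_def prod_ray_def by blast
qed

lemma E_plus_pos: "\<theta> \<in> E_plus I \<Longrightarrow> i \<in> I \<Longrightarrow> 0 < \<theta> i"
  unfolding E_plus_def by (auto simp: PiE_mem)

lemma regular_endpoint:
  assumes "\<And>i. i \<in> I \<Longrightarrow> geodesic_ray (X i) (d i) (\<sigma>s i)" "\<theta> \<in> E_plus I"
  shows "endpoint P D (prod_ray I \<sigma>s \<theta>) \<in> regular_boundary I X d"
    "regular_boundary_map I X d (endpoint P D (prod_ray I \<sigma>s \<theta>)) =
      ((\<lambda>i\<in>I. endpoint (X i) (d i) (\<sigma>s i)), \<theta>)"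
proof -
  have dec: "ray_decomposition I X d (prod_ray I \<sigma>s \<theta>) \<sigma>s \<theta>" by (rule prod_ray_decomposition[OF assms])
  show "endpoint P D (prod_ray I \<sigma>s \<theta>) \<in> regular_boundary I X d"
    unfolding regular_boundary_def geom_boundary_def
    using ray_slope_endpoint[OF dec] ray_decomposition_imp_ray[OF dec] assms(2) by auto
  show "regular_boundary_map I X d (endpoint P D (prod_ray I \<sigma>s \<theta>)) =
      ((\<lambda>i\<in>I. endpoint (X i) (d i) (\<sigma>s i)), \<theta>)"
    unfolding regular_boundary_map_def
    using ray_slope_endpoint[OF dec] furstenberg_proj_endpoint[OF dec] E_plus_pos[OF assms(2)] by simp
qed

text \<open>The component rays are moved separately to start at x, so that all limit points can be
  tested from one base point.\<close>

lemma regular_boundary_cases: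
  assumes \<xi>: "\<xi> \<in> regular_boundary I X d" and x: "x \<in> P"
  obtains \<sigma>s \<theta> where "\<And>i. i \<in> I \<Longrightarrow> geodesic_ray (X i) (d i) (\<sigma>s i)" "\<And>i. i \<in> I \<Longrightarrow> \<sigma>s i 0 = x i"
    "\<theta> \<in> E_plus I" "\<xi> = endpoint P D (prod_ray I \<sigma>s \<theta>)"
proof -
  obtain c where c: "geodesic_ray P D c" "\<xi> = endpoint P D c"
    using \<xi> unfolding regular_boundary_def geom_boundary_def by blast
  obtain \<sigma>s \<theta> where dec: "ray_decomposition I X d c \<sigma>s \<theta>" using ex_ray_decomposition[OF c(1)] by blast
  have \<theta>: "\<theta> \<in> E_plus I"
    using \<xi> ray_slope_endpoint[OF dec] c(2) unfolding regular_boundary_def by simp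
  have rays: "geodesic_ray (X i) (d i) (\<sigma>s i)" if "i \<in> I" for i
    using dec that unfolding ray_decomposition_def by blast
  have "\<exists>e. geodesic_ray (X i) (d i) e \<and> e 0 = x i \<and> (\<forall>t\<ge>0. d i (\<sigma>s i t) (e t) \<le> 2 * d i (\<sigma>s i 0) (x i) + 1)"
    if i: "i \<in> I" for i
  proof -
    interpret proper_CN_space "X i" "d i" by (rule factor[OF i])
    have "x i \<in> X i" using x i by (auto simp: PiE_mem)
    then show ?thesis using asymptotic_ray_from[OF rays[OF i]] by blast
  qed
  then obtain \<tau> where \<tau>: "\<And>i. i \<in> I \<Longrightarrow> geodesic_ray (X i) (d i) (\<tau> i)"
    "\<And>i. i \<in> I \<Longrightarrow> \<tau> i 0 = x i"
    "\<And>i t. i \<in> I \<Longrightarrow> 0 \<le> t \<Longrightarrow> d i (\<sigma>s i t) (\<tau> i t) \<le> 2 * d i (\<sigma>s i 0) (x i) + 1"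
    by metis
  have dec': "ray_decomposition I X d (prod_ray I \<tau> \<theta>) \<tau> \<theta>" by (rule prod_ray_decomposition[OF \<tau>(1) \<theta>])
  have "D (c t) (prod_ray I \<tau> \<theta> t) \<le> (\<Sum>i\<in>I. 2 * d i (\<sigma>s i 0) (x i) + 1)" if t: "0 \<le> t" for t
  proof -
    have "c t = (\<lambda>i\<in>I. \<sigma>s i (\<theta> i * t))" using dec t unfolding ray_decomposition_def by blast
    then have "D (c t) (prod_ray I \<tau> \<theta> t) \<le> (\<Sum>i\<in>I. d i (\<sigma>s i (\<theta> i * t)) (\<tau> i (\<theta> i * t)))"
      using D_le_sum[of "c t" "prod_ray I \<tau> \<theta> t"] by (simp add: prod_ray_def)
    also have "\<dots> \<le> (\<Sum>i\<in>I. 2 * d i (\<sigma>s i 0) (x i) + 1)"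
      using \<tau>(3) E_plus_pos[OF \<theta>] t by (intro sum_mono) (simp add: less_imp_le)
    finally show ?thesis .
  qed
  then have "asymptotic D c (prod_ray I \<tau> \<theta>)" unfolding asymptotic_def by blast
  then have "\<xi> = endpoint P D (prod_ray I \<tau> \<theta>)"
    unfolding c(2) using c(1) ray_decomposition_imp_ray[OF dec']
    by (intro P.endpoint_eq) (auto simp: geodesic_ray_def)
  then show ?thesis using that \<tau>(1,2) \<theta> by blast
qed

end

section \<open>Limit points of product groups\<close>

text \<open>Each i rules out at most one of the card I + 1 values of k.\<close>

lemma pigeonhole_avoid:
  assumes "finite I" and "\<And>i j k. \<lbrakk>i \<in> I; j < k; k \<le> card I\<rbrakk> \<Longrightarrow> \<not> (U i j \<and> U i k)"
  obtains k where "k \<le> card I" "\<And>i. i \<in> I \<Longrightarrow> \<not> U i k"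
proof (rule ccontr)
  assume "\<not> thesis"
  then have "\<forall>k\<in>{..card I}. \<exists>i. i \<in> I \<and> U i k" using that by auto
  from bchoice[OF this] obtain f where f: "\<And>k. k \<le> card I \<Longrightarrow> f k \<in> I \<and> U (f k) k" by auto
  have "inj_on f {..card I}"
  proof (rule linorder_inj_onI)
    show "f j \<noteq> f k" if "j < k" "j \<in> {..card I}" "k \<in> {..card I}" for j k
      using f[of j] f[of k] assms(2)[of "f j" j k] that by auto
  qed auto
  then have "card {..card I} \<le> card I"
    by (rule card_inj_on_le) (use f assms(1) in auto)
  then show False by simp
qed

section \<open>Combining the direction and the slope of two limit points\<close>

context CN_space
begin

text \<open>Two contractions towards p: between a and the point w of [p, y] near it, contributing B,
  and between c T and the point q of [p, a] near it, contributing 1. The condition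
  \<open>A + 1 + B \<le> T\<close> keeps all four points at distance at least A from p.\<close>

lemma gp_follow:
  assumes M: "p \<in> M" "y \<in> M" "a \<in> M" and u: "u \<in> {0..1}" "d (pt p y u) a \<le> B"
    and s: "0 \<le> s" "s \<le> d p a" and c: "geodesic_ray M d c" "c 0 = p" and near: "d (gp p a s) (c T) \<le> 1"
    and A: "0 < A" "A + 1 + B \<le> T" and t: "0 \<le> t" "t \<le> A" and B: "0 \<le> B"
  shows "A \<le> d p y" "d (gp p y t) (c t) \<le> t / A * (B + 1)"
proof -
  define w q where "w = pt p y u" and "q = gp p a s"
  have T: "0 \<le> T" using A B by simp
  have e: "c T \<in> M" "d p (c T) = T" using c T unfolding geodesic_ray_def by auto
  have q: "q \<in> M" "d p q = s" unfolding q_def using M s by (auto simp: dist_gp)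
  have sT: "T - 1 \<le> s" using triangle[of p q "c T"] M(1) q e near unfolding q_def[symmetric] by simp
  have w: "w \<in> M" "d w a \<le> B" "d p w = u * d p y" using M u by (auto simp: w_def dist_pt_left)
  have wA: "A \<le> d p w" using triangle[of p w a] M w s sT A by simp
  have wy: "d p w \<le> d p y" using u(1) unfolding w(3) by (simp add: mult_left_le_one_le)
  then show Ay: "A \<le> d p y" using wA by simp
  have "d p y > 0" using Ay A by simp
  then have "w = gp p y (d p w)" unfolding gp_def w(3) by (simp add: w_def)
  then have 1: "gp p y t = gp p w t" using gp_gp[OF M(1,2) t(1) _ wy] t wA by simp
  have 2: "gp p a t = gp p q t" unfolding q_def using gp_gp[OF M(1,3) t(1) _ s(2)] t sT A B by simp
  have 3: "c t = gp p (c T) t" using ray_gp[OF c(1) t(1), of T] c(2) t A B by simp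
  have "d (gp p w t) (gp p a t) \<le> t / A * d w a"
    using M w t A wA s sT B by (intro gp_dist_le) auto
  also have "\<dots> \<le> t / A * B" using w(2) t A by (intro mult_left_mono) auto
  finally have 4: "d (gp p w t) (gp p a t) \<le> t / A * B" .
  have "d (gp p q t) (gp p (c T) t) \<le> t / A * d q (c T)"
    using M q e t A sT B by (intro gp_dist_le) auto
  also have "\<dots> \<le> t / A * 1" using near t A unfolding q_def by (intro mult_left_mono) auto
  finally have 5: "d (gp p a t) (c t) \<le> t / A" using 2 3 by simp
  have "d (gp p y t) (c t) \<le> d (gp p w t) (gp p a t) + d (gp p a t) (c t)"
    unfolding 1 using M w t A wA s sT B c(1)
    by (intro triangle) (auto simp: geodesic_ray_def)
  then show "d (gp p y t) (c t) \<le> t / A * (B + 1)" using 4 5 by (simp only: distrib_left mult_1_right)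
qed

end

context CN_product
begin

lemma D_le_add:
  assumes "\<And>i. i \<in> I \<Longrightarrow> d i (x i) (y i) \<le> d i (x i) (z i) + C" "0 \<le> C"
  shows "D x y \<le> D x z + real (card I) * C"
proof -
  have "D x y \<le> L2_set (\<lambda>i. d i (x i) (z i) + C) I"
    unfolding l2_dist_def using assms(1) Metric_space.nonneg[OF ms] by (intro L2_set_mono) auto
  also have "\<dots> \<le> D x z + L2_set (\<lambda>i. C) I" unfolding l2_dist_def by (rule L2_set_triangle_ineq)
  also have "L2_set (\<lambda>i. C) I \<le> (\<Sum>i\<in>I. C)" using assms(2) by (intro L2_set_le_sum) auto
  finally show ?thesis by simp
qed

lemma gp_near_prod_ray:
  assumes M: "x \<in> P" "y \<in> P" "0 \<le> R" "R \<le> D x y" and near: "D (P.gp x y R) (prod_ray I \<sigma>s \<theta> R) < 1"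
    and i: "i \<in> I" and s: "s = R * d i (x i) (y i) / D x y"
  shows "0 \<le> s" "s \<le> d i (x i) (y i)" "d i (fgp i (x i) (y i) s) (\<sigma>s i (\<theta> i * R)) < 1"
proof -
  have r: "0 \<le> R / D x y" "R / D x y \<le> 1" using P.ratio_bounds M by auto
  have n: "0 \<le> d i (x i) (y i)" by (rule Metric_space.nonneg[OF ms[OF i]])
  have s': "s = R / D x y * d i (x i) (y i)" by (simp add: s)
  show "0 \<le> s" unfolding s' by (rule mult_nonneg_nonneg[OF r(1) n])
  show "s \<le> d i (x i) (y i)" unfolding s' by (rule mult_left_le_one_le[OF n r])
  have "d i (P.gp x y R i) (prod_ray I \<sigma>s \<theta> R i) < 1"
    using component_le_D[OF i, of "P.gp x y R" "prod_ray I \<sigma>s \<theta> R"] near by simp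
  then show "d i (fgp i (x i) (y i) s) (\<sigma>s i (\<theta> i * R)) < 1"
    unfolding P_gp_component[OF M i] s using i by (simp add: prod_ray_def)
qed

text \<open>
  If \<open>S\<close> is the orbit of \<open>x\<close> and \<open>a = \<alpha> x\<close>, \<open>b = \<beta> x\<close>, then \<open>e\<close> is going to be \<open>\<alpha> \<gamma> \<beta> x\<close> with \<open>\<gamma>\<close> from
  a finite set; this is why \<open>C\<close> depends on \<open>a\<close> but not on \<open>b\<close>.
\<close>
definition joining :: "('i \<Rightarrow> 'a) \<Rightarrow> ('i \<Rightarrow> 'a) set \<Rightarrow> real \<Rightarrow> bool" where
  "joining x S B \<longleftrightarrow> (\<forall>a\<in>S. \<exists>C. \<forall>b\<in>S. \<exists>e\<in>S. \<forall>i\<in>I.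
     (\<exists>u\<in>{0..1}. d i (fpt i (x i) (e i) u) (a i) \<le> B) \<and> \<bar>d i (x i) (e i) - d i (x i) (b i)\<bar> \<le> C)"

text \<open>
  Given \<open>a \<in> S\<close> far away in the direction of the first ray and then \<open>b \<in> S\<close> even further away
  in the direction of the second one, \<open>e\<close> inherits its direction in each factor from \<open>a\<close>, since
  the segments from \<open>x i\<close> to \<open>e i\<close> pass near \<open>a i\<close>, and its slope from \<open>b\<close>.
\<close>
lemma combine_direction_and_slope:
  assumes S: "S \<subseteq> P" and x: "x \<in> P"
    and join: "joining x S B"
    and rays: "\<And>i. i \<in> I \<Longrightarrow> geodesic_ray (X i) (d i) (\<sigma>s i)" "\<And>i. i \<in> I \<Longrightarrow> \<sigma>s i 0 = x i" "\<theta> \<in> E_plus I"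
    and rays': "\<And>i. i \<in> I \<Longrightarrow> geodesic_ray (X i) (d i) (\<sigma>s' i)" "\<And>i. i \<in> I \<Longrightarrow> \<sigma>s' i 0 = x i" "\<theta>' \<in> E_plus I"
    and lim: "\<And>R. 0 < R \<Longrightarrow> \<exists>y\<in>S. R < D x y \<and> D (P.gp x y R) (prod_ray I \<sigma>s \<theta> R) < 1"
    and lim': "\<And>R. 0 < R \<Longrightarrow> \<exists>y\<in>S. R < D x y \<and> D (P.gp x y R) (prod_ray I \<sigma>s' \<theta>' R) < 1"
    and R: "0 < R"
  shows "\<exists>y\<in>S. R < D x y \<and> D (P.gp x y R) (prod_ray I \<sigma>s \<theta>' R) < 1"
proof -
  have L2: "L2_set \<theta>' I = 1" using rays'(3) unfolding E_plus_def by blast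
  then have ne: "I \<noteq> {}" by auto
  define r where "r = real (card I)"
  have r: "1 \<le> r" using ne finite_I by (simp add: r_def Suc_le_eq card_gt_0_iff)
  \<comment> \<open>Errors of at most 2 * \<epsilon> in each of the r factors add up to 1 /
    2.\<close>
  define \<epsilon> where "\<epsilon> = 1 / (4 * r)"
  have \<epsilon>: "0 < \<epsilon>" "r * (2 * \<epsilon>) = 1 / 2" using r by (auto simp: \<epsilon>_def)
  \<comment> \<open>By time R1 the first ray has gone at least m * R1 in every factor; this uses
    that all its slopes are positive.\<close>
  define m where "m = Min (\<theta> ` I)"
  have m: "0 < m" "\<And>i. i \<in> I \<Longrightarrow> m \<le> \<theta> i"
    unfolding m_def using ne finite_I E_plus_pos[OF rays(3)] by (auto simp: Min_gr_iff)
  define B' where "B' = max 0 B"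
  have B': "0 \<le> B'" "B \<le> B'" by (auto simp: B'_def)
  \<comment> \<open>Large enough for \<open>gp_follow\<close> to give an error of at most \<epsilon>
    up to time R.\<close>
  define A where "A = R + R * (B' + 1) / \<epsilon> + 1"
  have A: "0 < A" "R \<le> A" "R * (B' + 1) / \<epsilon> \<le> A" "0 \<le> R * (B' + 1) / \<epsilon>"
    using R \<epsilon> B' by (auto simp: A_def add_nonneg_pos)
  define R1 where "R1 = (A + 1 + B') / m"
  have R1: "0 < R1" "m * R1 = A + 1 + B'" using A B' m by (auto simp: R1_def)
  obtain a where a: "a \<in> S" "R1 < D x a" "D (P.gp x a R1) (prod_ray I \<sigma>s \<theta> R1) < 1"
    using lim[OF R1(1)] by blast
  obtain C0 where C0: "\<forall>b\<in>S. \<exists>e\<in>S. \<forall>i\<in>I.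
       (\<exists>u\<in>{0..1}. d i (fpt i (x i) (e i) u) (a i) \<le> B) \<and> \<bar>d i (x i) (e i) - d i (x i) (b i)\<bar> \<le> C0"
    using join a(1) unfolding joining_def by blast
  define C where "C = max 0 C0"
  have C: "0 \<le> C" "C0 \<le> C" by (auto simp: C_def)
  \<comment> \<open>Chosen after a, because C depends on a. When scaled by R, both the change of
    slope from b to e and the slope error 1 / R2 of b cost at most \<epsilon> / 2.\<close>
  define K where "K = 2 * R * (r + 1) * (C + 1) / \<epsilon>"
  define R2 where "R2 = r * C + K + R + 1"
  have K: "0 \<le> K" using R r C \<epsilon> by (simp add: K_def)
  have rC: "0 \<le> r * C" using r C by simp
  have R2: "0 < R2" using K rC R by (simp add: R2_def)
  obtain b where b: "b \<in> S" "R2 < D x b" "D (P.gp x b R2) (prod_ray I \<sigma>s' \<theta>' R2) < 1"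
    using lim'[OF R2] by blast
  obtain e where e: "e \<in> S" "\<And>i. i \<in> I \<Longrightarrow> \<exists>u\<in>{0..1}. d i (fpt i (x i) (e i) u) (a i) \<le> B"
    "\<And>i. i \<in> I \<Longrightarrow> \<bar>d i (x i) (e i) - d i (x i) (b i)\<bar> \<le> C0" using C0 b(1) by blast
  have abe: "a \<in> P" "b \<in> P" "e \<in> P" using a b e S by auto
  have diff: "\<bar>d i (x i) (e i) - d i (x i) (b i)\<bar> \<le> C" if "i \<in> I" for i using e(3)[OF that] C by simp
  have diff1: "d i (x i) (e i) \<le> d i (x i) (b i) + C" "d i (x i) (b i) \<le> d i (x i) (e i) + C" if "i \<in> I" for i
    using diff[OF that] by auto
  let ?b = "D x b" and ?e = "D x e"
  have eb: "?e \<le> ?b + r * C" "?b \<le> ?e + r * C"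
    unfolding r_def by (rule D_le_add[OF diff1(1) C(1)], assumption) (rule D_le_add[OF diff1(2) C(1)], assumption)
  have big: "K < ?e" "R < ?e" using b(2) eb K R rC by (auto simp: R2_def)
  have comp: "d i (P.gp x e R i) (prod_ray I \<sigma>s \<theta>' R i) \<le> 2 * \<epsilon>" if i: "i \<in> I" for i
  proof -
    interpret CN_space "X i" "d i" by (rule cn[OF i])
    have M: "x i \<in> X i" "a i \<in> X i" "b i \<in> X i" "e i \<in> X i" using x abe i by (auto simp: PiE_mem)
    let ?bi = "d i (x i) (b i)" and ?ei = "d i (x i) (e i)"
    have ray: "\<sigma>s' i t \<in> X i" "d i (x i) (\<sigma>s' i t) = t" "\<sigma>s i t \<in> X i" if "0 \<le> t" for t
      using rays(1)[OF i] rays'(1)[OF i] that unfolding geodesic_ray_def rays'(2)[OF i, symmetric] by auto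
    have \<theta>': "0 < \<theta>' i" "\<theta>' i \<le> 1"
      using E_plus_pos[OF rays'(3) i] member_le_L2_set[OF finite_I i, of \<theta>'] L2 by auto
    define t where "t = \<theta>' i * R"
    have t: "0 \<le> t" "t \<le> R" using \<theta>' R by (auto simp: t_def mult_left_le_one_le)
    obtain u where u: "u \<in> {0..1}" "d i (pt (x i) (e i) u) (a i) \<le> B'" using e(2)[OF i] B'(2) by force
    note na = gp_near_prod_ray[OF x abe(1) less_imp_le[OF R1(1)] less_imp_le[OF a(2)] a(3) i refl]
    have "m * R1 \<le> \<theta> i * R1" using m(2)[OF i] R1(1) by (intro mult_right_mono) auto
    then have AT: "A + 1 + B' \<le> \<theta> i * R1" using R1 by simp
    note follow = gp_follow[OF M(1,4,2) u na(1,2) rays(1)[OF i] rays(2)[OF i] less_imp_le[OF na(3)] A(1) AT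
        t(1) order_trans[OF t(2) A(2)] B'(1)]
    have "t / A * (B' + 1) \<le> R / A * (B' + 1)" using t A B' by (intro mult_right_mono divide_right_mono) auto
    also have "\<dots> \<le> \<epsilon>" using A(1,3) \<epsilon> by (simp add: field_simps)
    finally have 1: "d i (gp (x i) (e i) t) (\<sigma>s i t) \<le> \<epsilon>" using follow(2) by simp
    \<comment> \<open>At time R the segment to e has gone s in this factor, the target ray
      t.\<close>
    define s where "s = R * ?ei / ?e"
    have s: "0 \<le> s" "s \<le> ?ei"
    proof -
      have s': "s = R / ?e * ?ei" "0 \<le> R / ?e" "R / ?e \<le> 1" using R big by (auto simp: s_def)
      show "0 \<le> s" unfolding s'(1) by (rule mult_nonneg_nonneg[OF s'(2) nonneg])
      show "s \<le> ?ei" unfolding s'(1) by (rule mult_left_le_one_le[OF nonneg s'(2,3)])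
    qed
    note nb = gp_near_prod_ray[OF x abe(2) less_imp_le[OF R2] less_imp_le[OF b(2)] b(3) i refl]
    have "\<bar>R2 * ?bi / ?b - \<theta>' i * R2\<bar> \<le> d i (gp (x i) (b i) (R2 * ?bi / ?b)) (\<sigma>s' i (\<theta>' i * R2))"
    proof -
      have nn: "0 \<le> \<theta>' i * R2" using \<theta>' R2 by simp
      let ?q = "gp (x i) (b i) (R2 * ?bi / ?b)"
      have q: "?q \<in> X i" "d i (x i) ?q = R2 * ?bi / ?b" using M nb by (auto simp: dist_gp)
      show ?thesis
        using triangle[OF M(1) q(1) ray(1)[OF nn]] triangle[OF M(1) ray(1)[OF nn] q(1)] q(2) ray(2)[OF nn]
          commute[of ?q "\<sigma>s' i (\<theta>' i * R2)"] by linarith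
    qed
    also have "\<dots> < 1" by (rule nb(3))
    finally have "\<bar>R2 * (?bi / ?b - \<theta>' i)\<bar> < 1" by (simp add: algebra_simps)
    then have "R2 * \<bar>?bi / ?b - \<theta>' i\<bar> < 1" using R2 by (simp add: abs_mult)
    then have sl: "\<bar>?bi / ?b - \<theta>' i\<bar> < 1 / R2" using R2 by (simp add: field_simps)
    have pos: "0 < ?b" "0 < ?e" using b(2) R2 big R by auto
    have e1: "?ei / ?e - ?bi / ?b = ((?ei - ?bi) * ?b + ?bi * (?b - ?e)) / (?e * ?b)"
      using pos by (simp add: field_simps)
    have e2: "\<bar>((?ei - ?bi) * ?b + ?bi * (?b - ?e)) / (?e * ?b)\<bar> \<le> (C * ?b + ?b * (r * C)) / (?e * ?b)"
    proof -
      have "\<bar>(?ei - ?bi) * ?b\<bar> \<le> C * ?b" using diff[OF i] pos by (simp add: abs_mult)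
      moreover have "\<bar>?bi * (?b - ?e)\<bar> \<le> ?b * (r * C)"
        unfolding abs_mult using component_le_D[OF i, of x b] eb D_nonneg by (intro mult_mono) auto
      ultimately have "\<bar>(?ei - ?bi) * ?b + ?bi * (?b - ?e)\<bar> \<le> C * ?b + ?b * (r * C)" by linarith
      then show ?thesis using pos by (simp add: abs_divide divide_right_mono abs_mult)
    qed
    have "C * ?b + ?b * (r * C) = (r + 1) * C * ?b" by (simp add: algebra_simps)
    then have e3: "(C * ?b + ?b * (r * C)) / (?e * ?b) = (r + 1) * C / ?e" using pos(1) by simp
    have sl2: "\<bar>?ei / ?e - ?bi / ?b\<bar> \<le> (r + 1) * C / ?e"
      using e2 unfolding e1[symmetric] e3 .
    have "R * ((r + 1) * C / ?e) \<le> \<epsilon> / 2"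
    proof -
      have "2 * R * (r + 1) * C \<le> 2 * R * (r + 1) * (C + 1)" using R r by (intro mult_left_mono) auto
      also have "\<dots> = K * \<epsilon>" using \<epsilon> by (simp add: K_def)
      also have "\<dots> \<le> ?e * \<epsilon>" using big \<epsilon> by (intro mult_right_mono) auto
      finally show ?thesis using pos by (simp add: field_simps)
    qed
    moreover have "R * (1 / R2) \<le> \<epsilon> / 2"
    proof -
      have "1 * 1 \<le> (r + 1) * (C + 1)" using r C by (intro mult_mono) auto
      then have "2 * R / \<epsilon> * 1 \<le> 2 * R / \<epsilon> * ((r + 1) * (C + 1))"
        using R \<epsilon> by (intro mult_left_mono) auto
      also have "\<dots> = K" by (simp add: K_def)
      also have "\<dots> \<le> R2" using rC R by (simp add: R2_def)
      finally show ?thesis using \<epsilon> R2 by (simp add: field_simps)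
    qed
    moreover have "\<bar>?ei / ?e - \<theta>' i\<bar> \<le> (r + 1) * C / ?e + 1 / R2" using sl sl2 by linarith
    then have "R * \<bar>?ei / ?e - \<theta>' i\<bar> \<le> R * ((r + 1) * C / ?e + 1 / R2)" using R by (intro mult_left_mono) auto
    then have "R * \<bar>?ei / ?e - \<theta>' i\<bar> \<le> R * ((r + 1) * C / ?e) + R * (1 / R2)" by (simp only: distrib_left)
    moreover have "s - t = R * (?ei / ?e - \<theta>' i)" by (simp add: s_def t_def algebra_simps)
    then have "\<bar>s - t\<bar> = R * \<bar>?ei / ?e - \<theta>' i\<bar>" using R by (simp add: abs_mult)
    ultimately have 2: "\<bar>s - t\<bar> \<le> \<epsilon>" by linarith
    have te: "t \<le> ?ei" using follow(1) t A by simp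
    have "d i (gp (x i) (e i) s) (\<sigma>s i t) \<le> d i (gp (x i) (e i) s) (gp (x i) (e i) t) + d i (gp (x i) (e i) t) (\<sigma>s i t)"
      using M s t te ray by (intro triangle) auto
    also have "\<dots> \<le> \<epsilon> + \<epsilon>" using dist_gp_gp[OF M(1,4) s t(1) te] 1 2 by simp
    finally show ?thesis
      unfolding P_gp_component[OF x abe(3) less_imp_le[OF R] less_imp_le[OF big(2)] i] prod_ray_def
      using i by (simp add: s_def t_def)
  qed
  have "D (P.gp x e R) (prod_ray I \<sigma>s \<theta>' R) \<le> (\<Sum>i\<in>I. 2 * \<epsilon>)"
    using D_le_sum[of "P.gp x e R" "prod_ray I \<sigma>s \<theta>' R"] sum_mono[OF comp] by (rule order_trans)
  also have "\<dots> = 1 / 2" using \<epsilon>(2) by (simp add: r_def)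
  finally show ?thesis using e(1) big(2) by (intro bexI[of _ e]) auto
qed

end

section \<open>Joining elements of the group\<close>

context CN_space
begin

text \<open>The displacement of x alone bounds the change, whatever z is; hence the constant in
  \<open>joining\<close> does not depend on b.\<close>

lemma isom_displacement:
  assumes "isom g" "x \<in> M" "z \<in> M"
  shows "\<bar>d x (g z) - d x z\<bar> \<le> d x (g x)"
  using triangle[of x "g x" "g z"] triangle[of "g x" x "g z"] isom_dist[OF assms]
    isom_in[OF assms(1,2)] isom_in[OF assms(1,3)] assms(2,3) by (simp add: commute abs_le_iff)

end

text \<open>The conclusion of \<open>segments_through_ball\<close> with its four witnesses packed
  into a tuple, so that a single choice over the factors provides them all.\<close>

definition joining_data ::
  "'a set \<Rightarrow> ('a \<Rightarrow> 'a \<Rightarrow> real) \<Rightarrow> ('a \<Rightarrow> 'a) \<Rightarrow> ('a \<Rightarrow> 'a) \<Rightarrow> 'a \<Rightarrow> nat \<Rightarrow>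
   (nat \<Rightarrow> 'a \<Rightarrow> bool) \<times> (nat \<Rightarrow> 'a \<Rightarrow> bool) \<times> nat \<times> real \<Rightarrow> bool" where
  "joining_data M d g h x n = (\<lambda>(U, V, N0, B).
     (\<forall>y\<in>M. \<forall>j k. j < k \<longrightarrow> k \<le> n \<longrightarrow> \<not> (U j y \<and> U k y)) \<and>
     (\<forall>y\<in>M. \<forall>j k. j < k \<longrightarrow> k \<le> n \<longrightarrow> \<not> (V j y \<and> V k y)) \<and>
     (\<forall>N\<ge>N0. \<forall>j. \<forall>k\<le>n. \<forall>y\<in>M. \<forall>w\<in>M. \<not> U k y \<longrightarrow> \<not> V j ((g ^^ j) w) \<longrightarrow>
        (\<exists>u\<in>{0..1}. d (CN_space.pt M d y ((g ^^ k) ((h ^^ N) w)) u) x \<le> B)))"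

text \<open>Independence separates both ends of the axis of h from both ends of the axis of g, which
  gives the four required failures of asymptoticity.\<close>

lemma ex_joining_data:
  assumes "proper_CN_space M d" "independent_rank_one M d g h" "x \<in> M"
  shows "\<exists>p. joining_data M d g h x n p"
proof -
  interpret proper_CN_space M d by (rule assms(1))
  have "rank_one M d g" "rank_one M d h"
    and ne: "{attractive_point M d g, repulsive_point M d g} \<inter>
      {attractive_point M d h, repulsive_point M d h} = {}"
    using assms(2) unfolding independent_rank_one_def by auto
  obtain \<tau> l where \<tau>: "rank_one_line M d \<tau> l" "\<And>t. g (\<tau> t) = \<tau> (t + l)" "isom g"
    "attractive_point M d g = endpoint M d \<tau>" "repulsive_point M d g = endpoint M d (\<lambda>t. \<tau> (- t))"
    using rank_one_imp_line[OF assms(1) \<open>rank_one M d g\<close>] by metis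
  obtain \<sigma> a where \<sigma>: "rank_one_line M d \<sigma> a" "\<And>t. h (\<sigma> t) = \<sigma> (t + a)" "isom h"
    "attractive_point M d h = endpoint M d \<sigma>" "repulsive_point M d h = endpoint M d (\<lambda>t. \<sigma> (- t))"
    using rank_one_imp_line[OF assms(1) \<open>rank_one M d h\<close>] by metis
  have M: "\<sigma> t \<in> M" "\<tau> t \<in> M" for t
    using rank_one_line.\<sigma>_in[OF \<sigma>(1)] rank_one_line.\<sigma>_in[OF \<tau>(1)] by auto
  have "\<not> asymptotic d c c'" if "endpoint M d c \<noteq> endpoint M d c'" "\<And>t. c t \<in> M" "\<And>t. c' t \<in> M" for c c'
    using endpoint_eq that by blast
  then have na: "\<not> asymptotic d \<sigma> \<tau>" "\<not> asymptotic d \<sigma> (\<lambda>t. \<tau> (- t))"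
    "\<not> asymptotic d (\<lambda>t. \<sigma> (- t)) \<tau>" "\<not> asymptotic d (\<lambda>t. \<sigma> (- t)) (\<lambda>t. \<tau> (- t))"
    using ne M unfolding \<tau>(4,5) \<sigma>(4,5) by auto
  obtain U V N0 B where *:
    "\<And>y j k. \<lbrakk>y \<in> M; j < k; k \<le> n\<rbrakk> \<Longrightarrow> \<not> (U j y \<and> U k y)"
    "\<And>y j k. \<lbrakk>y \<in> M; j < k; k \<le> n\<rbrakk> \<Longrightarrow> \<not> (V j y \<and> V k y)"
    "\<And>N j k y w. \<lbrakk>N0 \<le> N; k \<le> n; y \<in> M; w \<in> M; \<not> U k y; \<not> V j ((g ^^ j) w)\<rbrakk> \<Longrightarrow>
       \<exists>u\<in>{0..1}. d (pt y ((g ^^ k) ((h ^^ N) w)) u) x \<le> B"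
    using segments_through_ball[OF \<sigma>(1) \<tau>(1,3,2) \<sigma>(3,2) na assms(3), of n] by blast
  have "joining_data M d g h x n (U, V, N0, B)"
    unfolding joining_data_def using * by simp
  then show ?thesis by blast
qed

lemma group_isometry_group:
  assumes "Metric_space M d"
  shows "group (isometry_group M d)"
proof -
  interpret Metric_space M d by (rule assms)
  interpret G: group "BijGroup M" by (rule group_BijGroup)
  let ?H = "{f \<in> Bij M. \<forall>x\<in>M. \<forall>y\<in>M. d (f x) (f y) = d x y}"
  have "subgroup ?H (BijGroup M)"
  proof (rule G.subgroupI)
    show "?H \<subseteq> carrier (BijGroup M)" by (auto simp: BijGroup_def)
    have "(\<lambda>x\<in>M. x) \<in> ?H" by (simp add: id_Bij)
    then show "?H \<noteq> {}" by blast
  next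
    fix f assume f: "f \<in> ?H"
    then have fb: "f \<in> Bij M" and bij: "bij_betw f M M" by (auto simp: Bij_def)
    have v: "inv_into M f x \<in> M" "f (inv_into M f x) = x" if "x \<in> M" for x
      using bij that by (auto simp: bij_betw_def inv_into_into f_inv_into_f)
    have "d (inv_into M f x) (inv_into M f y) = d x y" if "x \<in> M" "y \<in> M" for x y
      using f v[OF that(1)] v[OF that(2)] by force
    then show "inv\<^bsub>BijGroup M\<^esub> f \<in> ?H"
      unfolding inv_BijGroup[OF fb] using restrict_inv_into_Bij[OF fb] by simp
  next
    fix f g assume "f \<in> ?H" "g \<in> ?H"
    then show "f \<otimes>\<^bsub>BijGroup M\<^esub> g \<in> ?H"
      using Bij_imp_funcset[of g M]
      by (auto simp: BijGroup_def compose_Bij compose_eq Pi_iff)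
  qed
  then show ?thesis
    unfolding isometry_group_def using subgroup.subgroup_is_group[OF _ group_BijGroup] by blast
qed

lemma mult_isometry_group:
  assumes "a \<in> carrier (isometry_group M d)" "b \<in> carrier (isometry_group M d)" "y \<in> M"
  shows "(a \<otimes>\<^bsub>isometry_group M d\<^esub> b) y = a (b y)"
  using assms unfolding isometry_group_def by (simp add: BijGroup_def compose_eq)

lemma subgroup_of_isometries:
  assumes ms: "\<And>i. i \<in> I \<Longrightarrow> Metric_space (X i) (d i)"
    and \<Gamma>: "subgroup \<Gamma> (product_group I (\<lambda>i. isometry_group (X i) (d i)))"
  shows "\<And>a i. a \<in> \<Gamma> \<Longrightarrow> i \<in> I \<Longrightarrow> a i \<in> carrier (isometry_group (X i) (d i))"
    and "\<And>a b. a \<in> \<Gamma> \<Longrightarrow> b \<in> \<Gamma> \<Longrightarrow> \<exists>c\<in>\<Gamma>. \<forall>i\<in>I. \<forall>y\<in>X i. c i y = a i (b i y)"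
    and "\<And>a. a \<in> \<Gamma> \<Longrightarrow> \<exists>c\<in>\<Gamma>. \<forall>i\<in>I. \<forall>y\<in>X i. a i (c i y) = y \<and> c i (a i y) = y"
proof -
  let ?G = "product_group I (\<lambda>i. isometry_group (X i) (d i))"
  interpret G: group ?G by (rule product_group) (rule group_isometry_group[OF ms])
  interpret S: subgroup \<Gamma> ?G by (rule \<Gamma>)
  show car: "a i \<in> carrier (isometry_group (X i) (d i))" if "a \<in> \<Gamma>" "i \<in> I" for a i
    using S.mem_carrier[OF that(1)] that(2) by (auto simp: PiE_mem)
  have mult: "(a \<otimes>\<^bsub>?G\<^esub> b) i y = a i (b i y)" if "a \<in> \<Gamma>" "b \<in> \<Gamma>" "i \<in> I" "y \<in> X i" for a b i y
    using mult_isometry_group[OF car[OF that(1,3)] car[OF that(2,3)] that(4)] that(3) by simp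
  show "\<exists>c\<in>\<Gamma>. \<forall>i\<in>I. \<forall>y\<in>X i. c i y = a i (b i y)" if "a \<in> \<Gamma>" "b \<in> \<Gamma>" for a b
    using S.m_closed[OF that] mult[OF that] by blast
  show "\<exists>c\<in>\<Gamma>. \<forall>i\<in>I. \<forall>y\<in>X i. a i (c i y) = y \<and> c i (a i y) = y" if a: "a \<in> \<Gamma>" for a
  proof (intro bexI ballI)
    let ?c = "inv\<^bsub>?G\<^esub> a"
    show c: "?c \<in> \<Gamma>" by (rule S.m_inv_closed[OF a])
    fix i y assume iy: "i \<in> I" "y \<in> X i"
    have one: "\<one>\<^bsub>?G\<^esub> i y = y" using iy by (simp add: isometry_group_def BijGroup_def)
    show "a i (?c i y) = y \<and> ?c i (a i y) = y"
      using mult[OF a c iy, unfolded G.r_inv[OF S.mem_carrier[OF a]] one]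
        mult[OF c a iy, unfolded G.l_inv[OF S.mem_carrier[OF a]] one] by (intro conjI) (rule sym, assumption)+
  qed
qed

context CN_product
begin

lemma join_orbit_points:
  assumes \<Gamma>: "subgroup \<Gamma> (product_group I (\<lambda>i. isometry_group (X i) (d i)))"
    and gh: "g \<in> \<Gamma>" "h \<in> \<Gamma>" "\<And>i. i \<in> I \<Longrightarrow> independent_rank_one (X i) (d i) (g i) (h i)"
    and x: "x \<in> P"
  defines "S \<equiv> (\<lambda>\<gamma>. prod_action I \<gamma> x) ` \<Gamma>"
  obtains B where "S \<subseteq> P" "joining x S B"
proof -
  have mult: "\<exists>c\<in>\<Gamma>. \<forall>i\<in>I. \<forall>y\<in>X i. c i y = a i (b i y)" if "a \<in> \<Gamma>" "b \<in> \<Gamma>" for a b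
    by (rule subgroup_of_isometries(2)[OF ms \<Gamma> that])
  have inv: "\<exists>c\<in>\<Gamma>. \<forall>i\<in>I. \<forall>y\<in>X i. a i (c i y) = y \<and> c i (a i y) = y" if "a \<in> \<Gamma>" for a
    by (rule subgroup_of_isometries(3)[OF ms \<Gamma> that])
  have iso: "CN_space.isom (X i) (d i) (a i)" if "a \<in> \<Gamma>" "i \<in> I" for a i
    by (rule CN_space.isometry_group_imp_isom[OF cn[OF that(2)]
          subgroup_of_isometries(1)[OF ms \<Gamma> that]])
  have xi: "x i \<in> X i" if "i \<in> I" for i using x that by (simp add: PiE_mem)
  have a_in: "a i y \<in> X i" if "a \<in> \<Gamma>" "i \<in> I" "y \<in> X i" for a i y
    using CN_space.isom_in[OF cn[OF that(2)] iso[OF that(1,2)] that(3)] .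
  have pow: "\<exists>c\<in>\<Gamma>. \<forall>i\<in>I. \<forall>y\<in>X i. c i y = (a i ^^ m) y" if a: "a \<in> \<Gamma>" for a and m :: nat
  proof (induction m)
    case 0
    obtain b where b: "b \<in> \<Gamma>" "\<forall>i\<in>I. \<forall>y\<in>X i. a i (b i y) = y \<and> b i (a i y) = y" using inv[OF a] by blast
    obtain c where "c \<in> \<Gamma>" "\<forall>i\<in>I. \<forall>y\<in>X i. c i y = a i (b i y)" using mult[OF a b(1)] by blast
    then show ?case using b(2) by (intro bexI[of _ c]) auto
  next
    case (Suc m)
    then obtain b where b: "b \<in> \<Gamma>" "\<forall>i\<in>I. \<forall>y\<in>X i. b i y = (a i ^^ m) y" by blast
    obtain c where "c \<in> \<Gamma>" "\<forall>i\<in>I. \<forall>y\<in>X i. c i y = a i (b i y)" using mult[OF a b(1)] by blast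
    then show ?case using b(2) by (intro bexI[of _ c]) auto
  qed
  define n where "n = card I"
  have "\<forall>i\<in>I. \<exists>p. joining_data (X i) (d i) (g i) (h i) (x i) n p"
    using ex_joining_data[OF factor gh(3) xi] by blast
  from bchoice[OF this] obtain p where p: "\<And>i. i \<in> I \<Longrightarrow> joining_data (X i) (d i) (g i) (h i) (x i) n (p i)"
    by blast
  define U V N0 B0 where "U i = fst (p i)" and "V i = fst (snd (p i))"
    and "N0 i = fst (snd (snd (p i)))" and "B0 i = snd (snd (snd (p i)))" for i
  have J: "\<And>i y j k. \<lbrakk>i \<in> I; y \<in> X i; j < k; k \<le> n\<rbrakk> \<Longrightarrow> \<not> (U i j y \<and> U i k y)"
    "\<And>i y j k. \<lbrakk>i \<in> I; y \<in> X i; j < k; k \<le> n\<rbrakk> \<Longrightarrow> \<not> (V i j y \<and> V i k y)"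
    "\<And>i N j k y w. \<lbrakk>i \<in> I; N0 i \<le> N; k \<le> n; y \<in> X i; w \<in> X i; \<not> U i k y; \<not> V i j ((g i ^^ j) w)\<rbrakk> \<Longrightarrow>
       \<exists>u\<in>{0..1}. d i (fpt i y ((g i ^^ k) ((h i ^^ N) w)) u) (x i) \<le> B0 i"
    using p unfolding joining_data_def U_def V_def N0_def B0_def by (simp_all add: split_beta)
  \<comment> \<open>One exponent above all thresholds, since the same power of h has to serve in
    every factor.\<close>
  define N where "N = (\<Sum>i\<in>I. N0 i)"
  have N: "N0 i \<le> N" if "i \<in> I" for i unfolding N_def using that finite_I by (intro member_le_sum) auto
  define B where "B = (\<Sum>i\<in>I. max 0 (B0 i))"
  have B: "B0 i \<le> B" if "i \<in> I" for i
    using member_le_sum[of i I "\<lambda>i. max 0 (B0 i)"] that finite_I by (simp add: B_def)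
  \<comment> \<open>On every factor a acts as \<open>g\<^sup>k h\<^sup>N g\<^sup>-\<^sup>j\<close>;
    the preimage w takes the place of the inverse power.\<close>
  define carries where "carries k j a \<longleftrightarrow> a \<in> \<Gamma> \<and> (\<forall>i\<in>I. \<forall>z\<in>X i. \<exists>w\<in>X i.
      (g i ^^ j) w = z \<and> a i z = (g i ^^ k) ((h i ^^ N) w))" for k j a
  have "\<exists>a. carries k j a" for k j
  proof -
    obtain G where G: "G \<in> \<Gamma>" "\<forall>i\<in>I. \<forall>y\<in>X i. G i y = (g i ^^ j) y" using pow[OF gh(1)] by blast
    obtain G' where G': "G' \<in> \<Gamma>" "\<forall>i\<in>I. \<forall>y\<in>X i. G i (G' i y) = y \<and> G' i (G i y) = y" using inv[OF G(1)] by blast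
    obtain K where K: "K \<in> \<Gamma>" "\<forall>i\<in>I. \<forall>y\<in>X i. K i y = (g i ^^ k) y" using pow[OF gh(1)] by blast
    obtain H where H: "H \<in> \<Gamma>" "\<forall>i\<in>I. \<forall>y\<in>X i. H i y = (h i ^^ N) y" using pow[OF gh(2)] by blast
    obtain b where b: "b \<in> \<Gamma>" "\<forall>i\<in>I. \<forall>y\<in>X i. b i y = H i (G' i y)" using mult[OF H(1) G'(1)] by blast
    obtain a where a: "a \<in> \<Gamma>" "\<forall>i\<in>I. \<forall>y\<in>X i. a i y = K i (b i y)" using mult[OF K(1) b(1)] by blast
    have "\<exists>w\<in>X i. (g i ^^ j) w = z \<and> a i z = (g i ^^ k) ((h i ^^ N) w)" if i: "i \<in> I" and z: "z \<in> X i" for i z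
    proof (rule bexI[of _ "G' i z"])
      show w: "G' i z \<in> X i" by (rule a_in[OF G'(1) i z])
      have "H i (G' i z) \<in> X i" by (rule a_in[OF H(1) i w])
      then show "(g i ^^ j) (G' i z) = z \<and> a i z = (g i ^^ k) ((h i ^^ N) (G' i z))"
        using G(2) G'(2) K(2) H(2) a(2) b(2) i z w by metis
    qed
    then show ?thesis using a(1) unfolding carries_def by blast
  qed
  then obtain A where "\<And>k j. carries k j (A k j)" by metis
  then have A: "\<And>k j. A k j \<in> \<Gamma>"
    "\<And>k j i z. \<lbrakk>i \<in> I; z \<in> X i\<rbrakk> \<Longrightarrow> \<exists>w\<in>X i. (g i ^^ j) w = z \<and> A k j i z = (g i ^^ k) ((h i ^^ N) w)"
    unfolding carries_def by blast+
  have "\<exists>C. \<forall>\<beta>\<in>\<Gamma>. \<exists>\<delta>\<in>\<Gamma>. \<forall>i\<in>I.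
      (\<exists>u\<in>{0..1}. d i (fpt i (x i) (\<delta> i (x i)) u) (\<alpha> i (x i)) \<le> B) \<and>
      \<bar>d i (x i) (\<delta> i (x i)) - d i (x i) (\<beta> i (x i))\<bar> \<le> C" if \<alpha>: "\<alpha> \<in> \<Gamma>" for \<alpha>
  proof (intro exI ballI)
    define T where "T = I \<times> {..n} \<times> {..n}"
    \<comment> \<open>Summing over all factors and all pairs k, j makes the bound independent of
      \<beta>, which is fixed only afterwards.\<close>
    define C where "C = (\<Sum>(i, k, j)\<in>T. d i (x i) (\<alpha> i (A k j i (x i))))"
    have C: "d i (x i) (\<alpha> i (A k j i (x i))) \<le> C" if "i \<in> I" "k \<le> n" "j \<le> n" for i k j
    proof -
      have "(i, k, j) \<in> T" "finite T" using that finite_I by (auto simp: T_def)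
      then show ?thesis
        using member_le_sum[of "(i, k, j)" T "\<lambda>(i, k, j). d i (x i) (\<alpha> i (A k j i (x i)))"]
          Metric_space.nonneg[OF ms] unfolding C_def by (auto simp: T_def)
    qed
    fix \<beta> assume \<beta>: "\<beta> \<in> \<Gamma>"
    obtain \<alpha>' where \<alpha>': "\<alpha>' \<in> \<Gamma>" "\<forall>i\<in>I. \<forall>y\<in>X i. \<alpha> i (\<alpha>' i y) = y \<and> \<alpha>' i (\<alpha> i y) = y"
      using inv[OF \<alpha>] by blast
    define y z where "y i = \<alpha>' i (x i)" and "z i = \<beta> i (x i)" for i
    have yz: "y i \<in> X i" "z i \<in> X i" "\<alpha> i (y i) = x i" if "i \<in> I" for i
      using a_in[OF \<alpha>'(1) that xi[OF that]] a_in[OF \<beta> that xi[OF that]] \<alpha>'(2) xi[OF that] that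
      by (auto simp: y_def z_def)
    \<comment> \<open>k depends on y only and j on z only, so the two pigeonhole choices do not
      interfere.\<close>
    obtain k where k: "k \<le> n" "\<And>i. i \<in> I \<Longrightarrow> \<not> U i k (y i)"
      using pigeonhole_avoid[OF finite_I, of "\<lambda>i k. U i k (y i)"] J(1) yz(1) unfolding n_def by metis
    obtain j where j: "j \<le> n" "\<And>i. i \<in> I \<Longrightarrow> \<not> V i j (z i)"
      using pigeonhole_avoid[OF finite_I, of "\<lambda>i k. V i k (z i)"] J(2) yz(2) unfolding n_def by metis
    obtain b where b: "b \<in> \<Gamma>" "\<forall>i\<in>I. \<forall>y\<in>X i. b i y = \<alpha> i (A k j i y)"
      using mult[OF \<alpha> A(1)] by blast
    obtain \<delta> where \<delta>: "\<delta> \<in> \<Gamma>" "\<forall>i\<in>I. \<forall>y\<in>X i. \<delta> i y = b i (\<beta> i y)"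
      using mult[OF b(1) \<beta>] by blast
    have "(\<exists>u\<in>{0..1}. d i (fpt i (x i) (\<delta> i (x i)) u) (\<alpha> i (x i)) \<le> B) \<and>
      \<bar>d i (x i) (\<delta> i (x i)) - d i (x i) (\<beta> i (x i))\<bar> \<le> C" if i: "i \<in> I" for i
    proof
      interpret CN_space "X i" "d i" by (rule cn[OF i])
      have \<delta>b: "\<delta> i (x i) = b i (z i)" using \<delta>(2) i xi[OF i] by (simp add: z_def)
      then have \<delta>i: "\<delta> i (x i) = \<alpha> i (A k j i (z i))" using b(2) i yz(2)[OF i] by simp
      obtain w where w: "w \<in> X i" "(g i ^^ j) w = z i" "A k j i (z i) = (g i ^^ k) ((h i ^^ N) w)"
        using A(2)[OF i yz(2)[OF i]] by blast
      obtain u where u: "u \<in> {0..1}" "d i (pt (y i) (A k j i (z i)) u) (x i) \<le> B0 i"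
        using J(3)[OF i N[OF i] k(1) yz(1)[OF i] w(1) k(2)[OF i], of j] j(2)[OF i] w(2,3) by auto
      have Az: "A k j i (z i) \<in> X i" by (rule a_in[OF A(1) i yz(2)[OF i]])
      \<comment> \<open>\<alpha> carries the segment that starts at y i and passes near x i to one
        that starts at x i and passes near \<alpha> i (x i).\<close>
      have "pt (x i) (\<delta> i (x i)) u = \<alpha> i (pt (y i) (A k j i (z i)) u)"
        using isom_pt[OF iso[OF \<alpha> i] yz(1)[OF i] Az] u(1) \<delta>i yz(3)[OF i] by simp
      then have "d i (pt (x i) (\<delta> i (x i)) u) (\<alpha> i (x i)) \<le> B"
        using isom_dist[OF iso[OF \<alpha> i] pt_in[OF yz(1)[OF i] Az] xi[OF i], of u] u B[OF i] by simp
      then show "\<exists>u\<in>{0..1}. d i (pt (x i) (\<delta> i (x i)) u) (\<alpha> i (x i)) \<le> B" using u(1) by blast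
      have "\<bar>d i (x i) (b i (z i)) - d i (x i) (z i)\<bar> \<le> d i (x i) (b i (x i))"
        by (rule isom_displacement[OF iso[OF b(1) i] xi[OF i] yz(2)[OF i]])
      also have "b i (x i) = \<alpha> i (A k j i (x i))" using b(2) i xi[OF i] by simp
      finally show "\<bar>d i (x i) (\<delta> i (x i)) - d i (x i) (\<beta> i (x i))\<bar> \<le> C"
        using C[OF i k(1) j(1)] \<delta>b by (simp add: z_def)
    qed
    then show "\<exists>\<delta>\<in>\<Gamma>. \<forall>i\<in>I. (\<exists>u\<in>{0..1}. d i (fpt i (x i) (\<delta> i (x i)) u) (\<alpha> i (x i)) \<le> B) \<and>
      \<bar>d i (x i) (\<delta> i (x i)) - d i (x i) (\<beta> i (x i))\<bar> \<le> C" using \<delta>(1) by blast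
  qed
  then have "joining x S B"
    unfolding joining_def S_def prod_action_def by simp
  moreover have "S \<subseteq> P"
    using a_in xi unfolding S_def prod_action_def by auto
  ultimately show ?thesis using that by blast
qed

end

theorem theoremB:
  fixes r :: nat
    and X :: "nat \<Rightarrow> 'a set"
    and d :: "nat \<Rightarrow> 'a \<Rightarrow> 'a \<Rightarrow> real"
    and \<Gamma> :: "(nat \<Rightarrow> 'a \<Rightarrow> 'a) set"
    and x :: "nat \<Rightarrow> 'a"
  assumes "r \<ge> 1"
    and "\<And>i. i \<in> {1..r} \<Longrightarrow> hadamard_space (X i) (d i)"
    and "\<And>i. i \<in> {1..r} \<Longrightarrow> locally_compact_space (Metric_space.mtopology (X i) (d i))"
    and "subgroup \<Gamma> (product_group {1..r} (\<lambda>i. isometry_group (X i) (d i)))"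
    and "acts_properly_discontinuously {1..r} X d \<Gamma>"
    and "\<exists>g\<in>\<Gamma>. \<exists>h\<in>\<Gamma>. independent_regular_axial {1..r} X d g h"
    and "x \<in> Pi\<^sub>E {1..r} X"
  shows "regular_boundary_map {1..r} X d `
           (limit_set {1..r} X d \<Gamma> x \<inter> regular_boundary {1..r} X d) =
         furstenberg_limit_set {1..r} X d \<Gamma> x \<times> regular_slopes {1..r} X d \<Gamma> x"
proof -
  let ?I = "{1..r}"
  have factor: "proper_CN_space (X i) (d i)" if "i \<in> ?I" for i
    by (rule hadamard_imp_proper_CN_space[OF assms(2,3)[OF that]])
  obtain g h where gh: "g \<in> \<Gamma>" "h \<in> \<Gamma>" "independent_regular_axial ?I X d g h"
    using assms(6) by blast
  have ind: "independent_rank_one (X i) (d i) (g i) (h i)" if "i \<in> ?I" for i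
    using gh(3) that unfolding independent_regular_axial_def by blast
  interpret CN_product ?I X d
  proof (rule CN_product.intro)
    show "finite ?I" by simp
    show "proper_CN_space (X i) (d i)" if "i \<in> ?I" for i by (rule factor[OF that])
    show "\<exists>c. geodesic_ray (X i) (d i) c" if i: "i \<in> ?I" for i
    proof -
      obtain \<sigma> where "is_axis (X i) (d i) (g i) \<sigma>"
        using ind[OF i] unfolding independent_rank_one_def rank_one_def by blast
      then have "geodesic_ray (X i) (d i) \<sigma>"
        unfolding is_axis_def geodesic_line_def geodesic_ray_def by blast
      then show ?thesis by blast
    qed
  qed
  define S where "S = (\<lambda>\<gamma>. prod_action ?I \<gamma> x) ` \<Gamma>"
  obtain B where SP: "S \<subseteq> P" and join: "joining x S B"
    unfolding S_def using join_orbit_points[OF assms(4) gh(1,2) ind assms(7)] by blast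
  have limit: "endpoint P D (prod_ray ?I \<sigma>s \<theta>) \<in> limit_set ?I X d \<Gamma> x \<longleftrightarrow>
      (\<forall>R>0. \<exists>y\<in>S. R < D x y \<and> D (P.gp x y R) (prod_ray ?I \<sigma>s \<theta> R) < 1)"
    if "\<And>i. i \<in> ?I \<Longrightarrow> geodesic_ray (X i) (d i) (\<sigma>s i)" "\<And>i. i \<in> ?I \<Longrightarrow> \<sigma>s i 0 = x i" "\<theta> \<in> E_plus ?I"
    for \<sigma>s \<theta>
  proof -
    have "prod_ray ?I \<sigma>s \<theta> 0 = x"
      unfolding prod_ray_def using that(2) assms(7) by (auto simp: PiE_iff extensional_def fun_eq_iff)
    then show ?thesis
      using P.endpoint_in_boundary_limit_points_iff[OF
          ray_decomposition_imp_ray[OF prod_ray_decomposition[OF that(1,3)]] SP]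
      unfolding limit_set_def S_def by simp
  qed
  show ?thesis
  proof (intro equalityI subsetI)
    fix q assume "q \<in> regular_boundary_map ?I X d ` (limit_set ?I X d \<Gamma> x \<inter> regular_boundary ?I X d)"
    then show "q \<in> furstenberg_limit_set ?I X d \<Gamma> x \<times> regular_slopes ?I X d \<Gamma> x"
      unfolding furstenberg_limit_set_def regular_slopes_def regular_boundary_map_def by blast
  next
    fix q assume "q \<in> furstenberg_limit_set ?I X d \<Gamma> x \<times> regular_slopes ?I X d \<Gamma> x"
    then obtain \<xi> \<xi>' where q: "q = (furstenberg_proj ?I X d \<xi>, ray_slope ?I X d \<xi>')"
      and \<xi>: "\<xi> \<in> limit_set ?I X d \<Gamma> x" "\<xi> \<in> regular_boundary ?I X d"
      and \<xi>': "\<xi>' \<in> limit_set ?I X d \<Gamma> x" "\<xi>' \<in> regular_boundary ?I X d"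
      unfolding furstenberg_limit_set_def regular_slopes_def by blast
    obtain \<sigma>s \<theta> where c: "\<And>i. i \<in> ?I \<Longrightarrow> geodesic_ray (X i) (d i) (\<sigma>s i)" "\<And>i. i \<in> ?I \<Longrightarrow> \<sigma>s i 0 = x i"
      "\<theta> \<in> E_plus ?I" "\<xi> = endpoint P D (prod_ray ?I \<sigma>s \<theta>)"
      using regular_boundary_cases[OF \<xi>(2) assms(7)] by blast
    obtain \<sigma>s' \<theta>' where c': "\<And>i. i \<in> ?I \<Longrightarrow> geodesic_ray (X i) (d i) (\<sigma>s' i)" "\<And>i. i \<in> ?I \<Longrightarrow> \<sigma>s' i 0 = x i"
      "\<theta>' \<in> E_plus ?I" "\<xi>' = endpoint P D (prod_ray ?I \<sigma>s' \<theta>')"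
      using regular_boundary_cases[OF \<xi>'(2) assms(7)] by blast
    \<comment> \<open>The component rays of \<xi>, run through at the speeds of \<xi>'.\<close>
    define \<zeta> where "\<zeta> = endpoint P D (prod_ray ?I \<sigma>s \<theta>')"
    have 1: "\<And>R. 0 < R \<Longrightarrow> \<exists>y\<in>S. R < D x y \<and> D (P.gp x y R) (prod_ray ?I \<sigma>s \<theta> R) < 1"
      using \<xi>(1) limit[OF c(1-3)] unfolding c(4) by blast
    have 2: "\<And>R. 0 < R \<Longrightarrow> \<exists>y\<in>S. R < D x y \<and> D (P.gp x y R) (prod_ray ?I \<sigma>s' \<theta>' R) < 1"
      using \<xi>'(1) limit[OF c'(1-3)] unfolding c'(4) by blast
    have "\<exists>y\<in>S. R < D x y \<and> D (P.gp x y R) (prod_ray ?I \<sigma>s \<theta>' R) < 1" if "0 < R" for R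
      by (rule combine_direction_and_slope[OF SP assms(7) join c(1-3) c'(1-3) 1 2 that])
    then have "\<zeta> \<in> limit_set ?I X d \<Gamma> x"
      unfolding \<zeta>_def using limit[OF c(1,2) c'(3)] by blast
    moreover have "\<zeta> \<in> regular_boundary ?I X d"
      unfolding \<zeta>_def by (rule regular_endpoint(1)[OF c(1) c'(3)])
    moreover have "regular_boundary_map ?I X d \<zeta> = q"
      using regular_endpoint(2)[OF c(1) c'(3)] regular_endpoint(2)[OF c(1,3)] regular_endpoint(2)[OF c'(1,3)]
      unfolding q \<zeta>_def c(4) c'(4) regular_boundary_map_def by simp
    ultimately show "q \<in> regular_boundary_map ?I X d ` (limit_set ?I X d \<Gamma> x \<inter> regular_boundary ?I X d)"
      by blast
  qed
qed

end
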